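(* Let $\Omega\subset\mathbb{R}^n$ be an open set and let $V$ be a $d$-varifold in $\Omega$ of finite mass $\|V\|(\Omega)<+\infty$. Assume that: (i) there exist $0<C_1<C_2$ such that for $\|V\|$-almost every $x\in\Omega$ and for all $0<r<d(x,\Omega^c)$ such that $B_r(x)\subset\Omega$, $$C_1\,\omega_d\, r^d\le \|V\|(B_r(x))\le C_2\,\omega_d\, r^d ;$$ (ii) $V\left(\{(x,P)\in\Omega\times G_{d,n} : E_0(x,P,V)=+\infty\}\right)=0$. Then $V$ is a rectifiable $d$-varifold.
   Context: $d,n$ are integers with $1\le d<n$. $G_{d,n}$ is the set of $d$-dimensional vector subspaces of $\mathbb{R}^n$, with the metric $d(T,P)=\|\Pi_T-\Pi_P\|$, where $\Pi_P$ is the orthogonal projection onto $P$. $B_r(x)$ is the open ball, $\omega_d$ is the volume of the unit ball of $\mathbb{R}^d$, and $d(x,\Omega^c)$ is the distance from $x$ to $\mathbb{R}^n\setminus\Omega$ ($+\infty$ if $\Omega=\mathbb{R}^n$). $d(z,P)$ for $z\in\mathbb{R}^n$ is the Euclidean distance from $z$ to the subspace $P$. A $d$-varifold in $\Omega$ is a positive Radon measure $V$ on $\Omega\times G_{d,n}$. Its mass $\|V\|$ is the positive Radon measure on $\Omega$ given by $\|V\|(B)=V(B\times G_{d,n})$ for Borel $B\subset\Omega$. The averaged height excess is $$E_0(x,P,V)=\int_{r=0}^1\frac1{r^d}\int_{y\in B_r(x)\cap\Omega}\left(\frac{d(y-x,P)}{r}\right)^2 d\|V\|(y)\,\frac{dr}{r}\in[0,+\infty].$$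 A set $M$ is countably $d$-rectifiable if $M\subset M_0\cup\bigcup_{i\in\mathbb{N}}f_i(\mathbb{R}^d)$ with $f_i:\mathbb{R}^d\to\mathbb{R}^n$ Lipschitz and $\mathcal{H}^d(M_0)=0$. A rectifiable $d$-varifold in $\Omega$ is a $d$-varifold of the form $V=\theta\,\mathcal{H}^d_{|M}\otimes\delta_{T_xM}$, i.e. $\int\varphi\,dV=\int_M\varphi(x,T_xM)\,\theta(x)\,d\mathcal{H}^d(x)$ for all $\varphi\in C_c(\Omega\times G_{d,n})$, where $M$ is countably $d$-rectifiable, $\theta$ is a non-negative Borel function with $\theta>0$ $\mathcal{H}^d$-a.e. on $M$, and $T_xM$ is the approximate tangent space at $x$, i.e. the $d$-plane $T_xM\in G_{d,n}$ such that $r^{-d}\int\varphi(\frac{y-x}{r})\,d\mu(y)\to\theta(x)\int_{T_xM}\varphi\,d\mathcal{H}^d$ as $r\downarrow0$ for all $\varphi\in C_c(\mathbb{R}^n)$, with $\mu=\theta\mathcal{H}^d_{|M}$ (it exists for $\mathcal{H}^d$-a.e. $x\in M$). *)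

theory Defs
  imports "HOL-Analysis.Analysis"
begin

text \<open>
  The normalisation by \<open>unit_ball_vol d * (diameter / 2) ^ d\<close> makes the \<open>d\<close>-dimensional Hausdorff
  measure of \<open>\<real>\<^sup>d\<close> equal to Lebesgue measure.  Boundedness of the covering sets is required because
  \<^const>\<open>diameter\<close> is unspecified on unbounded sets.  The definitions are meant for \<open>0 < d\<close>
  (for \<open>d = 0\<close> empty covering sets would count, as \<open>0 ^ 0 = 1\<close>).
\<close>

definition hausdorff_pre :: "nat \<Rightarrow> real \<Rightarrow> 'a::metric_space set \<Rightarrow> ennreal" where
  "hausdorff_pre d \<delta> A =
     (INF C \<in> {C :: nat \<Rightarrow> 'a set. A \<subseteq> (\<Union>i. C i) \<and> (\<forall>i. bounded (C i) \<and> diameter (C i) \<le> \<delta>)}.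
        \<Sum>i. ennreal (unit_ball_vol (real d) * (diameter (C i) / 2) ^ d))"

definition hausdorff_outer :: "nat \<Rightarrow> 'a::metric_space set \<Rightarrow> ennreal" where
  "hausdorff_outer d A = (SUP \<delta> \<in> {0<..}. hausdorff_pre d \<delta> A)"

text \<open>The measure lives on the Caratheodory-measurable sets; in particular it is complete.\<close>

definition hausdorff_measure :: "nat \<Rightarrow> 'a::metric_space measure" where
  "hausdorff_measure d =
     measure_of UNIV (lambda_system UNIV UNIV (hausdorff_outer d)) (hausdorff_outer d)"

definition grassmannian :: "nat \<Rightarrow> 'a::euclidean_space set set" where
  "grassmannian d = {P. subspace P \<and> dim P = d}"

definition orth_proj :: "'a::euclidean_space set \<Rightarrow> 'a \<Rightarrow> 'a" where
  "orth_proj P x = (THE y. y \<in> P \<and> (\<forall>z\<in>P. orthogonal (x - y) z))"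

text \<open>
  The value on pairs that are not subspaces is irrelevant; \<open>0\<close> is chosen because
  \<^locale>\<open>Metric_space\<close> asks for nonnegativity on the whole type.
\<close>

definition grass_dist :: "'a::euclidean_space set \<Rightarrow> 'a set \<Rightarrow> real" where
  "grass_dist P Q =
     (if subspace P \<and> subspace Q then onorm (\<lambda>x. orth_proj P x - orth_proj Q x) else 0)"

definition grass_topology :: "nat \<Rightarrow> 'a::euclidean_space set topology" where
  "grass_topology d = Metric_space.mtopology (grassmannian d) grass_dist"

definition borel_of :: "'a topology \<Rightarrow> 'a measure" where
  "borel_of X = sigma (topspace X) {U. openin X U}"

definition Cc :: "'a topology \<Rightarrow> ('a \<Rightarrow> real) set" where
  "Cc X = {\<phi>. continuous_map X euclideanreal \<phi> \<and>
              compactin X (X closure_of {x \<in> topspace X. \<phi> x \<noteq> 0})}"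

definition varifold_space ::
    "nat \<Rightarrow> 'a::euclidean_space set \<Rightarrow> ('a \<times> 'a set) topology" where
  "varifold_space d \<Omega> = prod_topology (top_of_set \<Omega>) (grass_topology d)"

text \<open>
  For open \<open>\<Omega>\<close> the space \<open>\<Omega> \<times> G\<close> is locally compact, metrizable and second countable, so a Borel
  measure that is finite on compact sets is automatically regular, i.e. Radon.
\<close>

definition varifold ::
    "nat \<Rightarrow> 'a::euclidean_space set \<Rightarrow> ('a \<times> 'a set) measure \<Rightarrow> bool" where
  "varifold d \<Omega> V \<longleftrightarrow>
     sets V = sets (borel_of (varifold_space d \<Omega>)) \<and>
     (\<forall>K. compactin (varifold_space d \<Omega>) K \<longrightarrow> emeasure V K < \<infinity>)"

definition mass ::
    "'a::euclidean_space set \<Rightarrow> ('a \<times> 'a set) measure \<Rightarrow> 'a measure" where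
  "mass \<Omega> V = distr V (restrict_space borel \<Omega>) fst"

definition height_excess ::
    "nat \<Rightarrow> 'a::euclidean_space set \<Rightarrow> 'a \<Rightarrow> 'a set \<Rightarrow> ('a \<times> 'a set) measure \<Rightarrow> ennreal" where
  "height_excess d \<Omega> x P V =
     (\<integral>\<^sup>+ r \<in> {0<..1}.
        ennreal (1 / r ^ d) *
        (\<integral>\<^sup>+ y \<in> ball x r \<inter> \<Omega>. ennreal ((infdist (y - x) P / r)\<^sup>2) \<partial>mass \<Omega> V) *
        ennreal (1 / r) \<partial>lborel)"

text \<open>Unlike \<^const>\<open>infdist\<close>, the following equals \<open>\<infinity>\<close> when \<open>\<Omega>\<close> is the whole space.\<close>

definition dist_compl :: "'a::metric_space \<Rightarrow> 'a set \<Rightarrow> ereal" where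
  "dist_compl x \<Omega> = (INF y \<in> - \<Omega>. ereal (dist x y))"

text \<open>
  The dimension \<open>d = CARD('d)\<close> is passed as a type, so that \<open>\<real>\<^sup>d\<close> is the type \<open>real ^ 'd\<close>;
  \<open>d \<ge> 1\<close> holds because types are nonempty.
\<close>

definition countably_rectifiable :: "'d::finite itself \<Rightarrow> 'a::euclidean_space set \<Rightarrow> bool" where
  "countably_rectifiable (_ :: 'd itself) M \<longleftrightarrow>
     (\<exists>M0 (f :: nat \<Rightarrow> real ^ 'd \<Rightarrow> 'a).
        hausdorff_outer CARD('d) M0 = 0 \<and> (\<forall>i. \<exists>L. L-lipschitz_on UNIV (f i)) \<and>
        M \<subseteq> M0 \<union> (\<Union>i. range (f i)))"

definition weighted_hausdorff ::
    "nat \<Rightarrow> 'a::metric_space set \<Rightarrow> ('a \<Rightarrow> real) \<Rightarrow> 'a measure" where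
  "weighted_hausdorff d M \<theta> =
     density (hausdorff_measure d) (\<lambda>x. ennreal (\<theta> x) * indicator M x)"

definition approx_tangent_space ::
    "nat \<Rightarrow> 'a::euclidean_space set \<Rightarrow> ('a \<Rightarrow> real) \<Rightarrow> 'a \<Rightarrow> 'a set \<Rightarrow> bool" where
  "approx_tangent_space d M \<theta> x P \<longleftrightarrow>
     P \<in> grassmannian d \<and>
     (\<forall>\<phi> \<in> Cc euclidean.
        ((\<lambda>r. 1 / r ^ d * (\<integral>y. \<phi> ((1 / r) *\<^sub>R (y - x)) \<partial>weighted_hausdorff d M \<theta>))
          \<longlongrightarrow> \<theta> x * (LINT y:P|hausdorff_measure d. \<phi> y)) (at_right 0))"

text \<open>
  Where \<open>\<theta> x > 0\<close> the approximate tangent space at \<open>x\<close> is unique, so the function \<open>T\<close> below is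
  determined almost everywhere on \<open>M\<close>.  The integrability clause makes sure that the right-hand
  integrals really exist, as the Bochner integral of a non-integrable function is \<open>0\<close> by convention.
\<close>

definition rectifiable_varifold ::
    "'d::finite itself \<Rightarrow> 'a::euclidean_space set \<Rightarrow> ('a \<times> 'a set) measure \<Rightarrow> bool" where
  "rectifiable_varifold (D :: 'd itself) \<Omega> V \<longleftrightarrow>
     varifold CARD('d) \<Omega> V \<and>
     (\<exists>M \<theta> T.
        M \<subseteq> \<Omega> \<and> M \<in> sets (hausdorff_measure CARD('d)) \<and> countably_rectifiable D M \<and>
        \<theta> \<in> borel_measurable borel \<and> (\<forall>x. 0 \<le> \<theta> x) \<and>
        (AE x in hausdorff_measure CARD('d). x \<in> M \<longrightarrow> 0 < \<theta> x) \<and>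
        (AE x in hausdorff_measure CARD('d).
           x \<in> M \<longrightarrow> approx_tangent_space CARD('d) M \<theta> x (T x)) \<and>
        (\<forall>\<phi> \<in> Cc (varifold_space CARD('d) \<Omega>).
           set_integrable (hausdorff_measure CARD('d)) M (\<lambda>x. \<phi> (x, T x) * \<theta> x) \<and>
           (\<integral>z. \<phi> z \<partial>V) =
             (LINT x:M|hausdorff_measure CARD('d). \<phi> (x, T x) * \<theta> x)))"

lemma hausdorff_pre_mono: "A \<subseteq> B \<Longrightarrow> hausdorff_pre d \<delta> A \<le> hausdorff_pre d \<delta> B"
  unfolding hausdorff_pre_def by (rule INF_superset_mono) auto

lemma hausdorff_pre_antimono: "\<delta> \<le> \<epsilon> \<Longrightarrow> hausdorff_pre d \<epsilon> A \<le> hausdorff_pre d \<delta> A"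
  unfolding hausdorff_pre_def by (rule INF_superset_mono) (auto intro: order_trans)

lemma hausdorff_outer_mono: "A \<subseteq> B \<Longrightarrow> hausdorff_outer d A \<le> hausdorff_outer d B"
  unfolding hausdorff_outer_def by (rule SUP_mono) (auto intro: hausdorff_pre_mono)

lemma hausdorff_pre_le_outer: "0 < \<delta> \<Longrightarrow> hausdorff_pre d \<delta> A \<le> hausdorff_outer d A"
  unfolding hausdorff_outer_def by (rule SUP_upper) auto

lemma hausdorff_outer_empty:
  assumes "0 < d"
  shows "hausdorff_outer d {} = 0"
proof -
  have "hausdorff_pre d \<delta> ({} :: 'a set) \<le> 0" if "0 < \<delta>" for \<delta>
    unfolding hausdorff_pre_def
    by (rule INF_lower2[of "\<lambda>_. {}"]) (use that assms in \<open>auto simp: zero_power\<close>)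
  then show ?thesis
    by (auto simp: hausdorff_outer_def intro!: antisym SUP_least)
qed

lemma hausdorff_pre_UN:
  "hausdorff_pre d \<delta> (\<Union>i. A i) \<le> (\<Sum>i. hausdorff_pre d \<delta> (A i :: 'a::metric_space set))"
proof (rule ennreal_le_epsilon)
  fix e :: real
  assume fin: "(\<Sum>i. hausdorff_pre d \<delta> (A i)) < top" and e: "0 < e"
  let ?w = "\<lambda>C :: 'a set. ennreal (unit_ball_vol (real d) * (diameter C / 2) ^ d)"
  let ?e = "\<lambda>i. ennreal (e * (1/2) ^ Suc i)"
  have "\<exists>C. (A i \<subseteq> (\<Union>j. C j) \<and> (\<forall>j. bounded (C j) \<and> diameter (C j) \<le> \<delta>)) \<and>
            (\<Sum>j. ?w (C j)) \<le> hausdorff_pre d \<delta> (A i) + ?e i" for i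
  proof -
    have "hausdorff_pre d \<delta> (A i) < top"
      using fin by (metis ennreal_suminf_lessD infinity_ennreal_def)
    moreover have "0 < ?e i" using e by simp
    ultimately have "hausdorff_pre d \<delta> (A i) < hausdorff_pre d \<delta> (A i) + ?e i"
      by (metis ennreal_add_left_cancel_less add.right_neutral infinity_ennreal_def less_irrefl)
    then show ?thesis
      unfolding hausdorff_pre_def INF_less_iff by (force intro: less_imp_le)
  qed
  then obtain C where C: "\<And>i. A i \<subseteq> (\<Union>j. C i j)"
      "\<And>i j. bounded (C i j)" "\<And>i j. diameter (C i j) \<le> \<delta>"
      "\<And>i. (\<Sum>j. ?w (C i j)) \<le> hausdorff_pre d \<delta> (A i) + ?e i"
    by metis
  let ?D = "\<lambda>n. case_prod C (prod_decode n)"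
  have "(\<Union>i. A i) \<subseteq> (\<Union>n. ?D n)"
  proof
    fix x assume "x \<in> (\<Union>i. A i)"
    then obtain i j where "x \<in> C i j" using C(1) by blast
    then have "x \<in> ?D (prod_encode (i, j))" by simp
    then show "x \<in> (\<Union>n. ?D n)" by (rule UN_I[OF UNIV_I])
  qed
  then have "hausdorff_pre d \<delta> (\<Union>i. A i) \<le> (\<Sum>n. ?w (?D n))"
    unfolding hausdorff_pre_def
    by (intro INF_lower) (auto simp: C split: prod.split)
  also have "(\<Sum>n. ?w (?D n)) = (\<Sum>i. \<Sum>j. ?w (C i j))"
    using suminf_ennreal_2dimen[of "\<lambda>i. \<Sum>j. ?w (C i j)" "\<lambda>p. ?w (case_prod C p)"]
    by (simp add: o_def)
  also have "\<dots> \<le> (\<Sum>i. hausdorff_pre d \<delta> (A i) + ?e i)"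
    by (intro suminf_le C(4)) auto
  also have "\<dots> = (\<Sum>i. hausdorff_pre d \<delta> (A i)) + (\<Sum>i. ?e i)"
    by (rule suminf_add[symmetric]) auto
  also have "(\<Sum>i. ?e i) = ennreal (\<Sum>i. e * (1/2) ^ Suc i)"
    using e by (intro suminf_ennreal2) (auto intro: summable_mult simp del: power_Suc
        simp: summable_Suc_iff[of "\<lambda>i. (1/2::real)^i"] summable_geometric)
  also have "(\<Sum>i. e * (1/2) ^ Suc i) = e"
    using power_half_series by (metis mult.right_neutral sums_mult sums_unique)
  finally show "hausdorff_pre d \<delta> (\<Union>i. A i) \<le> (\<Sum>i. hausdorff_pre d \<delta> (A i)) + ennreal e" .
qed

lemma hausdorff_outer_UN:
  "hausdorff_outer d (\<Union>i. A i) \<le> (\<Sum>i. hausdorff_outer d (A i))"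
proof -
  have "hausdorff_pre d \<delta> (\<Union>i. A i) \<le> (\<Sum>i. hausdorff_outer d (A i))" if "0 < \<delta>" for \<delta>
    using that by (intro order_trans[OF hausdorff_pre_UN] suminf_le hausdorff_pre_le_outer) auto
  then show ?thesis
    by (subst (1) hausdorff_outer_def) (auto intro!: SUP_least)
qed

lemma outer_measure_space_hausdorff:
  assumes "0 < d"
  shows "outer_measure_space UNIV (hausdorff_outer d)"
  using assms
  by (auto simp: outer_measure_space_def positive_def increasing_def countably_subadditive_def
      hausdorff_outer_empty intro: hausdorff_outer_mono hausdorff_outer_UN)

lemma hausdorff_outer_Un:
  assumes "0 < d"
  shows "hausdorff_outer d (A \<union> B) \<le> hausdorff_outer d A + hausdorff_outer d B"
proof -
  have "A \<union> B = (\<Union>i. binaryset A B i)" by (simp add: UN_binaryset_eq)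
  then have "hausdorff_outer d (A \<union> B) \<le> (\<Sum>i. hausdorff_outer d (binaryset A B i))"
    by (metis hausdorff_outer_UN)
  also have "\<dots> = hausdorff_outer d A + hausdorff_outer d B"
    by (rule suminf_binaryset_eq) (simp add: hausdorff_outer_empty assms)
  finally show ?thesis .
qed

lemma measure_space_hausdorff:
  assumes "0 < d"
  shows "measure_space UNIV (lambda_system UNIV UNIV (hausdorff_outer d)) (hausdorff_outer d)"
proof -
  interpret sigma_algebra UNIV "UNIV :: 'a set set"
    using sigma_algebra_Pow[of UNIV] by simp
  show ?thesis
    by (rule caratheodory_lemma[OF outer_measure_space_hausdorff[OF assms]])
qed

lemma space_hausdorff_measure [simp]: "space (hausdorff_measure d) = UNIV"
  by (simp add: hausdorff_measure_def space_measure_of_conv)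

lemma sets_hausdorff_measure:
  assumes "0 < d"
  shows "sets (hausdorff_measure d) = lambda_system UNIV UNIV (hausdorff_outer d)"
proof -
  interpret sigma_algebra UNIV "lambda_system UNIV UNIV (hausdorff_outer d :: 'a set \<Rightarrow> _)"
    using measure_space_hausdorff[OF assms, where 'a = 'a] by (simp add: measure_space_def)
  show ?thesis
    by (simp add: hausdorff_measure_def sets_measure_of_eq)
qed

lemma emeasure_hausdorff_measure:
  assumes "0 < d" "A \<in> sets (hausdorff_measure d)"
  shows "emeasure (hausdorff_measure d) A = hausdorff_outer d A"
  using measure_space_hausdorff[OF assms(1), where 'a = 'a] assms(2)
  unfolding sets_hausdorff_measure[OF assms(1)]
  unfolding hausdorff_measure_def measure_space_def
  by (elim conjE) (rule emeasure_measure_of_sigma)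

lemma hausdorff_null_sets_iff:
  assumes "0 < d"
  shows "A \<in> null_sets (hausdorff_measure d) \<longleftrightarrow> hausdorff_outer d A = 0"
proof
  assume "A \<in> null_sets (hausdorff_measure d)"
  then show "hausdorff_outer d A = 0"
    using emeasure_hausdorff_measure[OF assms, of A] by (auto simp: null_sets_def)
next
  assume A: "hausdorff_outer d A = 0"
  have "hausdorff_outer d (A \<inter> X) + hausdorff_outer d ((UNIV - A) \<inter> X) = hausdorff_outer d X" for X
  proof -
    have 0: "hausdorff_outer d (A \<inter> X) = 0"
      using hausdorff_outer_mono[of "A \<inter> X" A d] A by simp
    have "hausdorff_outer d X \<le> hausdorff_outer d (A \<inter> X) + hausdorff_outer d ((UNIV - A) \<inter> X)"
      by (rule order_trans[OF hausdorff_outer_mono hausdorff_outer_Un[OF assms]]) auto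
    moreover have "hausdorff_outer d ((UNIV - A) \<inter> X) \<le> hausdorff_outer d X"
      by (rule hausdorff_outer_mono) auto
    ultimately show ?thesis using 0 by simp
  qed
  then have "A \<in> sets (hausdorff_measure d)"
    by (simp add: sets_hausdorff_measure assms lambda_system_def)
  then show "A \<in> null_sets (hausdorff_measure d)"
    using A by (simp add: null_sets_def emeasure_hausdorff_measure assms)
qed

lemma hausdorff_outer_separated:
  fixes A B :: "'a::metric_space set"
  assumes "0 < d" and "0 < e" and sep: "\<And>x y. x \<in> A \<Longrightarrow> y \<in> B \<Longrightarrow> e \<le> dist x y"
  shows "hausdorff_outer d A + hausdorff_outer d B \<le> hausdorff_outer d (A \<union> B)"
proof -
  let ?w = "\<lambda>C :: 'a set. ennreal (unit_ball_vol (real d) * (diameter C / 2) ^ d)"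
  have w0: "?w {} = 0" using \<open>0 < d\<close> by (simp add: zero_power)
  have pre: "hausdorff_pre d \<delta> A + hausdorff_pre d \<delta> B \<le> hausdorff_pre d \<delta> (A \<union> B)"
    if \<delta>: "0 < \<delta>" "\<delta> < e" for \<delta>
    unfolding hausdorff_pre_def[of _ _ "A \<union> B"]
  proof (rule INF_greatest, clarify)
    fix C :: "nat \<Rightarrow> 'a set"
    assume cov: "A \<union> B \<subseteq> (\<Union>i. C i)" and C: "\<forall>i. bounded (C i) \<and> diameter (C i) \<le> \<delta>"
    define CA where "CA i = (if C i \<inter> A = {} then {} else C i)" for i
    define CB where "CB i = (if C i \<inter> B = {} then {} else C i)" for i
    have disj: "CA i = {} \<or> CB i = {}" for i
    proof (rule ccontr)
      assume "\<not> ?thesis"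
      then obtain x y where xy: "x \<in> C i" "x \<in> A" "y \<in> C i" "y \<in> B"
        by (auto simp: CA_def CB_def split: if_splits)
      then have "dist x y \<le> \<delta>"
        using diameter_bounded_bound[of "C i" x y] C by (meson order_trans)
      then show False using sep[OF xy(2) xy(4)] \<delta> by linarith
    qed
    have "hausdorff_pre d \<delta> A \<le> (\<Sum>i. ?w (CA i))"
      unfolding hausdorff_pre_def
    proof (rule INF_lower, safe)
      fix x assume "x \<in> A"
      then obtain i where "x \<in> C i" using cov by blast
      with \<open>x \<in> A\<close> have "x \<in> CA i" by (auto simp: CA_def)
      then show "x \<in> (\<Union>i. CA i)" by (rule UN_I[OF UNIV_I])
    qed (use C \<delta> in \<open>auto simp: CA_def\<close>)
    moreover have "hausdorff_pre d \<delta> B \<le> (\<Sum>i. ?w (CB i))"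
      unfolding hausdorff_pre_def
    proof (rule INF_lower, safe)
      fix x assume "x \<in> B"
      then obtain i where "x \<in> C i" using cov by blast
      with \<open>x \<in> B\<close> have "x \<in> CB i" by (auto simp: CB_def)
      then show "x \<in> (\<Union>i. CB i)" by (rule UN_I[OF UNIV_I])
    qed (use C \<delta> in \<open>auto simp: CB_def\<close>)
    ultimately have "hausdorff_pre d \<delta> A + hausdorff_pre d \<delta> B \<le> (\<Sum>i. ?w (CA i)) + (\<Sum>i. ?w (CB i))"
      by (rule add_mono)
    also have "\<dots> = (\<Sum>i. ?w (CA i) + ?w (CB i))"
      by (rule suminf_add) auto
    also have "\<dots> \<le> (\<Sum>i. ?w (C i))"
    proof (rule suminf_le)
      fix i
      consider "CA i = {}" "CB i = {}" | "CA i = {}" "CB i = C i" | "CA i = C i" "CB i = {}"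
        using disj[of i] unfolding CA_def CB_def by metis
      then show "?w (CA i) + ?w (CB i) \<le> ?w (C i)"
        by cases (simp_all only: w0 add_0_left add_0_right order_refl zero_le)
    qed auto
    finally show "hausdorff_pre d \<delta> A + hausdorff_pre d \<delta> B \<le> (\<Sum>i. ?w (C i))" .
  qed
  have "hausdorff_pre d \<delta> A + hausdorff_pre d \<epsilon> B \<le> hausdorff_outer d (A \<union> B)"
    if pos: "0 < \<delta>" "0 < \<epsilon>" for \<delta> \<epsilon>
  proof -
    define m where "m = min (min \<delta> \<epsilon>) (e / 2)"
    have m: "0 < m" "m < e" "m \<le> \<delta>" "m \<le> \<epsilon>" using pos \<open>0 < e\<close> by (auto simp: m_def)
    have "hausdorff_pre d \<delta> A + hausdorff_pre d \<epsilon> B \<le> hausdorff_pre d m A + hausdorff_pre d m B"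
      by (intro add_mono hausdorff_pre_antimono m)
    also have "\<dots> \<le> hausdorff_outer d (A \<union> B)"
      using pre[OF m(1,2)] hausdorff_pre_le_outer[OF m(1)] by (rule order_trans)
    finally show ?thesis .
  qed
  then have "(SUP \<delta>\<in>{0<..}. hausdorff_pre d \<delta> A + hausdorff_pre d \<epsilon> B) \<le> hausdorff_outer d (A \<union> B)"
    if "0 < \<epsilon>" for \<epsilon>
    using that by (intro SUP_least) auto
  then have "hausdorff_outer d A + hausdorff_pre d \<epsilon> B \<le> hausdorff_outer d (A \<union> B)"
    if "0 < \<epsilon>" for \<epsilon>
    using that by (simp add: ennreal_SUP_add_left hausdorff_outer_def[of d A])
  then have "(SUP \<epsilon>\<in>{0<..}. hausdorff_outer d A + hausdorff_pre d \<epsilon> B) \<le> hausdorff_outer d (A \<union> B)"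
    by (intro SUP_least) auto
  then show ?thesis
    by (simp add: ennreal_SUP_add_right hausdorff_outer_def[of d B])
qed

lemma closed_in_sets_hausdorff_measure:
  fixes F :: "'a::metric_space set"
  assumes d: "0 < d" and F: "closed F"
  shows "F \<in> sets (hausdorff_measure d)"
proof (cases "F = {}")
  case True
  then show ?thesis by simp
next
  case False
  let ?H = "hausdorff_outer d :: 'a set \<Rightarrow> ennreal"
  have main: "?H (F \<inter> X) + ?H (X - F) \<le> ?H X" for X
  proof (cases "?H X = top")
    case True
    then show ?thesis by simp
  next
    case False
    define q :: "nat \<Rightarrow> real" where "q n = 1 / (real n + 1)" for n
    have q: "q (Suc n) < q n" "0 < q n" for n by (auto simp: q_def field_simps)
    have qm: "q n \<le> q m" if "m \<le> n" for m n using that by (auto simp: q_def field_simps)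
    define A where "A n = {x \<in> X. q n \<le> infdist x F}" for n
    define R where "R n = A (Suc n) - A n" for n
    have sepA: "q n \<le> dist x y" if "x \<in> F \<inter> X" "y \<in> A n" for x y n
      using that infdist_le[of x F y] by (auto simp: A_def dist_commute)
    have one: "?H (F \<inter> X) + ?H (A n) \<le> ?H X" for n
      by (rule order_trans[OF hausdorff_outer_separated[OF d q(2)[of n]] hausdorff_outer_mono])
         (use sepA A_def in auto)
    have odd_even: "(\<Sum>i<n. ?H (R (2 * i + k))) \<le> ?H (\<Union>i<n. R (2 * i + k))" for n k
    proof (induction n)
      case 0
      then show ?case by simp
    next
      case (Suc n)
      show ?case
      proof (cases "2 * n + k")
        case 0
        then show ?thesis by (simp add: lessThan_Suc)
      next
        case (Suc m)
        have sep: "q m - q (Suc m) \<le> dist x y"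
          if "x \<in> (\<Union>i<n. R (2 * i + k))" "y \<in> R (2 * n + k)" for x y
        proof -
          obtain i where i: "i < n" "x \<in> R (2 * i + k)" using \<open>x \<in> _\<close> by blast
          then have "q (Suc (2 * i + k)) \<le> infdist x F" by (auto simp: R_def A_def)
          moreover have "q m \<le> q (Suc (2 * i + k))" using i Suc by (intro qm) auto
          moreover have "infdist y F < q (Suc m)"
            using that(2) Suc by (auto simp: R_def A_def)
          moreover have "infdist x F \<le> infdist y F + dist x y" by (rule infdist_triangle)
          ultimately show ?thesis by linarith
        qed
        have "(\<Sum>i<Suc n. ?H (R (2 * i + k))) \<le> ?H (\<Union>i<n. R (2 * i + k)) + ?H (R (2 * n + k))"
          using Suc.IH by (simp add: add_right_mono)
        also have "\<dots> \<le> ?H ((\<Union>i<n. R (2 * i + k)) \<union> R (2 * n + k))"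
          by (rule hausdorff_outer_separated[OF d, of "q m - q (Suc m)"])
             (use q(1)[of m] sep in auto)
        also have "(\<Union>i<n. R (2 * i + k)) \<union> R (2 * n + k) = (\<Union>i<Suc n. R (2 * i + k))"
          by (auto simp: lessThan_Suc)
        finally show ?thesis .
      qed
    qed
    have RX: "(\<Union>i<n. R (2 * i + k)) \<subseteq> X" for n k by (auto simp: R_def A_def)
    have half: "(\<Sum>i<n. ?H (R (2 * i + k))) \<le> ?H X" for n k
      using odd_even[of k n] hausdorff_outer_mono[OF RX] by (rule order_trans)
    have split: "(\<Sum>i<2 * n. ?H (R i)) = (\<Sum>i<n. ?H (R (2 * i + 0))) + (\<Sum>i<n. ?H (R (2 * i + 1)))" for n
      by (induction n) (simp_all add: ac_simps)
    have fin: "(\<Sum>i. ?H (R i)) \<le> ?H X + ?H X"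
    proof (rule suminf_le_const[OF summableI])
      fix n
      have "(\<Sum>i<n. ?H (R i)) \<le> (\<Sum>i<2 * n. ?H (R i))" by (rule sum_mono2) auto
      also have "\<dots> \<le> ?H X + ?H X" unfolding split by (intro add_mono half)
      finally show "(\<Sum>i<n. ?H (R i)) \<le> ?H X + ?H X" .
    qed
    define h where "h i = enn2real (?H (R i))" for i
    have "(\<Sum>i. ?H (R i)) < top"
      using fin False by (simp add: less_top order_le_less_trans)
    then have "?H (R i) < top" for i
      by (metis ennreal_suminf_lessD infinity_ennreal_def)
    then have h: "ennreal (h i) = ?H (R i)" for i by (simp add: h_def)
    have "summable h"
      using \<open>(\<Sum>i. ?H (R i)) < top\<close>
      by (intro summable_suminf_not_top) (auto simp: h, simp add: h_def)
    have "?H (X - F) \<le> ?H (A n) + (\<Sum>i. ?H (R (i + n)))" for n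
    proof -
      have "X - F \<subseteq> A n \<union> (\<Union>i. R (i + n))"
      proof
        fix x assume x: "x \<in> X - F"
        have "0 < infdist x F"
          using x F \<open>F \<noteq> {}\<close> infdist_pos_not_in_closed by auto
        then obtain m where m: "q m < infdist x F"
          unfolding q_def using nat_approx_posE by (metis add.commute of_nat_Suc)
        have "x \<in> (\<Union>i. R (i + n))" if "x \<notin> A n"
        proof -
          have xm: "x \<in> A m" using m x by (auto simp: A_def)
          define k where "k = (LEAST k. x \<in> A k)"
          have k: "x \<in> A k" unfolding k_def by (rule LeastI[of _ m]) (rule xm)
          have "n < k"
          proof (rule ccontr)
            assume "\<not> n < k"
            then have "A k \<subseteq> A n" using qm[of k n] by (auto simp: A_def)
            then show False using k \<open>x \<notin> A n\<close> by blast
          qed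
          then obtain l where l: "k = Suc (l + n)"
            by (metis add.commute less_imp_Suc_add)
          have "x \<notin> A (l + n)" using not_less_Least[of "l + n" "\<lambda>k. x \<in> A k"] l k_def by auto
          then have "x \<in> R (l + n)" using k l by (auto simp: R_def)
          then show ?thesis by (rule UN_I[OF UNIV_I])
        qed
        then show "x \<in> A n \<union> (\<Union>i. R (i + n))" by blast
      qed
      then have "?H (X - F) \<le> ?H (A n) + ?H (\<Union>i. R (i + n))"
        by (rule order_trans[OF hausdorff_outer_mono hausdorff_outer_Un[OF d]])
      then show ?thesis
        by (rule order_trans) (intro add_left_mono hausdorff_outer_UN)
    qed
    then have "?H (F \<inter> X) + ?H (X - F) \<le> ?H (F \<inter> X) + (?H (A n) + (\<Sum>i. ?H (R (i + n))))" for n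
      by (rule add_left_mono)
    then have tail: "?H (F \<inter> X) + ?H (X - F) \<le> ?H X + (\<Sum>i. ?H (R (i + n)))" for n
      unfolding add.assoc[symmetric] by (rule order_trans[OF _ add_right_mono[OF one[of n]]])
    show ?thesis
    proof (rule ennreal_le_epsilon)
      fix e :: real assume "0 < e"
      from suminf_exist_split[OF this \<open>summable h\<close>]
      obtain N where N: "norm (\<Sum>i. h (i + N)) < e" by blast
      have "(\<Sum>i. ?H (R (i + N))) = ennreal (\<Sum>i. h (i + N))"
        unfolding h[symmetric]
      proof (rule suminf_ennreal2)
        show "0 \<le> h (i + N)" for i by (simp add: h_def)
        show "summable (\<lambda>i. h (i + N))" using \<open>summable h\<close> by (simp only: summable_iff_shift)
      qed
      also have "\<dots> \<le> ennreal e" using N by (intro ennreal_leI) auto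
      finally show "?H (F \<inter> X) + ?H (X - F) \<le> ?H X + ennreal e"
        by (rule order_trans[OF tail[of N] add_left_mono])
    qed
  qed
  have "?H (F \<inter> X) + ?H ((UNIV - F) \<inter> X) = ?H X" for X
  proof (rule antisym)
    have eq: "(UNIV - F) \<inter> X = X - F" by auto
    show "?H (F \<inter> X) + ?H ((UNIV - F) \<inter> X) \<le> ?H X" unfolding eq by (rule main)
    show "?H X \<le> ?H (F \<inter> X) + ?H ((UNIV - F) \<inter> X)"
      by (rule order_trans[OF hausdorff_outer_mono hausdorff_outer_Un[OF d]]) auto
  qed
  then show ?thesis by (simp add: sets_hausdorff_measure d lambda_system_def)
qed

lemma borel_in_sets_hausdorff_measure:
  assumes "0 < d" "A \<in> sets borel"
  shows "A \<in> sets (hausdorff_measure d :: 'a::metric_space measure)"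
proof -
  have "sigma_sets UNIV (Collect closed) \<subseteq> sets (hausdorff_measure d :: 'a measure)"
    using sets.sigma_sets_subset[of "Collect closed" "hausdorff_measure d :: 'a measure"]
      closed_in_sets_hausdorff_measure[OF assms(1)] by auto
  then show ?thesis
    using assms(2) by (auto simp: borel_eq_closed)
qed

lemma orth_proj:
  fixes P :: "'a::euclidean_space set"
  assumes "subspace P"
  shows orth_proj_in: "orth_proj P x \<in> P"
    and orth_proj_orthogonal: "z \<in> P \<Longrightarrow> orthogonal (x - orth_proj P x) z"
    and orth_proj_unique:
      "\<lbrakk>y \<in> P; \<And>z. z \<in> P \<Longrightarrow> orthogonal (x - y) z\<rbrakk> \<Longrightarrow> orth_proj P x = y"
proof -
  have unique: "y = y'"
    if "y \<in> P" "\<And>z. z \<in> P \<Longrightarrow> orthogonal (x - y) z"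
       "y' \<in> P" "\<And>z. z \<in> P \<Longrightarrow> orthogonal (x - y') z" for y y'
  proof -
    have "y - y' \<in> P" using that assms by (simp add: subspace_diff)
    then have "orthogonal (x - y) (y - y')" "orthogonal (x - y') (y - y')" using that by auto
    then have "inner (y - y') (y - y') = 0" by (simp add: orthogonal_def inner_simps)
    then show ?thesis by simp
  qed
  obtain y w where y: "y \<in> span P" "\<And>z. z \<in> span P \<Longrightarrow> orthogonal w z" "x = y + w"
    using orthogonal_subspace_decomp_exists[of P x] by metis
  then have y': "y \<in> P" "\<And>z. z \<in> P \<Longrightarrow> orthogonal (x - y) z"
    using assms by (auto simp: span_eq_iff[THEN iffD2])
  then have ex: "y \<in> P \<and> (\<forall>z\<in>P. orthogonal (x - y) z)" by blast
  have "orth_proj P x \<in> P \<and> (\<forall>z\<in>P. orthogonal (x - orth_proj P x) z)"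
    unfolding orth_proj_def
    by (rule theI[of "\<lambda>y. y \<in> P \<and> (\<forall>z\<in>P. orthogonal (x - y) z)", OF ex])
       (use unique y' in blast)
  then show in_P: "orth_proj P x \<in> P"
    and orth: "z \<in> P \<Longrightarrow> orthogonal (x - orth_proj P x) z" for z by auto
  show "orth_proj P x = y" if "y \<in> P" "\<And>z. z \<in> P \<Longrightarrow> orthogonal (x - y) z" for y
    using unique in_P orth that by blast
qed

lemma bounded_linear_orth_proj:
  assumes "subspace P"
  shows "bounded_linear (orth_proj P)"
proof -
  have "linear (orth_proj P)"
  proof (rule linearI)
    fix x y
    show "orth_proj P (x + y) = orth_proj P x + orth_proj P y"
    proof (rule orth_proj_unique[OF assms])
      show "orth_proj P x + orth_proj P y \<in> P"
        by (intro subspace_add assms orth_proj_in)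
      fix z assume "z \<in> P"
      then show "orthogonal (x + y - (orth_proj P x + orth_proj P y)) z"
        using orth_proj_orthogonal[OF assms, of z x] orth_proj_orthogonal[OF assms, of z y]
        by (simp add: orthogonal_def inner_simps)
    qed
  next
    fix c x
    show "orth_proj P (c *\<^sub>R x) = c *\<^sub>R orth_proj P x"
    proof (rule orth_proj_unique[OF assms])
      show "c *\<^sub>R orth_proj P x \<in> P"
        by (intro subspace_scale assms orth_proj_in)
      fix z assume "z \<in> P"
      then show "orthogonal (c *\<^sub>R x - c *\<^sub>R orth_proj P x) z"
        using orth_proj_orthogonal[OF assms, of z x]
        by (simp add: orthogonal_def inner_simps)
    qed
  qed
  then show ?thesis by (rule linear_conv_bounded_linear[THEN iffD1])
qed

lemma Metric_space_grassmannian: "Metric_space (grassmannian d) grass_dist"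
proof
  fix P Q R :: "'a set"
  have bl: "bounded_linear (\<lambda>x. orth_proj P x - orth_proj Q x)"
    if "subspace P" "subspace Q" for P Q :: "'a set"
    using that by (intro bounded_linear_sub bounded_linear_orth_proj)
  show "0 \<le> grass_dist P Q"
    by (simp add: grass_dist_def onorm_pos_le bl)
  have "onorm (\<lambda>x. orth_proj P x - orth_proj Q x) = onorm (\<lambda>x. orth_proj Q x - orth_proj P x)"
    using onorm_neg[of "\<lambda>x. orth_proj P x - orth_proj Q x"] by simp
  then show "grass_dist P Q = grass_dist Q P"
    by (simp add: grass_dist_def)
  show "grass_dist P Q = 0 \<longleftrightarrow> P = Q" if "P \<in> grassmannian d" "Q \<in> grassmannian d"
  proof -
    have sub: "subspace P" "subspace Q" using that by (auto simp: grassmannian_def)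
    have fix_iff: "x \<in> S \<longleftrightarrow> orth_proj S x = x" if "subspace S" for x and S :: "'a set"
      using orth_proj_in[OF that, of x] orth_proj_unique[OF that, of x x]
      by (auto simp: orthogonal_def)
    have "grass_dist P Q = 0 \<longleftrightarrow> (\<forall>x. orth_proj P x = orth_proj Q x)"
      by (simp add: grass_dist_def sub onorm_eq_0 bl)
    also have "\<dots> \<longleftrightarrow> P = Q"
      using fix_iff sub by auto
    finally show ?thesis .
  qed
  show "grass_dist P R \<le> grass_dist P Q + grass_dist Q R"
    if "P \<in> grassmannian d" "Q \<in> grassmannian d" "R \<in> grassmannian d"
  proof -
    have sub: "subspace P" "subspace Q" "subspace R" using that by (auto simp: grassmannian_def)
    show ?thesis
      using onorm_triangle[OF bl[OF sub(1,2)] bl[OF sub(2,3)]]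
      by (simp add: grass_dist_def sub)
  qed
qed

lemma topspace_varifold_space: "topspace (varifold_space d \<Omega>) = \<Omega> \<times> grassmannian d"
  by (simp add: varifold_space_def grass_topology_def
      Metric_space.topspace_mtopology[OF Metric_space_grassmannian])

lemma space_borel_of: "space (borel_of X) = topspace X"
  by (simp add: borel_of_def space_measure_of_conv)

lemma openin_sets_borel_of: "openin X U \<Longrightarrow> U \<in> sets (borel_of X)"
  unfolding borel_of_def
  by (subst sets_measure_of) (auto dest: openin_subset)

lemma emeasure_mass:
  assumes "open \<Omega>" "varifold d \<Omega> V" "B \<in> sets borel" "B \<subseteq> \<Omega>"
  shows "emeasure (mass \<Omega> V) B = emeasure V (B \<times> grassmannian d)"
proof -
  have sets: "sets V = sets (borel_of (varifold_space d \<Omega>))"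
    using assms(2) by (simp add: varifold_def)
  then have space: "space V = \<Omega> \<times> grassmannian d"
    by (metis sets_eq_imp_space_eq space_borel_of topspace_varifold_space)
  have "fst \<in> borel_measurable V"
  proof (rule borel_measurableI)
    fix S :: "'a set" assume "open S"
    then have "openin (varifold_space d \<Omega>) ((S \<inter> \<Omega>) \<times> topspace (grass_topology d))"
      unfolding varifold_space_def using \<open>open \<Omega>\<close>
      by (intro openin_prod_Times_iff[THEN iffD2] disjI2 conjI)
         (auto simp: openin_open_eq intro: open_Int)
    moreover have "fst -` S \<inter> space V = (S \<inter> \<Omega>) \<times> topspace (grass_topology d)"
      by (auto simp: space grass_topology_def
          Metric_space.topspace_mtopology[OF Metric_space_grassmannian])
    ultimately show "fst -` S \<inter> space V \<in> sets V"
      by (simp add: sets openin_sets_borel_of)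
  qed
  then have "fst \<in> measurable V (restrict_space borel \<Omega>)"
    by (rule measurable_restrict_space2[rotated]) (auto simp: space)
  moreover have "B \<in> sets (restrict_space borel \<Omega>)"
    using assms by (simp add: sets_restrict_space_iff)
  ultimately have "emeasure (mass \<Omega> V) B = emeasure V (fst -` B \<inter> space V)"
    by (simp add: mass_def emeasure_distr)
  also have "fst -` B \<inter> space V = B \<times> grassmannian d"
    using assms(4) by (auto simp: space)
  finally show ?thesis .
qed

end

theory Submission
  imports Defs
begin

text \<open>
  Let \<open>m\<close> be the mass of \<open>V\<close>, regarded as a measure on the whole space, and \<open>S\<close> the closure of the set of
  points at which the density bounds hold.

  The excess compares \<open>m\<close> at all small scales with one and the same plane.  If it is finite at \<open>(x, P)\<close>,
  the mean height of \<open>m\<close> over \<open>x + P\<close> in \<open>ball x r\<close> is small compared with \<open>r\<close>, and the lower density bound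
  turns this mean into a pointwise statement, because each point of \<open>S\<close> carries around itself a ball of
  substantial mass.  So \<open>S\<close> lies near \<open>x\<close> in arbitrarily thin cones around \<open>x + P\<close>; this is \<open>tangent_to S x P\<close>,
  proved in \<open>tangent_to_of_height_excess\<close>.

  Planes being taken from finite nets of the compact Grassmannian, for every \<open>\<epsilon>\<close> almost all of \<open>m\<close> is
  carried by countably many compact pieces all of whose chords are within \<open>\<epsilon>\<close> of a fixed plane \<open>Q\<close>
  (\<open>ex_flat_pieces\<close>).  Orthogonal projection to \<open>Q\<close> is bi-Lipschitz on such a piece with constants close
  to \<open>1\<close>.  Thus the pieces are Lipschitz images of subsets of \<open>Q\<close>, which is rectifiability, and the
  Hausdorff measure is sigma-finite on their union.  The upper density bound makes \<open>m\<close> absolutely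
  continuous with respect to it (\<open>null_set_of_hausdorff_null\<close>), and the Radon-Nikodym theorem provides \<open>\<theta>\<close>.

  The approximate tangent planes are found by letting \<open>\<epsilon>\<close> tend to \<open>0\<close>.  Take a point \<open>x\<close> of a piece \<open>K\<close> such
  that the rest of \<open>m\<close> has density zero at \<open>x\<close>, \<open>x\<close> is a Lebesgue point of \<open>\<theta>\<close> with respect to the Hausdorff
  measure on \<open>K\<close>, and the projection of \<open>x\<close> is a density point of the projection of \<open>K\<close> in \<open>Q\<close>.  By
  \<open>blowup_estimate\<close>, the blow-up of \<open>m\<close> at \<open>x\<close> differs from \<open>\<theta> x\<close> times the Hausdorff measure of \<open>Q\<close> by an
  error that is small with \<open>\<epsilon>\<close>.  The third property also forces every plane \<open>P\<close> tangent to \<open>S\<close> at \<open>x\<close> to be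
  close to \<open>Q\<close> (\<open>tangent_plane_close\<close>), so that in the limit \<open>P\<close> is unique and the blow-up is \<open>\<theta> x\<close> times the
  Hausdorff measure of \<open>P\<close>.  All three properties hold almost everywhere by one covering argument,
  \<open>AE_vanishing_density\<close>.  The limit has the right constant because \<open>\<theta>\<close> is a density with respect to the
  Hausdorff measure, and the Hausdorff measure on a plane, being translation invariant, homogeneous of
  degree \<open>d\<close> and locally finite, is its own blow-up.

  Finally, \<open>V\<close>-almost every \<open>(x, P)\<close> has finite excess, so that \<open>P\<close> is the unique tangent plane at \<open>x\<close>, and
  \<open>V\<close> is the image of \<open>m\<close> under \<open>x \<mapsto> (x, T x)\<close>.
\<close>

section \<open>Hausdorff measure, Lipschitz maps and planes\<close>

lemma hausdorff_outer_lipschitz_image: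
  fixes f :: "'a::metric_space \<Rightarrow> 'b::metric_space"
  assumes L: "0 < L" and lip: "\<And>x y. x \<in> A \<Longrightarrow> y \<in> A \<Longrightarrow> dist (f x) (f y) \<le> L * dist x y"
  shows "hausdorff_outer d (f ` A) \<le> ennreal (L ^ d) * hausdorff_outer d A"
proof -
  let ?w = "\<lambda>C. ennreal (unit_ball_vol (real d) * (diameter C / 2) ^ d)"
  have pre: "ennreal ((1 / L) ^ d) * hausdorff_pre d \<delta> (f ` A) \<le> hausdorff_pre d (\<delta> / L) A"
    if \<delta>: "0 < \<delta>" for \<delta>
    unfolding hausdorff_pre_def[of _ _ A]
  proof (rule INF_greatest, clarify)
    fix C :: "nat \<Rightarrow> 'a set"
    assume cov: "A \<subseteq> (\<Union>i. C i)" and C: "\<forall>i. bounded (C i) \<and> diameter (C i) \<le> \<delta> / L"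
    have dist: "dist u v \<le> L * diameter (C i)"
      if "u \<in> f ` (C i \<inter> A)" "v \<in> f ` (C i \<inter> A)" for u v i
    proof -
      obtain x y where xy: "x \<in> C i" "x \<in> A" "y \<in> C i" "y \<in> A" "u = f x" "v = f y"
        using \<open>u \<in> _\<close> \<open>v \<in> _\<close> by blast
      have "dist u v \<le> L * dist x y" using xy lip by simp
      also have "\<dots> \<le> L * diameter (C i)"
        using L xy C diameter_bounded_bound[of "C i" x y] by (intro mult_left_mono) auto
      finally show ?thesis .
    qed
    have bd: "bounded (f ` (C i \<inter> A))" for i
      using dist unfolding bounded_two_points by blast
    have dge: "0 \<le> diameter (C i)" for i
      using C diameter_ge_0 by blast
    have dm: "diameter (f ` (C i \<inter> A)) \<le> L * diameter (C i)" for i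
    proof (cases "f ` (C i \<inter> A) = {}")
      case True
      then show ?thesis using L dge[of i] by simp
    next
      case False
      then have "(SUP (u, v) \<in> f ` (C i \<inter> A) \<times> f ` (C i \<inter> A). dist u v) \<le> L * diameter (C i)"
        using dist by (intro cSUP_least) (auto simp del: times_divide_eq_right)
      then show ?thesis using False unfolding diameter_def by simp
    qed
    have "hausdorff_pre d \<delta> (f ` A) \<le> (\<Sum>i. ?w (f ` (C i \<inter> A)))"
      unfolding hausdorff_pre_def
    proof (rule INF_lower, safe)
      fix x assume "x \<in> A"
      then show "f x \<in> (\<Union>i. f ` (C i \<inter> A))" using cov by blast
    next
      fix i
      show "bounded (f ` (C i \<inter> A))" by (rule bd)
      have "L * diameter (C i) \<le> \<delta>" using C L by (simp add: field_simps)
      then show "diameter (f ` (C i \<inter> A)) \<le> \<delta>" using dm[of i] by linarith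
    qed
    then have "ennreal ((1 / L) ^ d) * hausdorff_pre d \<delta> (f ` A) \<le>
       ennreal ((1 / L) ^ d) * (\<Sum>i. ?w (f ` (C i \<inter> A)))"
      by (rule mult_left_mono) simp
    also have "\<dots> = (\<Sum>i. ennreal ((1 / L) ^ d) * ?w (f ` (C i \<inter> A)))"
      by simp
    also have "\<dots> \<le> (\<Sum>i. ?w (C i))"
    proof (rule suminf_le)
      fix i
      have "((1 / L) * (diameter (f ` (C i \<inter> A)) / 2)) ^ d \<le> (diameter (C i) / 2) ^ d"
        using dm[of i] L diameter_ge_0[OF bd[of i]]
        by (intro power_mono) (auto simp: field_simps)
      then have "(1 / L) ^ d * (unit_ball_vol (real d) * (diameter (f ` (C i \<inter> A)) / 2) ^ d)
          \<le> unit_ball_vol (real d) * (diameter (C i) / 2) ^ d"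
        unfolding power_mult_distrib mult.left_commute[of "(1 / L) ^ d"]
        by (rule mult_left_mono) simp
      then show "ennreal ((1 / L) ^ d) * ?w (f ` (C i \<inter> A)) \<le> ?w (C i)"
        using L by (subst ennreal_mult'[symmetric]) (auto intro!: ennreal_leI)
    qed auto
    finally show "ennreal ((1 / L) ^ d) * hausdorff_pre d \<delta> (f ` A) \<le> (\<Sum>i. ?w (C i))" .
  qed
  have "hausdorff_pre d \<delta> (f ` A) \<le> ennreal (L ^ d) * hausdorff_outer d A" if "0 < \<delta>" for \<delta>
  proof -
    have "hausdorff_pre d \<delta> (f ` A) =
        ennreal (L ^ d) * (ennreal ((1 / L) ^ d) * hausdorff_pre d \<delta> (f ` A))"
      using L by (simp add: mult.assoc[symmetric] ennreal_mult'[symmetric] power_divide)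
    also have "\<dots> \<le> ennreal (L ^ d) * hausdorff_pre d (\<delta> / L) A"
      by (intro mult_left_mono pre that) simp
    also have "\<dots> \<le> ennreal (L ^ d) * hausdorff_outer d A"
      using that L by (intro mult_left_mono hausdorff_pre_le_outer) auto
    finally show ?thesis .
  qed
  then show ?thesis
    by (subst hausdorff_outer_def) (auto intro!: SUP_least)
qed

lemma hausdorff_outer_scale_translate:
  fixes A :: "'a::real_normed_vector set"
  assumes r: "0 < r"
  shows "hausdorff_outer d ((\<lambda>y. c + r *\<^sub>R y) ` A) = ennreal (r ^ d) * hausdorff_outer d A"
proof (rule antisym)
  let ?f = "\<lambda>y. c + r *\<^sub>R y"
  show "hausdorff_outer d (?f ` A) \<le> ennreal (r ^ d) * hausdorff_outer d A"
    using r by (intro hausdorff_outer_lipschitz_image)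
       (auto simp: dist_norm scaleR_diff_right[symmetric])
  have "A = (\<lambda>y. (1 / r) *\<^sub>R (y - c)) ` (?f ` A)"
    using r by (auto simp: image_image)
  then have "hausdorff_outer d A \<le> ennreal ((1 / r) ^ d) * hausdorff_outer d (?f ` A)"
    using r hausdorff_outer_lipschitz_image[of "1 / r" "?f ` A" "\<lambda>y. (1 / r) *\<^sub>R (y - c)" d]
    by (auto simp: dist_norm scaleR_diff_right[symmetric])
  then have "ennreal (r ^ d) * hausdorff_outer d A \<le>
      ennreal (r ^ d) * (ennreal ((1 / r) ^ d) * hausdorff_outer d (?f ` A))"
    by (rule mult_left_mono) simp
  also have "\<dots> = hausdorff_outer d (?f ` A)"
    using r by (simp add: mult.assoc[symmetric] ennreal_mult'[symmetric] power_divide)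
  finally show "ennreal (r ^ d) * hausdorff_outer d A \<le> hausdorff_outer d (?f ` A)" .
qed

text \<open>
  In coordinates with respect to an orthonormal basis of \<open>Q\<close> the unit ball lies in a cube of side \<open>2\<close>.
  Cut into \<open>(2 * N) ^ d\<close> cells of side \<open>1 / N\<close>, hence of diameter at most \<open>d / N\<close>, it gives a covering
  sum that does not depend on \<open>N\<close>.  What matters below is that the bound is the same for all planes.
\<close>
lemma hausdorff_outer_plane_unit_ball:
  fixes Q :: "'a::euclidean_space set"
  assumes d: "0 < d" and Q: "Q \<in> grassmannian d"
  shows "hausdorff_outer d (Q \<inter> ball 0 1) \<le> ennreal (unit_ball_vol (real d) * real d ^ d)"
proof -
  have sub: "subspace Q" and dimQ: "dim Q = d" using Q by (auto simp: grassmannian_def)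
  obtain B where B: "B \<subseteq> Q" "pairwise orthogonal B" "\<And>x. x \<in> B \<Longrightarrow> norm x = 1"
    "independent B" "card B = dim Q" "span B = Q"
    using orthonormal_basis_subspace[OF sub] by metis
  have finB: "finite B" using B(4) by (rule independent_imp_finite)
  have cardB: "card B = d" using B(5) dimQ by simp
  have norm_le: "norm v \<le> (\<Sum>b\<in>B. \<bar>v \<bullet> b\<bar>)" if "v \<in> Q" for v
  proof -
    have "v \<in> span B" using that B(6) by simp
    then obtain a where a: "v = (\<Sum>b\<in>B. a b *\<^sub>R b)"
      using span_finite[OF finB] by auto
    have coef: "v \<bullet> b = a b" if "b \<in> B" for b
    proof -
      have "v \<bullet> b = (\<Sum>c\<in>B. a c * (c \<bullet> b))" by (simp add: a inner_sum_left)
      also have "\<dots> = (\<Sum>c\<in>B. if c = b then a b else 0)"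
        using B(2,3) that
        by (intro sum.cong) (auto simp: pairwise_def orthogonal_def norm_eq_1)
      finally show ?thesis using finB that by simp
    qed
    have "norm v \<le> (\<Sum>b\<in>B. norm (a b *\<^sub>R b))" unfolding a by (rule norm_sum)
    also have "\<dots> = (\<Sum>b\<in>B. \<bar>v \<bullet> b\<bar>)" using coef B(3) by (intro sum.cong) auto
    finally show ?thesis .
  qed
  have pre: "hausdorff_pre d \<delta> (Q \<inter> ball 0 1) \<le> ennreal (unit_ball_vol (real d) * real d ^ d)"
    if \<delta>: "0 < \<delta>" for \<delta>
  proof -
    obtain N :: nat where N: "real d / \<delta> < real N" using reals_Archimedean2 by blast
    then have N0: "0 < real N" using \<delta> d by (smt (verit) divide_nonneg_pos of_nat_0_le_iff)
    have dN: "real d / real N \<le> \<delta>" using N N0 \<delta> by (simp add: field_simps)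
    \<comment> \<open>The cells of a grid of width \<open>1 / N\<close>; on the open unit ball all coordinates lie in
      \<open>{-1<..<1}\<close>, so the cell numbers run from \<open>0\<close> to \<open>2 * N - 1\<close>.\<close>
    define cell where "cell f = {v \<in> Q \<inter> ball 0 1. \<forall>b\<in>B. nat \<lfloor>real N * (v \<bullet> b + 1)\<rfloor> = f b}" for f
    define F where "F = B \<rightarrow>\<^sub>E {..<2 * N}"
    have finF: "finite F" using finB by (simp add: F_def finite_PiE)
    have cardF: "card F = (2 * N) ^ d" using finB by (simp add: F_def card_PiE cardB)
    have cov: "Q \<inter> ball 0 1 \<subseteq> (\<Union>f\<in>F. cell f)"
    proof
      fix v assume v: "v \<in> Q \<inter> ball 0 1"
      define f where "f = restrict (\<lambda>b. nat \<lfloor>real N * (v \<bullet> b + 1)\<rfloor>) B"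
      have "f b < 2 * N" if "b \<in> B" for b
      proof -
        have "\<bar>v \<bullet> b\<bar> \<le> norm v * norm b" by (rule Cauchy_Schwarz_ineq2)
        then have "\<bar>v \<bullet> b\<bar> < 1" using v B(3)[OF that] by simp
        then have "real N * (v \<bullet> b + 1) < real N * 2"
          using N0 by (intro mult_strict_left_mono) auto
        then have "\<lfloor>real N * (v \<bullet> b + 1)\<rfloor> < int (2 * N)" by (simp add: floor_less_iff)
        then show ?thesis using that N0 by (simp add: f_def)
      qed
      then have "f \<in> F" by (auto simp: F_def f_def)
      moreover have "v \<in> cell f" using v by (auto simp: cell_def f_def)
      ultimately show "v \<in> (\<Union>f\<in>F. cell f)" by blast
    qed
    have bd: "bounded (cell f)" for f
      by (rule bounded_subset[OF bounded_ball[of 0 1]]) (auto simp: cell_def)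
    have dm: "diameter (cell f) \<le> real d / real N" for f
    proof (rule diameter_le)
      show "cell f \<noteq> {} \<or> 0 \<le> real d / real N" by simp
      fix x y assume x: "x \<in> cell f" and y: "y \<in> cell f"
      have "norm (x - y) \<le> (\<Sum>b\<in>B. \<bar>(x - y) \<bullet> b\<bar>)"
        using x y by (intro norm_le subspace_diff[OF sub]) (auto simp: cell_def)
      also have "\<dots> \<le> (\<Sum>b\<in>B. 1 / real N)"
      proof (rule sum_mono)
        fix b assume b: "b \<in> B"
        have rng: "0 \<le> real N * (z \<bullet> b + 1)" if "z \<in> cell f" for z
        proof -
          have "\<bar>z \<bullet> b\<bar> \<le> norm z * norm b" by (rule Cauchy_Schwarz_ineq2)
          then have "\<bar>z \<bullet> b\<bar> < 1" using that B(3)[OF b] by (simp add: cell_def)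
          then show ?thesis using N0 by simp
        qed
        have "\<lfloor>real N * (x \<bullet> b + 1)\<rfloor> = int (f b)" "\<lfloor>real N * (y \<bullet> b + 1)\<rfloor> = int (f b)"
          using x y b rng[OF x] rng[OF y] by (auto simp: cell_def nat_eq_iff)
        then have "\<bar>real N * (x \<bullet> b + 1) - real N * (y \<bullet> b + 1)\<bar> \<le> 1" by linarith
        moreover have "real N * (x \<bullet> b + 1) - real N * (y \<bullet> b + 1) = real N * ((x - y) \<bullet> b)"
          by (simp add: algebra_simps inner_diff_left)
        ultimately have "real N * \<bar>(x - y) \<bullet> b\<bar> \<le> 1"
          using N0 by (simp add: abs_mult)
        then show "\<bar>(x - y) \<bullet> b\<bar> \<le> 1 / real N" using N0 by (simp add: field_simps)
      qed
      also have "\<dots> = real d / real N" by (simp add: cardB)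
      finally show "norm (x - y) \<le> real d / real N" .
    qed
    obtain h where h: "bij_betw h {0..<card F} F"
      using ex_bij_betw_nat_finite[OF finF] by blast
    define C where "C i = (if i < card F then cell (h i) else {})" for i
    have "hausdorff_pre d \<delta> (Q \<inter> ball 0 1) \<le>
        (\<Sum>i. ennreal (unit_ball_vol (real d) * (diameter (C i) / 2) ^ d))"
      unfolding hausdorff_pre_def
    proof (rule INF_lower, safe)
      fix v assume "v \<in> Q" "v \<in> ball 0 1"
      then obtain f where f: "f \<in> F" "v \<in> cell f" using cov by blast
      then have "f \<in> h ` {0..<card F}" using h by (simp add: bij_betw_def)
      then obtain i where "i < card F" "h i = f" by auto
      then show "v \<in> (\<Union>i. C i)" using f by (auto simp: C_def)
    next
      fix i
      show "bounded (C i)" using bd by (simp add: C_def)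
      have "diameter (cell f) \<le> \<delta>" for f using dm dN by (rule order_trans)
      then show "diameter (C i) \<le> \<delta>" using \<delta> by (simp add: C_def)
    qed
    also have "\<dots> = (\<Sum>i<card F. ennreal (unit_ball_vol (real d) * (diameter (C i) / 2) ^ d))"
      using d by (intro suminf_finite) (auto simp: C_def zero_power)
    also have "\<dots> \<le> (\<Sum>i<card F. ennreal (unit_ball_vol (real d) * (real d / real N / 2) ^ d))"
    proof (intro sum_mono ennreal_leI mult_left_mono power_mono divide_right_mono)
      fix i
      show "diameter (C i) \<le> real d / real N" using dm by (simp add: C_def)
      show "0 \<le> diameter (C i) / 2" using diameter_ge_0[OF bd] by (simp add: C_def)
    qed auto
    also have "\<dots> = ennreal (real (card F) * (unit_ball_vol (real d) * (real d / real N / 2) ^ d))"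
      by (simp add: ennreal_mult' ennreal_of_nat_eq_real_of_nat)
    also have "real (card F) * (unit_ball_vol (real d) * (real d / real N / 2) ^ d) =
        unit_ball_vol (real d) * (real (2 * N) * (real d / real N / 2)) ^ d"
      unfolding cardF of_nat_power power_mult_distrib[of "real (2 * N)"] by (rule mult.left_commute)
    also have "real (2 * N) * (real d / real N / 2) = real d" using N0 by simp
    finally show ?thesis .
  qed
  then show ?thesis
    by (auto simp: hausdorff_outer_def intro!: SUP_least)
qed

section \<open>Hausdorff measure of a Borel set as a Borel measure\<close>

text \<open>
  Moving the restricted Hausdorff measure from the Caratheodory sets to the Borel sets makes the
  regularity theorems for finite Borel measures applicable.
\<close>
definition hausdorff_on :: "nat \<Rightarrow> 'a::metric_space set \<Rightarrow> 'a measure" where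
  "hausdorff_on d A = distr (density (hausdorff_measure d) (indicator A)) borel (\<lambda>x. x)"

lemma sets_hausdorff_on [simp, measurable_cong]: "sets (hausdorff_on d A) = sets borel"
  by (simp add: hausdorff_on_def)

lemma space_hausdorff_on [simp]: "space (hausdorff_on d A) = UNIV"
  by (simp add: hausdorff_on_def)

lemma borel_measurable_hausdorff_measure:
  assumes "0 < d" "f \<in> borel_measurable (borel :: 'a::metric_space measure)"
  shows "f \<in> borel_measurable (hausdorff_measure d)"
proof (rule measurableI)
  fix A :: "'b set" assume "A \<in> sets borel"
  then have "f -` A \<inter> space borel \<in> sets borel" using assms(2) by (rule measurable_sets[rotated])
  then show "f -` A \<inter> space (hausdorff_measure d) \<in> sets (hausdorff_measure d)"
    by (simp add: borel_in_sets_hausdorff_measure assms(1))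
qed simp

lemma id_measurable_hausdorff:
  assumes "0 < d"
  shows "(\<lambda>x. x) \<in> borel_measurable (density (hausdorff_measure d :: 'a::metric_space measure) g)"
  using borel_measurable_hausdorff_measure[OF assms, of "\<lambda>x::'a. x"] by simp

lemma emeasure_hausdorff_on:
  fixes A B :: "'a::metric_space set"
  assumes d: "0 < d" and A: "A \<in> sets borel" and B: "B \<in> sets borel"
  shows "emeasure (hausdorff_on d A) B = hausdorff_outer d (A \<inter> B)"
proof -
  have [measurable]: "A \<in> sets (hausdorff_measure d)" "B \<in> sets (hausdorff_measure d)"
    using A B d by (auto intro: borel_in_sets_hausdorff_measure)
  have "emeasure (hausdorff_on d A) B = emeasure (density (hausdorff_measure d) (indicator A)) B"
    unfolding hausdorff_on_def using B by (subst emeasure_distr[OF id_measurable_hausdorff[OF d]]) auto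
  also have "\<dots> = emeasure (hausdorff_measure d) (A \<inter> B)"
    by (subst emeasure_density) (auto simp: indicator_inter_arith[symmetric])
  also have "\<dots> = hausdorff_outer d (A \<inter> B)"
    by (simp add: emeasure_hausdorff_measure d)
  finally show ?thesis .
qed

lemma integral_hausdorff_on:
  fixes f :: "'a::metric_space \<Rightarrow> real"
  assumes d: "0 < d" and A: "A \<in> sets borel" and f: "f \<in> borel_measurable borel"
  shows "(\<integral>x. f x \<partial>hausdorff_on d A) = (LINT x:A|hausdorff_measure d. f x)"
proof -
  have [measurable]: "A \<in> sets (hausdorff_measure d)"
    using A d by (auto intro: borel_in_sets_hausdorff_measure)
  have f': "f \<in> borel_measurable (hausdorff_measure d)"
    using f d by (rule borel_measurable_hausdorff_measure[rotated])
  have eq: "(\<lambda>x. ennreal (indicator A x)) = (indicator A :: 'a \<Rightarrow> ennreal)"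
    by (auto simp: indicator_def)
  have "(\<integral>x. f x \<partial>hausdorff_on d A) = (\<integral>x. f x \<partial>density (hausdorff_measure d) (indicator A))"
    unfolding hausdorff_on_def using f by (intro integral_distr id_measurable_hausdorff d)
  also have "\<dots> = (LINT x:A|hausdorff_measure d. f x)"
    unfolding set_lebesgue_integral_def using f'
    by (subst integral_density[where g = "indicator A :: 'a \<Rightarrow> real", symmetric])
       (auto simp: eq)
  finally show ?thesis .
qed

lemma finite_measure_hausdorff_on:
  assumes "0 < d" "A \<in> sets borel" "hausdorff_outer d A < \<infinity>"
  shows "finite_measure (hausdorff_on d A)"
  by (rule finite_measureI) (use assms in \<open>auto simp: emeasure_hausdorff_on\<close>)

lemma
  fixes f :: "'a \<Rightarrow> real"
  assumes S: "S \<in> sets M" "emeasure M S < \<infinity>" and f: "f \<in> borel_measurable M"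
    and bound: "\<And>x. x \<in> space M \<Longrightarrow> x \<in> S \<Longrightarrow> \<bar>f x\<bar> \<le> b"
    and supp: "\<And>x. x \<in> space M \<Longrightarrow> x \<notin> S \<Longrightarrow> f x = 0"
  shows integrable_bounded_support: "integrable M f"
    and abs_integral_le_support: "\<bar>\<integral>x. f x \<partial>M\<bar> \<le> b * measure M S"
proof -
  show int: "integrable M f"
    by (rule integrableI_bounded_set[OF S(1) f S(2), of b]) (use bound supp in auto)
  have "\<bar>\<integral>x. f x \<partial>M\<bar> \<le> (\<integral>x. \<bar>f x\<bar> \<partial>M)" by (rule integral_abs_bound)
  also have "\<dots> \<le> (\<integral>x. b * indicator S x \<partial>M)"
  proof (rule integral_mono)
    show "integrable M (\<lambda>x. b * indicator S x)"
      using S by (intro integrable_mult_right integrable_real_indicator) auto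
    show "\<bar>f x\<bar> \<le> b * indicator S x" if "x \<in> space M" for x
      using bound[OF that] supp[OF that] by (cases "x \<in> S") auto
  qed (use int in auto)
  also have "\<dots> = b * measure M S" using sets.sets_into_space[OF S(1)] by (simp add: Int_absorb2)
  finally show "\<bar>\<integral>x. f x \<partial>M\<bar> \<le> b * measure M S" .
qed

section \<open>Orthogonal projections and balls in planes\<close>

lemma orth_proj_decompose:
  assumes "subspace P" "p \<in> P"
  shows "(norm (v - p))\<^sup>2 = (norm (v - orth_proj P v))\<^sup>2 + (norm (orth_proj P v - p))\<^sup>2"
proof -
  have "orthogonal (v - orth_proj P v) (orth_proj P v - p)"
    using assms by (intro orth_proj_orthogonal subspace_diff orth_proj_in)
  from norm_add_Pythagorean[OF this] show ?thesis by simp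
qed

lemma norm_orth_proj_le:
  assumes "subspace P"
  shows "norm (orth_proj P v) \<le> norm v"
proof -
  have "(norm (orth_proj P v))\<^sup>2 \<le> (norm v)\<^sup>2"
    using orth_proj_decompose[OF assms subspace_0[OF assms], of v] by simp
  then show ?thesis by (rule power2_le_imp_le) simp
qed

text \<open>
  Pythagoras: the orthogonal projection is the nearest point of the subspace.
\<close>
lemma infdist_subspace:
  assumes "subspace P"
  shows "infdist v P = norm (v - orth_proj P v)"
proof (rule antisym)
  show "infdist v P \<le> norm (v - orth_proj P v)"
    using infdist_le[OF orth_proj_in[OF assms], of v v] by (simp add: dist_norm)
  have "norm (v - orth_proj P v) \<le> dist v p" if "p \<in> P" for p
    unfolding dist_norm
    by (rule power2_le_imp_le) (use orth_proj_decompose[OF assms that, of v] in auto)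
  moreover have "P \<noteq> {}" using subspace_0[OF assms] by auto
  ultimately show "norm (v - orth_proj P v) \<le> infdist v P"
    unfolding infdist_def by (auto intro!: cINF_greatest)
qed

lemma orth_proj_diff: "subspace P \<Longrightarrow> orth_proj P (x - y) = orth_proj P x - orth_proj P y"
  using bounded_linear_orth_proj[of P] by (simp add: bounded_linear.linear linear_diff)

lemma orth_proj_id: "subspace P \<Longrightarrow> x \<in> P \<Longrightarrow> orth_proj P x = x"
  by (rule orth_proj_unique) (auto simp: orthogonal_def)

lemma continuous_orth_proj: "subspace P \<Longrightarrow> continuous_on S (orth_proj P)"
  by (intro linear_continuous_on bounded_linear_orth_proj)

lemma borel_measurable_orth_proj: "subspace P \<Longrightarrow> orth_proj P \<in> borel_measurable borel"
  by (intro borel_measurable_continuous_onI continuous_orth_proj)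

lemma grassmannian_subspace: "P \<in> grassmannian d \<Longrightarrow> subspace P"
  by (simp add: grassmannian_def)

lemma grassmannian_borel: "P \<in> grassmannian d \<Longrightarrow> P \<in> sets borel"
  by (intro borel_closed closed_subspace grassmannian_subspace)

text \<open>
  An upper bound, common to all \<open>d\<close>-planes, for the Hausdorff measure of their unit balls.
\<close>
definition plane_const :: "nat \<Rightarrow> real" where
  "plane_const d = unit_ball_vol (real d) * real d ^ d"

lemma plane_const_nonneg: "0 \<le> plane_const d"
  by (simp add: plane_const_def)

lemma hausdorff_outer_plane_ball_eq:
  fixes Q :: "'a::euclidean_space set"
  assumes Q: "subspace Q" "a \<in> Q" and r: "0 < r"
  shows "hausdorff_outer d (Q \<inter> ball a r) = ennreal (r ^ d) * hausdorff_outer d (Q \<inter> ball 0 1)"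
proof -
  have "Q \<inter> ball a r = (\<lambda>y. a + r *\<^sub>R y) ` (Q \<inter> ball 0 1)"
  proof (intro equalityI subsetI)
    fix y assume y: "y \<in> Q \<inter> ball a r"
    have "y = a + r *\<^sub>R ((1 / r) *\<^sub>R (y - a))" using r by simp
    moreover have "(1 / r) *\<^sub>R (y - a) \<in> Q \<inter> ball 0 1"
      using y r Q by (auto simp: dist_norm norm_minus_commute intro: subspace_scale subspace_diff)
    ultimately show "y \<in> (\<lambda>y. a + r *\<^sub>R y) ` (Q \<inter> ball 0 1)" by blast
  next
    fix y assume "y \<in> (\<lambda>y. a + r *\<^sub>R y) ` (Q \<inter> ball 0 1)"
    then obtain z where "z \<in> Q" "norm z < 1" "y = a + r *\<^sub>R z" by auto
    then show "y \<in> Q \<inter> ball a r"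
      using Q r by (auto simp: dist_norm intro: subspace_add subspace_scale)
  qed
  then show ?thesis using hausdorff_outer_scale_translate[OF r] by metis
qed

lemma hausdorff_outer_plane_ball:
  fixes Q :: "'a::euclidean_space set"
  assumes d: "0 < d" and Q: "Q \<in> grassmannian d" "a \<in> Q" and r: "0 < r"
  shows "hausdorff_outer d (Q \<inter> ball a r) \<le> ennreal (plane_const d * r ^ d)"
proof -
  have "hausdorff_outer d (Q \<inter> ball a r) = ennreal (r ^ d) * hausdorff_outer d (Q \<inter> ball 0 1)"
    using Q r by (intro hausdorff_outer_plane_ball_eq grassmannian_subspace)
  also have "\<dots> \<le> ennreal (r ^ d) * ennreal (plane_const d)"
    unfolding plane_const_def
    by (intro mult_left_mono hausdorff_outer_plane_unit_ball d Q(1)) simp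
  also have "\<dots> = ennreal (plane_const d * r ^ d)"
    using r by (simp add: ennreal_mult'[of "r ^ d", symmetric] mult.commute[of "r ^ d"])
  finally show ?thesis .
qed

section \<open>Sets that are flat over a plane\<close>

text \<open>
  Every chord of \<open>A\<close> makes a small angle with \<open>Q\<close>: \<open>A\<close> is the graph of a Lipschitz function over a
  subset of \<open>Q\<close> if \<open>\<epsilon> < 1\<close>, with Lipschitz constant close to \<open>\<epsilon>\<close> for small \<open>\<epsilon>\<close>.
\<close>
definition flat_over :: "real \<Rightarrow> 'a::euclidean_space set \<Rightarrow> 'a set \<Rightarrow> bool" where
  "flat_over \<epsilon> Q A \<longleftrightarrow> (\<forall>x\<in>A. \<forall>y\<in>A. infdist (y - x) Q \<le> \<epsilon> * norm (y - x))"

lemma flat_over_subset: "flat_over \<epsilon> Q A \<Longrightarrow> B \<subseteq> A \<Longrightarrow> flat_over \<epsilon> Q B"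
  by (auto simp: flat_over_def)

lemma flat_over_proj_near:
  assumes "subspace Q" "flat_over \<epsilon> Q A" "x \<in> A" "y \<in> A"
  shows "norm ((y - x) - (orth_proj Q y - orth_proj Q x)) \<le> \<epsilon> * norm (y - x)"
proof -
  have "infdist (y - x) Q \<le> \<epsilon> * norm (y - x)" using assms by (auto simp: flat_over_def)
  then show ?thesis by (simp only: infdist_subspace assms(1) orth_proj_diff)
qed

lemma flat_over_dist_le:
  assumes Q: "subspace Q" and fl: "flat_over \<epsilon> Q A" "x \<in> A" "y \<in> A" and e: "\<epsilon> < 1"
  shows "dist x y \<le> 1 / (1 - \<epsilon>) * dist (orth_proj Q x) (orth_proj Q y)"
proof -
  have "norm (y - x) \<le> norm (orth_proj Q y - orth_proj Q x) + \<epsilon> * norm (y - x)"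
    using flat_over_proj_near[OF Q fl] norm_triangle_sub[of "y - x" "orth_proj Q y - orth_proj Q x"]
    by linarith
  then have "(1 - \<epsilon>) * norm (y - x) \<le> norm (orth_proj Q y - orth_proj Q x)"
    by (simp add: algebra_simps)
  then show ?thesis using e
    by (simp add: dist_norm norm_minus_commute field_simps)
qed

lemma flat_over_inj_on:
  assumes "subspace Q" "flat_over \<epsilon> Q A" "\<epsilon> < 1"
  shows "inj_on (orth_proj Q) A"
proof (rule inj_onI)
  fix x y assume "x \<in> A" "y \<in> A" "orth_proj Q x = orth_proj Q y"
  then show "x = y" using flat_over_dist_le[OF assms(1,2) _ _ assms(3), of x y] by simp
qed

lemma hausdorff_outer_proj_le:
  assumes "subspace Q"
  shows "hausdorff_outer d (orth_proj Q ` A) \<le> hausdorff_outer d A"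
  using hausdorff_outer_lipschitz_image[of 1 A "orth_proj Q" d] norm_orth_proj_le[OF assms]
  by (simp add: dist_norm orth_proj_diff[OF assms, symmetric])

text \<open>
  The inverse of the projection is Lipschitz on the projected set.  Together with
  \<open>hausdorff_outer_proj_le\<close>, the projection onto \<open>Q\<close> changes the Hausdorff measure of subsets of a flat
  set by a factor that tends to \<open>1\<close> with \<open>\<epsilon>\<close>; this is all that the proof needs to know about areas of
  Lipschitz graphs.
\<close>
lemma hausdorff_outer_flat_le:
  assumes Q: "subspace Q" and fl: "flat_over \<epsilon> Q A" and e: "\<epsilon> < 1"
  shows "hausdorff_outer d A \<le> ennreal ((1 / (1 - \<epsilon>)) ^ d) * hausdorff_outer d (orth_proj Q ` A)"
proof -
  let ?g = "inv_into A (orth_proj Q)"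
  have "dist (?g u) (?g v) \<le> 1 / (1 - \<epsilon>) * dist u v"
    if "u \<in> orth_proj Q ` A" "v \<in> orth_proj Q ` A" for u v
    using flat_over_dist_le[OF Q fl inv_into_into[OF that(1)] inv_into_into[OF that(2)] e]
      f_inv_into_f[OF that(1)] f_inv_into_f[OF that(2)] by simp
  then have "hausdorff_outer d (?g ` orth_proj Q ` A) \<le>
      ennreal ((1 / (1 - \<epsilon>)) ^ d) * hausdorff_outer d (orth_proj Q ` A)"
    using e by (intro hausdorff_outer_lipschitz_image) auto
  then show ?thesis
    using flat_over_inj_on[OF Q fl e] by simp
qed

lemma hausdorff_outer_flat_ball:
  fixes A :: "'a::euclidean_space set"
  assumes d: "0 < d" and Q: "Q \<in> grassmannian d" and fl: "flat_over \<epsilon> Q A" and e: "\<epsilon> \<le> 1/2"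
    and a: "a \<in> A" and s: "0 < s"
  shows "hausdorff_outer d (A \<inter> ball a s) \<le> ennreal (2 ^ d * plane_const d * s ^ d)"
proof -
  have sub: "subspace Q" using Q by (rule grassmannian_subspace)
  have fl2: "flat_over (1/2) Q A" unfolding flat_over_def
  proof (intro ballI)
    fix x y assume "x \<in> A" "y \<in> A"
    then have "infdist (y - x) Q \<le> \<epsilon> * norm (y - x)" using fl by (auto simp: flat_over_def)
    also have "\<dots> \<le> 1/2 * norm (y - x)" using e by (intro mult_right_mono) auto
    finally show "infdist (y - x) Q \<le> 1/2 * norm (y - x)" .
  qed
  have "hausdorff_outer d (A \<inter> ball a s) \<le>
      ennreal ((1 / (1 - 1/2)) ^ d) * hausdorff_outer d (orth_proj Q ` (A \<inter> ball a s))"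
    by (rule hausdorff_outer_flat_le[OF sub flat_over_subset[OF fl2]]) auto
  also have "\<dots> \<le> ennreal ((1 / (1 - 1/2)) ^ d) * hausdorff_outer d (Q \<inter> ball (orth_proj Q a) s)"
  proof (intro mult_left_mono hausdorff_outer_mono subsetI)
    fix z assume "z \<in> orth_proj Q ` (A \<inter> ball a s)"
    then obtain y where y: "dist a y < s" "z = orth_proj Q y" by auto
    have "dist (orth_proj Q a) z \<le> dist a y"
      using norm_orth_proj_le[OF sub, of "a - y"] by (simp add: y dist_norm orth_proj_diff[OF sub])
    then show "z \<in> Q \<inter> ball (orth_proj Q a) s" using y orth_proj_in[OF sub] by auto
  qed simp
  also have "\<dots> \<le> ennreal (2 ^ d) * ennreal (plane_const d * s ^ d)"
    using hausdorff_outer_plane_ball[OF d Q orth_proj_in[OF sub] s] by (intro mult_mono) auto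
  also have "\<dots> = ennreal (2 ^ d * plane_const d * s ^ d)"
    using s plane_const_nonneg[of d] by (simp add: ennreal_mult[symmetric] mult.assoc)
  finally show ?thesis .
qed

lemma hausdorff_outer_flat_finite:
  fixes A :: "'a::euclidean_space set"
  assumes d: "0 < d" and Q: "Q \<in> grassmannian d" and fl: "flat_over \<epsilon> Q A" and e: "\<epsilon> \<le> 1/2"
    and bd: "bounded A"
  shows "hausdorff_outer d A < \<infinity>"
proof (cases "A = {}")
  case True
  then show ?thesis using hausdorff_outer_empty[OF d, where 'a = 'a] by simp
next
  case False
  then obtain a where a: "a \<in> A" by blast
  obtain s where s: "0 < s" "A \<subseteq> ball a s" using bounded_subset_ballD[OF bd] by blast
  have "hausdorff_outer d (A \<inter> ball a s) \<le> ennreal (2 ^ d * plane_const d * s ^ d)"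
    by (rule hausdorff_outer_flat_ball[OF d Q fl e a s(1)])
  moreover have "A \<inter> ball a s = A" using s by blast
  ultimately show ?thesis by (simp add: le_less_trans)
qed

text \<open>
  Two errors add up.  Replacing \<open>y - a\<close> by its projection moves the argument of \<open>\<phi>\<close> by at most
  \<open>2 * \<epsilon> * R\<close>, which costs \<open>w\<close> times a mass of order \<open>R ^ d\<close>.  Afterwards the integrand factors through
  the projection, whose image measure lies between the Hausdorff measure of the projected set and
  \<open>(1 / (1 - \<epsilon>)) ^ d\<close> times it.

  The estimate is used at two places: for a piece of the support over its reference plane at a small
  scale, and for the reference plane itself over a tangent plane at scale \<open>1\<close>.
\<close>
lemma flat_integral_compare:
  fixes \<phi> :: "'a::euclidean_space \<Rightarrow> real"
  assumes d: "0 < d" and Q: "Q \<in> grassmannian d" and fl: "flat_over \<epsilon> Q A"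
    and e: "0 \<le> \<epsilon>" "\<epsilon> \<le> 1/2"
    and A: "A \<in> sets borel" "orth_proj Q ` A \<in> sets borel" and a: "a \<in> A"
    and \<phi>: "continuous_on UNIV \<phi>" "\<And>u. 0 \<le> \<phi> u" "\<And>u. \<phi> u \<le> b" "\<And>u. R \<le> norm u \<Longrightarrow> \<phi> u = 0"
    and R: "0 < R"
    and modulus: "\<And>u v. norm (u - v) \<le> 2 * \<epsilon> * R \<Longrightarrow> \<bar>\<phi> u - \<phi> v\<bar> \<le> w"
  shows "\<bar>(\<integral>y. \<phi> (y - a) \<partial>hausdorff_on d A) -
          (\<integral>z. \<phi> (z - orth_proj Q a) \<partial>hausdorff_on d (orth_proj Q ` A))\<bar>
         \<le> plane_const d * R ^ d * (4 ^ d * w + ((1 / (1 - \<epsilon>)) ^ d - 1) * b)"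
proof -
  let ?p = "orth_proj Q"
  let ?M = "hausdorff_on d A" and ?T = "hausdorff_on d (?p ` A)"
  let ?c = "(1 / (1 - \<epsilon>)) ^ d"
  have sub: "subspace Q" using Q by (rule grassmannian_subspace)
  have c1: "1 \<le> ?c" using e by (intro one_le_power) (simp add: field_simps)
  have [measurable]: "\<phi> \<in> borel_measurable borel" "?p \<in> borel_measurable borel"
    using \<phi>(1) borel_measurable_orth_proj[OF sub] by (auto intro: borel_measurable_continuous_onI)
  have w0: "0 \<le> w" using modulus[of 0 0] e R by simp
  have b0: "0 \<le> b" using \<phi>(2,3) order_trans by blast
  have lower: "?T \<le> distr ?M borel ?p" and upper: "distr ?M borel ?p \<le> scale_measure (ennreal ?c) ?T"
  proof -
    have img: "?p ` (A \<inter> ?p -` B) = ?p ` A \<inter> B" for B by auto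
    have vB: "?p -` B \<in> sets borel" if "B \<in> sets borel" for B
      using measurable_sets[OF borel_measurable_orth_proj[OF sub] that] by simp
    have em: "emeasure (distr ?M borel ?p) B = hausdorff_outer d (A \<inter> ?p -` B)"
      if "B \<in> sets borel" for B
      using that vB[OF that] A(1) by (simp add: emeasure_distr emeasure_hausdorff_on d)
    show "?T \<le> distr ?M borel ?p"
      using hausdorff_outer_proj_le[OF sub, of d "A \<inter> ?p -` _"]
      by (subst le_measure) (auto simp: em emeasure_hausdorff_on d A img)
    have "hausdorff_outer d (A \<inter> ?p -` B) \<le> ennreal ?c * hausdorff_outer d (?p ` A \<inter> B)" for B
      using hausdorff_outer_flat_le[OF sub flat_over_subset[OF fl], of "A \<inter> ?p -` B" d] e
      by (simp add: img)
    then show "distr ?M borel ?p \<le> scale_measure (ennreal ?c) ?T"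
      by (subst le_measure) (auto simp: em emeasure_hausdorff_on d A)
  qed
  define \<psi> where "\<psi> z = \<phi> (z - ?p a)" for z
  have \<psi>0: "0 \<le> \<psi> z" for z by (simp add: \<psi>_def \<phi>(2))
  have [measurable]: "\<psi> \<in> borel_measurable borel" by (simp add: \<psi>_def[abs_def])
  have inT: "emeasure ?T (ball (?p a) R) \<le> ennreal (plane_const d * R ^ d)"
  proof -
    have "emeasure ?T (ball (?p a) R) = hausdorff_outer d (?p ` A \<inter> ball (?p a) R)"
      by (simp add: emeasure_hausdorff_on d A)
    also have "\<dots> \<le> hausdorff_outer d (Q \<inter> ball (?p a) R)"
      using orth_proj_in[OF sub] by (intro hausdorff_outer_mono) auto
    also have "\<dots> \<le> ennreal (plane_const d * R ^ d)"
      by (rule hausdorff_outer_plane_ball[OF d Q orth_proj_in[OF sub] R])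
    finally show ?thesis .
  qed
  have inM: "emeasure ?M (ball a (2 * R)) \<le> ennreal (2 ^ d * plane_const d * (2 * R) ^ d)"
    using hausdorff_outer_flat_ball[OF d Q fl e(2) a, of "2 * R"] R
    by (simp add: emeasure_hausdorff_on d A)
  have finT: "emeasure ?T (ball (?p a) R) < \<infinity>" and finM: "emeasure ?M (ball a (2 * R)) < \<infinity>"
    using le_less_trans[OF inT ennreal_less_top] le_less_trans[OF inM ennreal_less_top] by auto
  have mT: "measure ?T (ball (?p a) R) \<le> plane_const d * R ^ d"
    using inT plane_const_nonneg[of d] R unfolding measure_def by (intro enn2real_leI) auto
  have mM: "measure ?M (ball a (2 * R)) \<le> 2 ^ d * plane_const d * (2 * R) ^ d"
    using inM plane_const_nonneg[of d] R unfolding measure_def by (intro enn2real_leI) auto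
  have MA: "AE y in ?M. y \<in> A"
  proof -
    have "- A \<in> null_sets ?M"
      using A d by (auto simp: null_sets_def emeasure_hausdorff_on hausdorff_outer_empty)
    then show ?thesis by (rule AE_I') auto
  qed
  \<comment> \<open>On \<open>A\<close> the composite of \<open>\<phi>\<close> with the projection still has support in a ball, of twice the radius.\<close>
  have near: "dist a y < 2 * R" if "y \<in> A" "norm (?p y - ?p a) < R" for y
  proof -
    have "dist a y \<le> 1 / (1 - \<epsilon>) * dist (?p a) (?p y)"
      using flat_over_dist_le[OF sub fl a that(1)] e by auto
    also have "\<dots> \<le> 2 * dist (?p a) (?p y)"
      using e by (intro mult_right_mono) (auto simp: field_simps)
    also have "\<dots> < 2 * R" using that by (simp add: dist_norm norm_minus_commute)
    finally show ?thesis .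
  qed
  have pr: "norm (?p y - ?p a) \<le> norm (y - a)" for y
    using norm_orth_proj_le[OF sub, of "y - a"] by (simp add: orth_proj_diff[OF sub])
  define \<psi>' where "\<psi>' y = \<psi> (?p y) * indicator A y" for y
  define \<phi>' where "\<phi>' y = \<phi> (y - a) * indicator A y" for y
  note [measurable] = A(1)
  have [measurable]: "\<psi>' \<in> borel_measurable borel" "\<phi>' \<in> borel_measurable borel"
    by (simp_all add: \<psi>'_def[abs_def] \<phi>'_def[abs_def])
  have \<psi>': "(\<integral>y. \<psi> (?p y) \<partial>?M) = (\<integral>y. \<psi>' y \<partial>?M)"
    using MA by (intro integral_cong_AE) (auto simp: \<psi>'_def)
  have \<phi>': "(\<integral>y. \<phi> (y - a) \<partial>?M) = (\<integral>y. \<phi>' y \<partial>?M)"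
    using MA by (intro integral_cong_AE) (auto simp: \<phi>'_def)
  have z\<psi>: "\<psi>' y = 0" if "y \<notin> ball a (2 * R)" for y
    using near[of y] \<phi>(4)[of "?p y - ?p a"] that
    by (cases "norm (?p y - ?p a) < R") (auto simp: \<psi>'_def \<psi>_def indicator_def)
  have z\<phi>: "\<phi>' y = 0" if "y \<notin> ball a (2 * R)" for y
    using near[of y] \<phi>(4)[of "y - a"] pr[of y] that R
    by (auto simp: \<phi>'_def indicator_def dist_norm norm_minus_commute)
  have int\<psi>': "integrable ?M \<psi>'"
    by (rule integrable_bounded_support[OF _ finM, of _ b])
       (use z\<psi> \<phi>(2,3) b0 in \<open>auto simp: \<psi>'_def \<psi>_def indicator_def\<close>)
  have int\<phi>': "integrable ?M \<phi>'"
    by (rule integrable_bounded_support[OF _ finM, of _ b])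
       (use z\<phi> \<phi>(2,3) b0 in \<open>auto simp: \<phi>'_def indicator_def\<close>)
  have int\<psi>p: "integrable ?M (\<lambda>y. \<psi> (?p y))"
    by (rule integrable_cong_AE[THEN iffD1, OF _ _ _ int\<psi>']) (use MA in \<open>auto simp: \<psi>'_def\<close>)
  have z\<psi>T: "\<psi> z = 0" if "z \<notin> ball (?p a) R" for z
    using \<phi>(4)[of "z - ?p a"] that by (simp add: \<psi>_def dist_norm norm_minus_commute)
  have int\<psi>: "integrable ?T \<psi>"
    by (rule integrable_bounded_support[OF _ finT, of _ b])
       (use z\<psi>T \<phi>(2,3) in \<open>auto simp: \<psi>_def\<close>)
  have J0: "0 \<le> (\<integral>z. \<psi> z \<partial>?T)" using \<phi>(2) by (simp add: \<psi>_def)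
  have J: "(\<integral>z. \<psi> z \<partial>?T) \<le> b * (plane_const d * R ^ d)"
  proof -
    have "\<bar>\<integral>z. \<psi> z \<partial>?T\<bar> \<le> b * measure ?T (ball (?p a) R)"
      by (rule abs_integral_le_support) (use z\<psi>T \<phi>(2,3) finT in \<open>auto simp: \<psi>_def\<close>)
    also have "\<dots> \<le> b * (plane_const d * R ^ d)" by (intro mult_left_mono mT b0)
    finally show ?thesis by simp
  qed
  have e1: "ennreal (\<integral>z. \<psi> z \<partial>?T) = (\<integral>\<^sup>+z. ennreal (\<psi> z) \<partial>?T)"
    by (rule nn_integral_eq_integral[symmetric, OF int\<psi>]) (simp add: \<psi>_def \<phi>(2))
  have e2: "ennreal (\<integral>y. \<psi> (?p y) \<partial>?M) = (\<integral>\<^sup>+y. ennreal (\<psi> y) \<partial>distr ?M borel ?p)"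
    by (subst nn_integral_distr)
       (auto simp: \<psi>_def \<phi>(2) intro!: nn_integral_eq_integral[OF int\<psi>p[unfolded \<psi>_def], symmetric])
  have "ennreal (\<integral>z. \<psi> z \<partial>?T) \<le> ennreal (\<integral>y. \<psi> (?p y) \<partial>?M)"
    unfolding e1 e2 by (rule nn_integral_mono_measure[OF _ lower]) simp
  then have l: "(\<integral>z. \<psi> z \<partial>?T) \<le> (\<integral>y. \<psi> (?p y) \<partial>?M)"
    by (subst (asm) ennreal_le_iff) (auto simp: \<psi>0)
  have "ennreal (\<integral>y. \<psi> (?p y) \<partial>?M) \<le> (\<integral>\<^sup>+z. ennreal (\<psi> z) \<partial>scale_measure (ennreal ?c) ?T)"
    unfolding e2 by (rule nn_integral_mono_measure[OF _ upper]) simp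
  also have "\<dots> = ennreal ?c * ennreal (\<integral>z. \<psi> z \<partial>?T)"
    unfolding e1 by (rule nn_integral_scale_measure) simp
  also have "\<dots> = ennreal (?c * (\<integral>z. \<psi> z \<partial>?T))"
    using e J0 by (simp add: ennreal_mult)
  finally have u: "(\<integral>y. \<psi> (?p y) \<partial>?M) \<le> ?c * (\<integral>z. \<psi> z \<partial>?T)"
    using e J0 by (subst (asm) ennreal_le_iff) auto
  have "\<bar>(\<integral>y. \<psi> (?p y) \<partial>?M) - (\<integral>z. \<psi> z \<partial>?T)\<bar> \<le> (?c - 1) * (\<integral>z. \<psi> z \<partial>?T)"
    using l u by (simp add: algebra_simps)
  also have "\<dots> \<le> (?c - 1) * (b * (plane_const d * R ^ d))"
    using J c1 by (intro mult_left_mono) auto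
  finally have p1: "\<bar>(\<integral>y. \<psi> (?p y) \<partial>?M) - (\<integral>z. \<psi> z \<partial>?T)\<bar> \<le> (?c - 1) * (b * (plane_const d * R ^ d))" .
  have "\<bar>(\<integral>y. \<phi> (y - a) \<partial>?M) - (\<integral>y. \<psi> (?p y) \<partial>?M)\<bar> = \<bar>\<integral>y. \<phi>' y - \<psi>' y \<partial>?M\<bar>"
    by (simp add: \<phi>' \<psi>' int\<phi>' int\<psi>')
  also have "\<dots> \<le> w * measure ?M (ball a (2 * R))"
  proof (rule abs_integral_le_support)
    fix y assume y: "y \<in> ball a (2 * R)"
    show "\<bar>\<phi>' y - \<psi>' y\<bar> \<le> w"
    proof (cases "y \<in> A")
      case True
      have "norm ((y - a) - (?p y - ?p a)) \<le> \<epsilon> * norm (y - a)"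
        by (rule flat_over_proj_near[OF sub fl a True])
      also have "\<dots> \<le> \<epsilon> * (2 * R)"
        using y e by (intro mult_left_mono) (auto simp: dist_norm norm_minus_commute)
      finally show ?thesis
        using True modulus[of "y - a" "?p y - ?p a"] by (simp add: \<phi>'_def \<psi>'_def \<psi>_def mult_ac)
    qed (simp add: \<phi>'_def \<psi>'_def w0)
  qed (use z\<phi> z\<psi> finM in auto)
  also have "\<dots> \<le> w * (2 ^ d * plane_const d * (2 * R) ^ d)" by (intro mult_left_mono mM w0)
  also have "\<dots> = plane_const d * R ^ d * (4 ^ d * w)"
    using power_mult_distrib[of "2::real" 2 d] by (simp add: power_mult_distrib mult_ac)
  finally have p2: "\<bar>(\<integral>y. \<phi> (y - a) \<partial>?M) - (\<integral>y. \<psi> (?p y) \<partial>?M)\<bar> \<le> plane_const d * R ^ d * (4 ^ d * w)" .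
  show ?thesis using p1 p2 unfolding \<psi>_def by (simp add: algebra_simps)
qed

section \<open>The gap between two planes\<close>

lemma flat_over_plane:
  assumes P: "subspace P" and Q: "subspace Q"
    and gap: "\<And>q. q \<in> Q \<Longrightarrow> infdist q P \<le> \<eta> * norm q"
  shows "flat_over \<eta> P Q"
  using gap Q by (auto simp: flat_over_def subspace_diff)

text \<open>
  The projection is injective on \<open>Q\<close>, and the dimensions agree.
\<close>
lemma orth_proj_plane_onto:
  fixes P Q :: "'a::euclidean_space set"
  assumes P: "P \<in> grassmannian d" and Q: "Q \<in> grassmannian d"
    and fl: "flat_over \<eta> P Q" and e: "\<eta> < 1"
  shows "orth_proj P ` Q = P"
proof -
  have subP: "subspace P" and subQ: "subspace Q" using P Q by (auto intro: grassmannian_subspace)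
  have lin: "linear (orth_proj P)" using bounded_linear_orth_proj[OF subP] by (simp add: bounded_linear.linear)
  have "inj_on (orth_proj P) Q" by (rule flat_over_inj_on[OF subP fl e])
  then have "dim (orth_proj P ` Q) = dim Q"
    using lin subQ by (intro dim_image_eq) (auto simp: span_eq_iff[THEN iffD2])
  then have "dim (orth_proj P ` Q) = dim P" using P Q by (simp add: grassmannian_def)
  moreover have "subspace (orth_proj P ` Q)" by (rule linear_subspace_image[OF lin subQ])
  moreover have "orth_proj P ` Q \<subseteq> P" using orth_proj_in[OF subP] by blast
  ultimately show ?thesis by (intro subspace_dim_equal subP) auto
qed

text \<open>
  A one-sided smallness of the gap suffices because the dimensions agree: each \<open>p\<close> in \<open>P\<close> is the
  projection of some \<open>q\<close> in \<open>Q\<close> of comparable length, and then \<open>p\<close> is close to \<open>q\<close>.  Splitting \<open>x\<close> into its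
  parts in \<open>P\<close> and orthogonal to \<open>P\<close> turns the two gaps into a bound for the difference of the
  projections.
\<close>
lemma grass_dist_le_gap:
  fixes P Q :: "'a::euclidean_space set"
  assumes P: "P \<in> grassmannian d" and Q: "Q \<in> grassmannian d"
    and gap: "\<And>q. q \<in> Q \<Longrightarrow> infdist q P \<le> \<eta> * norm q" and e: "0 \<le> \<eta>" "\<eta> \<le> 1/2"
  shows "grass_dist P Q \<le> 3 * \<eta>"
proof -
  have subP: "subspace P" and subQ: "subspace Q" using P Q by (auto intro: grassmannian_subspace)
  have fl: "flat_over \<eta> P Q" by (rule flat_over_plane[OF subP subQ gap])
  have onto: "orth_proj P ` Q = P" using e by (intro orth_proj_plane_onto[OF P Q fl]) auto
  have near: "norm (q - orth_proj P q) \<le> \<eta> * norm q" if "q \<in> Q" for q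
    using gap[OF that] by (simp add: infdist_subspace[OF subP])
  have rev: "norm (p - orth_proj Q p) \<le> 2 * \<eta> * norm p" if "p \<in> P" for p
  proof -
    obtain q where q: "q \<in> Q" "p = orth_proj P q" using \<open>p \<in> P\<close> onto by auto
    have "norm q \<le> norm p + norm (q - p)" by (metis norm_triangle_sub)
    moreover have "norm (q - p) \<le> \<eta> * norm q" using near q by simp
    moreover have "\<eta> * norm q \<le> 1/2 * norm q" using e by (intro mult_right_mono) auto
    ultimately have "norm q \<le> 2 * norm p" by linarith
    have "norm (p - orth_proj Q p) = infdist p Q" by (simp add: infdist_subspace[OF subQ])
    also have "\<dots> \<le> dist p q" by (rule infdist_le[OF q(1)])
    also have "\<dots> \<le> \<eta> * norm q" using near q by (simp add: dist_norm norm_minus_commute)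
    also have "\<dots> \<le> \<eta> * (2 * norm p)" using \<open>norm q \<le> 2 * norm p\<close> e by (intro mult_left_mono)
    finally show ?thesis by simp
  qed
  have perp: "norm (orth_proj Q w) \<le> \<eta> * norm w" if w: "\<And>p. p \<in> P \<Longrightarrow> w \<bullet> p = 0" for w
  proof (cases "orth_proj Q w = 0")
    case True
    then show ?thesis using e by simp
  next
    case False
    define v where "v = orth_proj Q w"
    have vQ: "v \<in> Q" by (simp add: v_def orth_proj_in[OF subQ])
    have "(w - v) \<bullet> v = 0"
      using orth_proj_orthogonal[OF subQ vQ, of w] by (simp add: v_def orthogonal_def)
    then have "(norm v)\<^sup>2 = w \<bullet> v" by (simp add: inner_diff_left power2_norm_eq_inner)
    also have "\<dots> = w \<bullet> (v - orth_proj P v)"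
      using w[OF orth_proj_in[OF subP]] by (simp add: inner_diff_right)
    also have "\<dots> \<le> norm w * norm (v - orth_proj P v)" by (rule norm_cauchy_schwarz)
    also have "\<dots> \<le> norm w * (\<eta> * norm v)" by (intro mult_left_mono near vQ) simp
    finally have "norm v * norm v \<le> (\<eta> * norm w) * norm v" by (simp add: power2_eq_square mult_ac)
    then show ?thesis using False by (simp add: v_def)
  qed
  have "norm (orth_proj P x - orth_proj Q x) \<le> 3 * \<eta> * norm x" for x
  proof -
    let ?p = "orth_proj P x"
    have "norm (?p - orth_proj Q ?p) \<le> 2 * \<eta> * norm ?p" by (intro rev orth_proj_in subP)
    also have "\<dots> \<le> 2 * \<eta> * norm x" using e by (intro mult_left_mono norm_orth_proj_le subP) auto
    finally have 1: "norm (?p - orth_proj Q ?p) \<le> 2 * \<eta> * norm x" .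
    have "norm (orth_proj Q (x - ?p)) \<le> \<eta> * norm (x - ?p)"
      using orth_proj_orthogonal[OF subP, of _ x] by (intro perp) (auto simp: orthogonal_def)
    also have "\<dots> \<le> \<eta> * norm x"
    proof (intro mult_left_mono e(1))
      have "(norm (x - ?p))\<^sup>2 \<le> (norm x)\<^sup>2"
        using orth_proj_decompose[OF subP subspace_0[OF subP], of x] by simp
      then show "norm (x - ?p) \<le> norm x" by (rule power2_le_imp_le) simp
    qed
    finally have 2: "norm (orth_proj Q (x - ?p)) \<le> \<eta> * norm x" .
    have "?p - orth_proj Q x = (?p - orth_proj Q ?p) - orth_proj Q (x - ?p)"
      by (simp add: orth_proj_diff[OF subQ])
    then show ?thesis using 1 2 norm_triangle_ineq4[of "?p - orth_proj Q ?p" "orth_proj Q (x - ?p)"]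
      by (simp add: algebra_simps)
  qed
  then have "onorm (\<lambda>x. orth_proj P x - orth_proj Q x) \<le> 3 * \<eta>"
    by (intro onorm_le)
  then show ?thesis by (simp add: grass_dist_def subP subQ)
qed

section \<open>Densities and null sets\<close>

lemma ennreal_eq_0_if_le_all:
  assumes "\<And>e. 0 < e \<Longrightarrow> (a::ennreal) \<le> ennreal e"
  shows "a = 0"
proof -
  have "a \<le> 0"
  proof (rule ennreal_le_epsilon)
    fix e :: real assume "0 < e"
    then show "a \<le> 0 + ennreal e" using assms by simp
  qed
  then show ?thesis by simp
qed

lemma ennreal_sum_prods:
  assumes "0 \<le> a" "0 \<le> p" "0 \<le> b" "0 \<le> q"
  shows "ennreal a * ennreal p + ennreal b * ennreal q = ennreal (a * p + b * q)"
  using assms by (simp add: ennreal_mult)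

lemma emeasure_UN_countable_le:
  assumes J: "countable J" and B: "\<And>j. j \<in> J \<Longrightarrow> B j \<in> sets M"
  shows "emeasure M (\<Union>j\<in>J. B j) \<le> (\<integral>\<^sup>+j. emeasure M (B j) \<partial>count_space J)"
proof -
  have "emeasure M (\<Union>j\<in>J. B j) = (\<integral>\<^sup>+x. indicator (\<Union>j\<in>J. B j) x \<partial>M)"
    using J B by (intro nn_integral_indicator[symmetric] sets.countable_UN'') auto
  also have "\<dots> \<le> (\<integral>\<^sup>+x. (\<integral>\<^sup>+j. indicator (B j) x \<partial>count_space J) \<partial>M)"
  proof (rule nn_integral_mono)
    fix x
    show "indicator (\<Union>j\<in>J. B j) x \<le> (\<integral>\<^sup>+j. indicator (B j) x \<partial>count_space J :: ennreal)"
    proof (cases "x \<in> (\<Union>j\<in>J. B j)")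
      case True
      then obtain k where k: "k \<in> J" "x \<in> B k" by blast
      have "(1::ennreal) = (\<integral>\<^sup>+j. indicator {k} j \<partial>count_space J)"
        using k by (subst nn_integral_indicator) auto
      also have "\<dots> \<le> (\<integral>\<^sup>+j. indicator (B j) x \<partial>count_space J)"
        using k by (intro nn_integral_mono) (auto simp: indicator_def)
      finally show ?thesis using True by simp
    qed simp
  qed
  also have "\<dots> = (\<integral>\<^sup>+j. (\<integral>\<^sup>+x. indicator (B j) x \<partial>M) \<partial>count_space J)"
    using J B by (intro nn_integral_count_space_nn_integral) auto
  also have "\<dots> = (\<integral>\<^sup>+j. emeasure M (B j) \<partial>count_space J)"
    using B by (intro nn_integral_cong nn_integral_indicator) auto
  finally show ?thesis .
qed

lemma ex_less_of_nat_Suc: "\<exists>k. (a::real) < real (Suc k)"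
proof -
  obtain k where "a < real k" using reals_Archimedean2 by blast
  then have "a < real (Suc k)" by simp
  then show ?thesis by blast
qed

text \<open>
  The upper \<open>d\<close>-density of \<open>\<mu>\<close> at \<open>x\<close> is finite.
\<close>
definition bounded_density :: "nat \<Rightarrow> 'a::metric_space measure \<Rightarrow> 'a \<Rightarrow> bool" where
  "bounded_density d \<mu> x \<longleftrightarrow>
     (\<exists>C \<rho>. 0 < \<rho> \<and> (\<forall>r. 0 < r \<and> r < \<rho> \<longrightarrow> emeasure \<mu> (ball x r) \<le> ennreal (C * r ^ d)))"

text \<open>
  The \<open>d\<close>-density of \<open>\<sigma>\<close> at \<open>x\<close> exists and is \<open>0\<close>.
\<close>
definition zero_density :: "nat \<Rightarrow> 'a::metric_space measure \<Rightarrow> 'a \<Rightarrow> bool" where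
  "zero_density d \<sigma> x \<longleftrightarrow>
     (\<forall>c>0. \<exists>\<delta>>0. \<forall>r. 0 < r \<and> r < \<delta> \<longrightarrow> emeasure \<sigma> (ball x r) \<le> ennreal (c * r ^ d))"

text \<open>
  This is the only differentiation theorem in the proof; density points, Lebesgue points and the
  localisation of blow-ups to one piece are all instances.  Around each point where the claim fails
  there are arbitrarily small balls with \<open>c * r ^ d < \<sigma> (ball x r)\<close> inside an open set \<open>U\<close> containing \<open>Z\<close>
  with \<open>\<sigma> U\<close> small.  The balls of a disjoint Vitali subfamily, enlarged five times, cover the bad
  points; the sum of their \<open>\<mu>\<close>-measures is at most a multiple of the sum of the \<open>r ^ d\<close>, hence of \<open>\<sigma> U\<close>.
\<close>
lemma AE_vanishing_density:
  fixes \<mu> \<sigma> :: "'a::euclidean_space measure"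
  assumes sets_\<mu>: "sets \<mu> = sets borel" and sets_\<sigma>: "sets \<sigma> = sets borel"
    and fin: "emeasure \<sigma> UNIV < \<infinity>"
    and Z: "Z \<in> sets borel" "emeasure \<sigma> Z = 0"
  shows "AE x in \<mu>. x \<in> Z \<longrightarrow> bounded_density d \<mu> x \<longrightarrow> zero_density d \<sigma> x"
proof -
  have space: "space \<sigma> = UNIV" "space \<mu> = UNIV"
    using sets_eq_imp_space_eq[OF sets_\<sigma>] sets_eq_imp_space_eq[OF sets_\<mu>] by auto
  \<comment> \<open>The parameter \<open>k\<close> makes both the density bound and the failure of the conclusion uniform.\<close>
  define bad where "bad k = {x \<in> Z.
     (\<forall>r. 0 < r \<and> r < 1 / real (Suc k) \<longrightarrow> emeasure \<mu> (ball x r) \<le> ennreal (real (Suc k) * r ^ d)) \<and>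
     (\<forall>\<delta>>0. \<exists>r. 0 < r \<and> r < \<delta> \<and> ennreal (1 / real (Suc k) * r ^ d) < emeasure \<sigma> (ball x r))}" for k
  have "\<exists>N\<in>null_sets \<mu>. bad k \<subseteq> N" for k
  proof -
    define K where "K = real (Suc k)"
    have K: "0 < K" by (simp add: K_def)
    have cover: "\<exists>U. U \<in> sets borel \<and> bad k \<subseteq> U \<and> emeasure \<mu> U \<le> ennreal (K * 5 ^ d * K) * ennreal \<eta>"
      if \<eta>: "0 < \<eta>" for \<eta> :: real
    proof -
      have "emeasure \<sigma> Z = (INF U \<in> {U. Z \<subseteq> U \<and> open U}. emeasure \<sigma> U)"
        using Z fin by (intro outer_regular sets_\<sigma>) (auto simp: space)
      then have "(INF U \<in> {U. Z \<subseteq> U \<and> open U}. emeasure \<sigma> U) < ennreal \<eta>" using Z \<eta> by simp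
      then obtain U where U: "Z \<subseteq> U" "open U" "emeasure \<sigma> U < ennreal \<eta>"
        unfolding INF_less_iff by auto
      define I where "I = bad k"
      have "\<exists>r. 0 < r \<and> r < 1 / (5 * K) \<and> ball x r \<subseteq> U \<and> ennreal (1 / K * r ^ d) < emeasure \<sigma> (ball x r)"
        if "x \<in> I" for x
      proof -
        have "x \<in> U" using that U by (auto simp: I_def bad_def)
        then obtain e where e: "0 < e" "ball x e \<subseteq> U" using U(2) openE by blast
        have "0 < min e (1 / (5 * K))" using e K by simp
        moreover have "\<forall>\<delta>>0. \<exists>r. 0 < r \<and> r < \<delta> \<and> ennreal (1 / K * r ^ d) < emeasure \<sigma> (ball x r)"
          using that by (simp add: I_def bad_def K_def)
        ultimately obtain r where r: "0 < r" "r < min e (1 / (5 * K))" "ennreal (1 / K * r ^ d) < emeasure \<sigma> (ball x r)"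
          by blast
        then have "ball x r \<subseteq> U" using e by (intro subset_trans[OF subset_ball e(2)]) auto
        then show ?thesis using r by auto
      qed
      then obtain r where r: "\<And>x. x \<in> I \<Longrightarrow> 0 < r x" "\<And>x. x \<in> I \<Longrightarrow> r x < 1 / (5 * K)"
        "\<And>x. x \<in> I \<Longrightarrow> ball x (r x) \<subseteq> U"
        "\<And>x. x \<in> I \<Longrightarrow> ennreal (1 / K * r x ^ d) < emeasure \<sigma> (ball x (r x))" by metis
      obtain J where J: "countable J" "J \<subseteq> I"
        "pairwise (\<lambda>i j. disjnt (cball i (r i)) (cball j (r j))) J"
        "\<And>i. i \<in> I \<Longrightarrow> \<exists>j. j \<in> J \<and> \<not> disjnt (cball i (r i)) (cball j (r j)) \<and>
           cball i (r i) \<subseteq> ball j (5 * r j)"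
      proof (rule Vitali_covering_lemma_cballs_balls[of I r "1 / (5 * K)" "\<lambda>x. x"])
        show "0 < r i \<and> r i \<le> 1 / (5 * K)" if "i \<in> I" for i using r(1,2)[OF that] by simp
      qed (rule that)
      define W where "W = (\<Union>j\<in>J. ball j (5 * r j))"
      have "bad k \<subseteq> W"
      proof
        fix x assume "x \<in> bad k"
        then have x: "x \<in> I" by (simp add: I_def)
        then have "x \<in> cball x (r x)" using r(1)[OF x] by simp
        then show "x \<in> W" using J(4)[OF x] unfolding W_def by blast
      qed
      moreover have "W \<in> sets borel" unfolding W_def using J(1) by (intro borel_open open_UN) auto
      moreover have "emeasure \<mu> W \<le> ennreal (K * 5 ^ d * K) * ennreal \<eta>"
      proof -
        have "emeasure \<mu> W \<le> (\<integral>\<^sup>+j. emeasure \<mu> (ball j (5 * r j)) \<partial>count_space J)"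
          unfolding W_def using J(1) by (intro emeasure_UN_countable_le) (auto simp: sets_\<mu>)
        also have "\<dots> \<le> (\<integral>\<^sup>+j. ennreal (K * 5 ^ d * K) * emeasure \<sigma> (ball j (r j)) \<partial>count_space J)"
        proof (rule nn_integral_mono)
          fix j assume "j \<in> space (count_space J)"
          then have j: "j \<in> I" using J(2) by auto
          have "5 * r j < 1 / K" using r(2)[OF j] K by (simp add: field_simps)
          moreover have "\<forall>r. 0 < r \<and> r < 1 / K \<longrightarrow> emeasure \<mu> (ball j r) \<le> ennreal (K * r ^ d)"
            using j by (simp add: I_def bad_def K_def)
          moreover have "0 < 5 * r j" using r(1)[OF j] by simp
          ultimately have "emeasure \<mu> (ball j (5 * r j)) \<le> ennreal (K * (5 * r j) ^ d)" by blast
          also have "\<dots> = ennreal (K * 5 ^ d * K) * ennreal (1 / K * r j ^ d)"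
            using K r(1)[OF j] by (simp add: ennreal_mult[symmetric] power_mult_distrib)
          also have "\<dots> \<le> ennreal (K * 5 ^ d * K) * emeasure \<sigma> (ball j (r j))"
            using r(4)[OF j] by (intro mult_left_mono) auto
          finally show "emeasure \<mu> (ball j (5 * r j)) \<le> ennreal (K * 5 ^ d * K) * emeasure \<sigma> (ball j (r j))" .
        qed
        also have "\<dots> = ennreal (K * 5 ^ d * K) * (\<integral>\<^sup>+j. emeasure \<sigma> (ball j (r j)) \<partial>count_space J)"
          by (rule nn_integral_cmult) simp
        also have "(\<integral>\<^sup>+j. emeasure \<sigma> (ball j (r j)) \<partial>count_space J) = emeasure \<sigma> (\<Union>j\<in>J. ball j (r j))"
        proof (rule emeasure_UN_countable[symmetric])
          show "disjoint_family_on (\<lambda>j. ball j (r j)) J"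
            using J(3) ball_subset_cball unfolding disjoint_family_on_def pairwise_def disjnt_def by blast
        qed (use J(1) sets_\<sigma> in auto)
        also have "\<dots> \<le> emeasure \<sigma> U"
          using r(3) J(2) U(2) by (intro emeasure_mono) (auto simp: sets_\<sigma>)
        also have "\<dots> \<le> ennreal \<eta>" using U(3) by simp
        finally show ?thesis by (simp add: mult_left_mono)
      qed
      ultimately show ?thesis by blast
    qed
    have "\<exists>U. U \<in> sets borel \<and> bad k \<subseteq> U \<and>
        emeasure \<mu> U \<le> ennreal (K * 5 ^ d * K) * ennreal (1 / real (Suc n))" for n
      by (intro cover) simp
    then obtain U where U: "\<And>n. U n \<in> sets borel" "\<And>n. bad k \<subseteq> U n"
       "\<And>n. emeasure \<mu> (U n) \<le> ennreal (K * 5 ^ d * K) * ennreal (1 / real (Suc n))"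
      by metis
    define N where "N = (\<Inter>n. U n)"
    have N: "N \<in> sets \<mu>" using U(1) by (auto simp: N_def sets_\<mu>)
    have "emeasure \<mu> N \<le> ennreal e" if "0 < e" for e
    proof -
      obtain n where n: "K * 5 ^ d * K / e < real (Suc n)"
        using ex_less_of_nat_Suc by blast
      have "emeasure \<mu> N \<le> emeasure \<mu> (U n)" using U(1) by (intro emeasure_mono) (auto simp: N_def sets_\<mu>)
      also have "\<dots> \<le> ennreal (K * 5 ^ d * K) * ennreal (1 / real (Suc n))" by (rule U(3))
      also have "\<dots> = ennreal (K * 5 ^ d * K * (1 / real (Suc n)))"
        using K by (intro ennreal_mult[symmetric]) auto
      also have "\<dots> \<le> ennreal e" using n that by (intro ennreal_leI) (simp add: field_simps)
      finally show ?thesis .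
    qed
    then have "emeasure \<mu> N = 0" by (rule ennreal_eq_0_if_le_all)
    then have "N \<in> null_sets \<mu>" using N by (simp add: null_setsI)
    moreover have "bad k \<subseteq> N" using U(2) by (auto simp: N_def)
    ultimately show ?thesis by blast
  qed
  then obtain N where N: "\<And>k. N k \<in> null_sets \<mu>" "\<And>k. bad k \<subseteq> N k" by metis
  have "(\<Union>k. N k) \<in> null_sets \<mu>" using N(1) by (intro null_sets_UN) auto
  then show ?thesis
  proof (rule AE_I', intro subsetI)
    fix x assume "x \<in> {x \<in> space \<mu>. \<not> (x \<in> Z \<longrightarrow> bounded_density d \<mu> x \<longrightarrow> zero_density d \<sigma> x)}"
    then have x: "x \<in> Z" and bd: "bounded_density d \<mu> x" and nz: "\<not> zero_density d \<sigma> x" by auto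
    obtain C \<rho> where \<rho>: "0 < \<rho>" and
      C: "\<forall>r. 0 < r \<and> r < \<rho> \<longrightarrow> emeasure \<mu> (ball x r) \<le> ennreal (C * r ^ d)"
      using bd unfolding bounded_density_def by blast
    obtain c where c: "0 < c" "\<forall>\<delta>>0. \<exists>r. 0 < r \<and> r < \<delta> \<and> ennreal (c * r ^ d) < emeasure \<sigma> (ball x r)"
      using nz by (auto simp: zero_density_def not_le)
    obtain k where k: "max C (max (1 / \<rho>) (1 / c)) < real (Suc k)"
      using ex_less_of_nat_Suc by blast
    have k\<rho>: "1 / real (Suc k) < \<rho>" and kc: "1 / real (Suc k) < c" and kC: "C \<le> real (Suc k)"
      using k \<rho> c(1) by (auto simp: field_simps)
    have "x \<in> bad k" unfolding bad_def
    proof (intro CollectI conjI x allI impI)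
      fix r :: real assume r: "0 < r \<and> r < 1 / real (Suc k)"
      then have "emeasure \<mu> (ball x r) \<le> ennreal (C * r ^ d)" using C k\<rho> by auto
      also have "\<dots> \<le> ennreal (real (Suc k) * r ^ d)"
        using kC r by (intro ennreal_leI mult_right_mono) auto
      finally show "emeasure \<mu> (ball x r) \<le> ennreal (real (Suc k) * r ^ d)" .
    next
      fix \<delta> :: real assume "0 < \<delta>"
      then obtain r where r: "0 < r" "r < \<delta>" "ennreal (c * r ^ d) < emeasure \<sigma> (ball x r)" using c(2) by blast
      have "ennreal (1 / real (Suc k) * r ^ d) \<le> ennreal (c * r ^ d)"
        using kc r(1) by (intro ennreal_leI mult_right_mono) auto
      then show "\<exists>r. 0 < r \<and> r < \<delta> \<and> ennreal (1 / real (Suc k) * r ^ d) < emeasure \<sigma> (ball x r)"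
        using r by (meson le_less_trans)
    qed
    then show "x \<in> (\<Union>k. N k)" using N(2) by blast
  qed
qed

text \<open>
  Each covering set that meets the set \<open>Y k\<close> of points with a uniform density bound is contained in a
  ball around a point of \<open>Y k\<close> with a radius only slightly larger than the diameter; the density bound
  estimates the mass of this ball.  The slack \<open>t i\<close> in the radius takes care of covering sets of
  diameter \<open>0\<close>.
\<close>
lemma null_set_of_hausdorff_null:
  fixes m :: "'a::euclidean_space measure"
  assumes d: "0 < d" and sets_m: "sets m = sets borel"
    and X: "\<And>x. x \<in> X \<Longrightarrow> bounded_density d m x"
    and B: "hausdorff_outer d (B :: 'a set) = 0"
  shows "\<exists>N\<in>null_sets m. B \<inter> X \<subseteq> N"
proof -
  define Y where "Y k = {x \<in> B.
     \<forall>r. 0 < r \<and> r < 1 / real (Suc k) \<longrightarrow> emeasure m (ball x r) \<le> ennreal (real (Suc k) * r ^ d)}" for k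
  have "\<exists>N\<in>null_sets m. Y k \<subseteq> N" for k
  proof -
    define K where "K = real (Suc k)"
    have K: "0 < K" by (simp add: K_def)
    define M where "M = K * 2 ^ d * (2 ^ d / unit_ball_vol (real d) + 1)"
    have M: "0 < M" using K unit_ball_vol_pos[of "real d"] by (simp add: M_def add_pos_pos)
    have cover: "\<exists>U. U \<in> sets borel \<and> Y k \<subseteq> U \<and> emeasure m U \<le> ennreal (M * \<eta>)"
      if \<eta>: "0 < \<eta>" "\<eta> < 1" for \<eta> :: real
    proof -
      \<comment> \<open>The slacks are summable, at most \<open>1\<close> (so that \<open>t i ^ d \<le> t i\<close>), and less than \<open>1 / (2 * K)\<close>, which
        keeps the radii in the range of the density bound.\<close>
      define t where "t i = \<eta> / (2 * K) * (1/2) ^ Suc i" for i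
      define \<delta> where "\<delta> = 1 / (2 * K)"
      have \<delta>: "0 < \<delta>" using K by (simp add: \<delta>_def)
      have "hausdorff_pre d \<delta> B < ennreal \<eta>"
        using hausdorff_pre_le_outer[OF \<delta>, of d B] B \<eta> by simp
      then obtain C where C: "B \<subseteq> (\<Union>i. C i)" "\<And>i. bounded (C i)" "\<And>i. diameter (C i) \<le> \<delta>"
        "(\<Sum>i. ennreal (unit_ball_vol (real d) * (diameter (C i) / 2) ^ d)) < ennreal \<eta>"
        unfolding hausdorff_pre_def INF_less_iff by auto
      define D where "D i = diameter (C i)" for i
      have D0: "0 \<le> D i" for i using C(2) diameter_ge_0 by (auto simp: D_def)
      define x where "x i = (SOME z. z \<in> C i \<inter> Y k)" for i
      define W where "W i = (if C i \<inter> Y k = {} then {} else ball (x i) (D i + t i))" for i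
      have t0: "0 < t i" for i using \<eta> K by (simp add: t_def)
      have t1: "t i < 1 / (2 * K)" for i
      proof -
        have "\<eta> * (1/2) ^ Suc i < 1 * 1"
          using \<eta> power_le_one[of "1/2::real" "Suc i"] by (intro mult_less_le_imp_less) (auto simp del: power_Suc)
        then have "1 / (2 * K) * (\<eta> * (1/2) ^ Suc i) < 1 / (2 * K) * 1"
          using K by (intro mult_strict_left_mono) auto
        then show ?thesis by (simp add: t_def)
      qed
      have xi: "x i \<in> C i \<inter> Y k" if "C i \<inter> Y k \<noteq> {}" for i
        unfolding x_def using that by (intro someI_ex[of "\<lambda>z. z \<in> C i \<inter> Y k"]) blast
      have "Y k \<subseteq> (\<Union>i. W i)"
      proof
        fix y assume y: "y \<in> Y k"
        then obtain i where i: "y \<in> C i" using C(1) by (auto simp: Y_def)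
        then have ne: "C i \<inter> Y k \<noteq> {}" using y by blast
        have "dist (x i) y \<le> D i"
          unfolding D_def using xi[OF ne] i by (intro diameter_bounded_bound C) auto
        then have "y \<in> W i" using ne t0[of i] by (simp add: W_def)
        then show "y \<in> (\<Union>i. W i)" by blast
      qed
      moreover have "(\<Union>i. W i) \<in> sets borel" by (auto simp: W_def)
      moreover have "emeasure m (\<Union>i. W i) \<le> ennreal (M * \<eta>)"
      proof -
        let ?w = "unit_ball_vol (real d)"
        have w: "0 < ?w" by (simp add: unit_ball_vol_pos)
        have "emeasure m (\<Union>i. W i) \<le> (\<Sum>i. emeasure m (W i))"
          by (intro emeasure_subadditive_countably) (auto simp: W_def sets_m)
        also have "\<dots> \<le> (\<Sum>i. ennreal (K * 2 ^ d * (2 ^ d / ?w)) * ennreal (?w * (D i / 2) ^ d)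
             + ennreal (K * 2 ^ d * \<eta>) * ennreal ((1/2) ^ Suc i))"
        proof (rule suminf_le)
          fix i
          have "emeasure m (W i) \<le> ennreal (K * (D i + t i) ^ d)"
          proof (cases "C i \<inter> Y k = {}")
            case True
            then show ?thesis by (simp add: W_def)
          next
            case False
            have "D i + t i < 1 / K" using C(3)[of i] t1[of i] K by (simp add: D_def \<delta>_def field_simps)
            then show ?thesis
              using xi[OF False] D0[of i] t0[of i] False unfolding Y_def K_def W_def by auto
          qed
          also have "\<dots> \<le> ennreal (K * (2 ^ d * D i ^ d + 2 ^ d * (\<eta> * (1/2) ^ Suc i)))"
          proof (intro ennreal_leI mult_left_mono)
            have "(D i + t i) ^ d \<le> (2 * max (D i) (t i)) ^ d"
              using D0[of i] t0[of i] by (intro power_mono) auto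
            also have "\<dots> = 2 ^ d * max (D i ^ d) (t i ^ d)"
              using D0[of i] t0[of i] by (auto simp: power_mult_distrib max_def power_mono antisym)
            also have "\<dots> \<le> 2 ^ d * (D i ^ d + t i ^ d)"
              using D0[of i] t0[of i] by (intro mult_left_mono) auto
            also have "t i ^ d \<le> \<eta> * (1/2) ^ Suc i"
            proof -
              have K1: "1 \<le> K" by (simp add: K_def)
              have inv: "1 / (2 * K) \<le> 1" using K1 by simp
              have "t i = (\<eta> * (1/2) ^ Suc i) * (1 / (2 * K))" by (simp add: t_def)
              also have "\<dots> \<le> (\<eta> * (1/2) ^ Suc i) * 1"
                using \<eta> inv by (intro mult_left_mono) auto
              finally have "t i \<le> \<eta> * (1/2) ^ Suc i" by simp
              moreover have "t i \<le> 1" using t1[of i] inv by linarith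
              then have "t i ^ d \<le> t i ^ 1" using t0[of i] d by (intro power_decreasing) auto
              ultimately show ?thesis by simp
            qed
            finally show "(D i + t i) ^ d \<le> 2 ^ d * D i ^ d + 2 ^ d * (\<eta> * (1/2) ^ Suc i)"
              by (simp add: algebra_simps)
          qed (use K in auto)
          also have "\<dots> = ennreal (K * 2 ^ d * (2 ^ d / ?w)) * ennreal (?w * (D i / 2) ^ d)
             + ennreal (K * 2 ^ d * \<eta>) * ennreal ((1/2) ^ Suc i)"
          proof -
            have "K * (2 ^ d * D i ^ d + 2 ^ d * (\<eta> * (1/2) ^ Suc i)) =
              (K * 2 ^ d * (2 ^ d / ?w)) * (?w * (D i / 2) ^ d) + (K * 2 ^ d * \<eta>) * (1/2) ^ Suc i"
              using w less_imp_neq[OF w] by (simp add: power_divide distrib_left mult_ac)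
            then show ?thesis using K w D0[of i] \<eta>
              by (simp only:) (rule ennreal_sum_prods[symmetric], auto)
          qed
          finally show "emeasure m (W i) \<le> ennreal (K * 2 ^ d * (2 ^ d / ?w)) * ennreal (?w * (D i / 2) ^ d)
             + ennreal (K * 2 ^ d * \<eta>) * ennreal ((1/2) ^ Suc i)" .
        qed auto
        also have "\<dots> = ennreal (K * 2 ^ d * (2 ^ d / ?w)) * (\<Sum>i. ennreal (?w * (D i / 2) ^ d))
             + ennreal (K * 2 ^ d * \<eta>) * (\<Sum>i. ennreal ((1/2) ^ Suc i))"
          by (subst suminf_add[symmetric]) (auto simp del: power_Suc)
        also have "(\<Sum>i. ennreal ((1/2) ^ Suc i)) = ennreal 1"
          using power_half_series by (intro suminf_ennreal_eq) (auto simp del: power_Suc)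
        also have "ennreal (K * 2 ^ d * (2 ^ d / ?w)) * (\<Sum>i. ennreal (?w * (D i / 2) ^ d))
             + ennreal (K * 2 ^ d * \<eta>) * ennreal 1
           \<le> ennreal (K * 2 ^ d * (2 ^ d / ?w)) * ennreal \<eta> + ennreal (K * 2 ^ d * \<eta>) * ennreal 1"
          using C(4) by (intro add_right_mono mult_left_mono) (auto simp: D_def)
        also have "\<dots> = ennreal (M * \<eta>)"
          using K w \<eta> by (subst ennreal_sum_prods) (auto simp: M_def algebra_simps)
        finally show ?thesis .
      qed
      ultimately show ?thesis by blast
    qed
    have "\<exists>U. U \<in> sets borel \<and> Y k \<subseteq> U \<and> emeasure m U \<le> ennreal (M * (1 / real (n + 2)))" for n
      by (intro cover) auto
    then obtain U where U: "\<And>n. U n \<in> sets borel" "\<And>n. Y k \<subseteq> U n"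
       "\<And>n. emeasure m (U n) \<le> ennreal (M * (1 / real (n + 2)))" by metis
    define N where "N = (\<Inter>n. U n)"
    have N: "N \<in> sets m" using U(1) by (auto simp: N_def sets_m)
    have "emeasure m N \<le> ennreal e" if "0 < e" for e
    proof -
      obtain n where n: "M / e < real n" using reals_Archimedean2 by blast
      have "emeasure m N \<le> emeasure m (U n)" using U(1) by (intro emeasure_mono) (auto simp: N_def sets_m)
      also have "\<dots> \<le> ennreal (M * (1 / real (n + 2)))" by (rule U(3))
      also have "\<dots> \<le> ennreal e"
      proof (rule ennreal_leI)
        have "M < e * real n" using n that by (simp add: field_simps)
        also have "\<dots> \<le> e * real (n + 2)" using that by simp
        finally show "M * (1 / real (n + 2)) \<le> e" by (simp add: field_simps)
      qed
      finally show ?thesis .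
    qed
    then have "emeasure m N = 0" by (rule ennreal_eq_0_if_le_all)
    then have "N \<in> null_sets m" using N by (simp add: null_setsI)
    moreover have "Y k \<subseteq> N" using U(2) by (auto simp: N_def)
    ultimately show ?thesis by blast
  qed
  then obtain N where N: "\<And>k. N k \<in> null_sets m" "\<And>k. Y k \<subseteq> N k" by metis
  have "(\<Union>k. N k) \<in> null_sets m" using N(1) by (intro null_sets_UN) auto
  moreover have "B \<inter> X \<subseteq> (\<Union>k. N k)"
  proof
    fix x assume x: "x \<in> B \<inter> X"
    then obtain C \<rho> where \<rho>: "0 < \<rho>" and
      C: "\<And>r. 0 < r \<Longrightarrow> r < \<rho> \<Longrightarrow> emeasure m (ball x r) \<le> ennreal (C * r ^ d)"
      using X unfolding bounded_density_def by blast
    obtain k where k: "max C (1 / \<rho>) < real (Suc k)"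
      using ex_less_of_nat_Suc by blast
    have k\<rho>: "1 / real (Suc k) < \<rho>" and kC: "C \<le> real (Suc k)"
      using k \<rho> by (auto simp: field_simps)
    have "x \<in> Y k" unfolding Y_def
    proof (intro CollectI conjI allI impI)
      show "x \<in> B" using x by blast
      fix r :: real assume r: "0 < r \<and> r < 1 / real (Suc k)"
      then have "emeasure m (ball x r) \<le> ennreal (C * r ^ d)" using C k\<rho> by auto
      also have "\<dots> \<le> ennreal (real (Suc k) * r ^ d)"
        using kC r by (intro ennreal_leI mult_right_mono) auto
      finally show "emeasure m (ball x r) \<le> ennreal (real (Suc k) * r ^ d)" .
    qed
    then show "x \<in> (\<Union>k. N k)" using N(2) by blast
  qed
  ultimately show ?thesis by blast
qed

section \<open>Tangent planes, density points and Lebesgue points\<close>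

text \<open>
  \<open>S\<close> lies near \<open>x\<close> in arbitrarily thin cones around \<open>x + P\<close>.  No part of \<open>S\<close> is exempted, as it would be
  in the measure-theoretic notion of an approximate tangent plane.
\<close>
definition tangent_to :: "'a::euclidean_space set \<Rightarrow> 'a \<Rightarrow> 'a set \<Rightarrow> bool" where
  "tangent_to S x P \<longleftrightarrow>
     (\<forall>\<epsilon>>0. \<exists>\<delta>>0. \<forall>y\<in>S. dist x y < \<delta> \<longrightarrow> infdist (y - x) P \<le> \<epsilon> * norm (y - x))"

text \<open>
  Almost every point of the projection of \<open>K\<close> is a density point of it in \<open>Q\<close>, and the inverse of the
  projection maps null sets of \<open>Q\<close> to null sets of \<open>K\<close>.
\<close>
lemma AE_proj_density_point:
  fixes K :: "'a::euclidean_space set"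
  assumes d: "0 < d" and Q: "Q \<in> grassmannian d" and K: "compact K"
    and fl: "flat_over \<epsilon> Q K" and e: "\<epsilon> \<le> 1/2"
  shows "AE x in hausdorff_on d K. x \<in> K \<longrightarrow>
           zero_density d (hausdorff_on d (Q - orth_proj Q ` K)) (orth_proj Q x)"
proof -
  let ?p = "orth_proj Q"
  have sub: "subspace Q" using Q by (rule grassmannian_subspace)
  have cpK: "compact (?p ` K)" by (rule compact_continuous_image[OF continuous_orth_proj[OF sub] K])
  then have bK [measurable]: "K \<in> sets borel" "?p ` K \<in> sets borel"
    using K by (auto intro: borel_closed compact_imp_closed)
  have bQ [measurable]: "Q \<in> sets borel" using Q by (rule grassmannian_borel)
  obtain R where R: "0 < R" "?p ` K \<subseteq> ball 0 R"
    using bounded_subset_ballD[OF compact_imp_bounded[OF cpK]] by blast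
  let ?\<mu> = "hausdorff_on d (Q \<inter> ball 0 R)" and ?\<sigma> = "hausdorff_on d (Q \<inter> ball 0 R - ?p ` K)"
  have "emeasure ?\<sigma> UNIV \<le> hausdorff_outer d (Q \<inter> ball 0 R)"
    by (subst emeasure_hausdorff_on) (auto simp: d intro: hausdorff_outer_mono)
  also have "\<dots> \<le> ennreal (plane_const d * R ^ d)"
    by (rule hausdorff_outer_plane_ball[OF d Q subspace_0[OF sub] R(1)])
  finally have fin: "emeasure ?\<sigma> UNIV < \<infinity>" by (simp add: le_less_trans)
  have "AE z in ?\<mu>. z \<in> ?p ` K \<longrightarrow> bounded_density d ?\<mu> z \<longrightarrow> zero_density d ?\<sigma> z"
  proof (rule AE_vanishing_density[OF _ _ fin])
    have "emeasure ?\<sigma> (?p ` K) = hausdorff_outer d ((Q \<inter> ball 0 R - ?p ` K) \<inter> ?p ` K)"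
      by (rule emeasure_hausdorff_on[OF d]) auto
    also have "(Q \<inter> ball 0 R - ?p ` K) \<inter> ?p ` K = {}" by blast
    finally show "emeasure ?\<sigma> (?p ` K) = 0" by (simp add: hausdorff_outer_empty d)
  qed auto
  then obtain N where N: "N \<in> null_sets ?\<mu>"
    "\<And>z. z \<in> ?p ` K \<Longrightarrow> bounded_density d ?\<mu> z \<Longrightarrow> z \<notin> N \<Longrightarrow> zero_density d ?\<sigma> z"
    by (rule AE_E3) auto
  have bN [measurable]: "N \<in> sets borel" using N(1) by (auto simp: null_sets_def)
  have HN: "hausdorff_outer d (Q \<inter> ball 0 R \<inter> N) = 0"
    using N(1) emeasure_hausdorff_on[OF d _ bN, of "Q \<inter> ball 0 R"] by auto
  have bpN [measurable]: "?p -` N \<in> sets borel"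
    using measurable_sets[OF borel_measurable_orth_proj[OF sub] bN] by simp
  have "hausdorff_outer d (K \<inter> ?p -` N) \<le>
      ennreal ((1 / (1 - \<epsilon>)) ^ d) * hausdorff_outer d (?p ` (K \<inter> ?p -` N))"
    using e by (intro hausdorff_outer_flat_le[OF sub flat_over_subset[OF fl]]) auto
  also have "hausdorff_outer d (?p ` (K \<inter> ?p -` N)) \<le> hausdorff_outer d (Q \<inter> ball 0 R \<inter> N)"
    using R(2) orth_proj_in[OF sub] by (intro hausdorff_outer_mono) auto
  finally have "hausdorff_outer d (K \<inter> ?p -` N) = 0" by (simp add: HN mult_left_mono)
  then have null: "?p -` N \<in> null_sets (hausdorff_on d K)"
    by (auto simp: null_sets_def emeasure_hausdorff_on d)
  show ?thesis
  proof (rule AE_I'[OF null], intro subsetI, rule ccontr)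
    fix x assume x: "x \<in> {x \<in> space (hausdorff_on d K). \<not> (x \<in> K \<longrightarrow>
        zero_density d (hausdorff_on d (Q - ?p ` K)) (?p x))}" and xN: "x \<notin> ?p -` N"
    then have xK: "x \<in> K" by auto
    have pxR: "?p x \<in> ball 0 R" using xK R(2) by blast
    then obtain t where t: "0 < t" "ball (?p x) t \<subseteq> ball 0 R"
      by (meson open_ball openE)
    have "bounded_density d ?\<mu> (?p x)"
      unfolding bounded_density_def
    proof (rule exI[of _ "plane_const d"], rule exI[of _ 1], intro conjI allI impI)
      fix r :: real assume r: "0 < r \<and> r < 1"
      have "emeasure ?\<mu> (ball (?p x) r) \<le> hausdorff_outer d (Q \<inter> ball (?p x) r)"
        by (subst emeasure_hausdorff_on) (auto simp: d intro: hausdorff_outer_mono)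
      also have "\<dots> \<le> ennreal (plane_const d * r ^ d)"
        using r by (intro hausdorff_outer_plane_ball[OF d Q orth_proj_in[OF sub]]) auto
      finally show "emeasure ?\<mu> (ball (?p x) r) \<le> ennreal (plane_const d * r ^ d)" .
    qed simp
    then have z: "zero_density d ?\<sigma> (?p x)" using N(2)[of "?p x"] xK xN by auto
    have "zero_density d (hausdorff_on d (Q - ?p ` K)) (?p x)"
      unfolding zero_density_def
    proof (intro allI impI)
      fix c :: real assume "0 < c"
      then obtain \<delta> where \<delta>: "0 < \<delta>" "\<And>r. 0 < r \<and> r < \<delta> \<Longrightarrow> emeasure ?\<sigma> (ball (?p x) r) \<le> ennreal (c * r ^ d)"
        using z unfolding zero_density_def by blast
      have "emeasure (hausdorff_on d (Q - ?p ` K)) (ball (?p x) r) \<le> ennreal (c * r ^ d)"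
        if r: "0 < r \<and> r < min \<delta> t" for r
      proof -
        have "ball (?p x) r \<subseteq> ball 0 R" using r t(2) subset_ball[of r t "?p x"] by auto
        then have "(Q - ?p ` K) \<inter> ball (?p x) r = (Q \<inter> ball 0 R - ?p ` K) \<inter> ball (?p x) r" by auto
        then have "emeasure (hausdorff_on d (Q - ?p ` K)) (ball (?p x) r) = emeasure ?\<sigma> (ball (?p x) r)"
          by (subst (1 2) emeasure_hausdorff_on[OF d]) auto
        then show ?thesis using \<delta>(2)[of r] r by simp
      qed
      moreover have "0 < min \<delta> t" using \<delta>(1) t(1) by simp
      ultimately show "\<exists>\<delta>>0. \<forall>r. 0 < r \<and> r < \<delta> \<longrightarrow>
          emeasure (hausdorff_on d (Q - ?p ` K)) (ball (?p x) r) \<le> ennreal (c * r ^ d)" by blast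
    qed
    then show False using x by auto
  qed
qed

text \<open>
  Since the projection of \<open>x\<close> is a density point of the projection of \<open>K\<close>, for every unit vector \<open>u\<close> of \<open>Q\<close>
  and small \<open>s\<close> some \<open>y\<close> in \<open>K\<close> projects into the ball of radius \<open>\<epsilon> * s\<close> around the projection of \<open>x\<close>
  moved by \<open>s *\<^sub>R u\<close>.  Then \<open>y - x\<close> is within \<open>4 * \<epsilon> * s\<close> of \<open>s *\<^sub>R u\<close> because \<open>K\<close> is flat, and within
  \<open>3 * \<epsilon> * s\<close> of \<open>P\<close> because \<open>P\<close> is tangent.
\<close>
lemma tangent_plane_close:
  fixes K :: "'a::euclidean_space set"
  assumes d: "0 < d" and Q: "Q \<in> grassmannian d" and P: "P \<in> grassmannian d"
    and K: "compact K" "K \<subseteq> S"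
    and fl: "flat_over \<epsilon> Q K" and e: "0 < \<epsilon>" "\<epsilon> \<le> 1/2" and x: "x \<in> K"
    and dens: "zero_density d (hausdorff_on d (Q - orth_proj Q ` K)) (orth_proj Q x)"
    and pos: "hausdorff_outer d (Q \<inter> ball 0 1) \<noteq> 0"
    and tan: "tangent_to S x P" and q: "q \<in> Q"
  shows "infdist q P \<le> 7 * \<epsilon> * norm q"
proof (cases "q = 0")
  case True
  then show ?thesis using P subspace_0[OF grassmannian_subspace[OF P]] by simp
next
  case False
  let ?p = "orth_proj Q"
  have sub: "subspace Q" and subP: "subspace P" using Q P by (auto intro: grassmannian_subspace)
  have bK [measurable]: "?p ` K \<in> sets borel"
    by (intro borel_closed compact_imp_closed compact_continuous_image[OF continuous_orth_proj[OF sub] K(1)])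
  have bQ [measurable]: "Q \<in> sets borel" using Q by (rule grassmannian_borel)
  define \<kappa> where "\<kappa> = enn2real (hausdorff_outer d (Q \<inter> ball 0 1))"
  have "hausdorff_outer d (Q \<inter> ball 0 1) < \<infinity>"
    using hausdorff_outer_plane_ball[OF d Q subspace_0[OF sub], of 1] by (simp add: le_less_trans)
  then have \<kappa>: "hausdorff_outer d (Q \<inter> ball 0 1) = ennreal \<kappa>" "0 < \<kappa>"
    using pos by (auto simp: \<kappa>_def enn2real_positive_iff less_top zero_less_iff_neq_zero)
  \<comment> \<open>With this \<open>c\<close>, \<open>c * (2 * s) ^ d\<close> is half the measure of a ball of radius \<open>\<epsilon> * s\<close> in \<open>Q\<close>: inside a ball
    of radius \<open>2 * s\<close>, the complement of the projection of \<open>K\<close> is too thin to contain such a ball.\<close>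
  define c where "c = \<kappa> * \<epsilon> ^ d / (2 * 2 ^ d)"
  have "0 < c" using \<kappa> e by (simp add: c_def)
  then obtain \<delta>1 where \<delta>1: "0 < \<delta>1" "\<And>r. 0 < r \<and> r < \<delta>1 \<Longrightarrow>
      emeasure (hausdorff_on d (Q - ?p ` K)) (ball (?p x) r) \<le> ennreal (c * r ^ d)"
    using dens unfolding zero_density_def by blast
  obtain \<delta>2 where \<delta>2: "0 < \<delta>2" "\<And>y. y \<in> S \<Longrightarrow> dist x y < \<delta>2 \<Longrightarrow> infdist (y - x) P \<le> \<epsilon> * norm (y - x)"
    using tan e(1) unfolding tangent_to_def by blast
  define s where "s = min \<delta>1 \<delta>2 / 4"
  have s: "0 < s" "2 * s < \<delta>1" "3 * s < \<delta>2" using \<delta>1(1) \<delta>2(1) by (auto simp: s_def)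
  define u where "u = (1 / norm q) *\<^sub>R q"
  have u: "u \<in> Q" "norm u = 1" using q False sub by (auto simp: u_def subspace_scale)
  define z where "z = ?p x + s *\<^sub>R u"
  have zQ: "z \<in> Q" unfolding z_def using u sub by (intro subspace_add subspace_scale orth_proj_in)
  have es: "0 < \<epsilon> * s" using e s by simp
  have "\<exists>y\<in>K. dist z (?p y) < \<epsilon> * s"
  proof (rule ccontr)
    assume no: "\<not> ?thesis"
    have "ennreal ((\<epsilon> * s) ^ d * \<kappa>) = hausdorff_outer d (Q \<inter> ball z (\<epsilon> * s))"
      using hausdorff_outer_plane_ball_eq[OF sub zQ es, of d] es \<kappa> by (simp add: ennreal_mult')
    also have "\<dots> \<le> hausdorff_outer d ((Q - ?p ` K) \<inter> ball (?p x) (2 * s))"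
    proof (rule hausdorff_outer_mono, intro subsetI)
      fix y assume y: "y \<in> Q \<inter> ball z (\<epsilon> * s)"
      have "dist (?p x) y \<le> dist (?p x) z + dist z y" by (rule dist_triangle)
      also have "dist (?p x) z = s" using u s by (simp add: z_def dist_norm)
      also have "dist z y < s"
      proof -
        have "\<epsilon> * s \<le> 1/2 * s" using e s by (intro mult_right_mono) auto
        moreover have "dist z y < \<epsilon> * s" using y by simp
        ultimately show ?thesis using s by linarith
      qed
      finally show "y \<in> (Q - ?p ` K) \<inter> ball (?p x) (2 * s)" using y no by auto
    qed
    also have "\<dots> \<le> ennreal (c * (2 * s) ^ d)"
      using \<delta>1(2)[of "2 * s"] s by (simp add: emeasure_hausdorff_on d)
    finally have "(\<epsilon> * s) ^ d * \<kappa> \<le> c * (2 * s) ^ d"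
      using s \<open>0 < c\<close> by (subst (asm) ennreal_le_iff) auto
    also have "\<dots> = (\<epsilon> * s) ^ d * \<kappa> / 2" by (simp add: c_def power_mult_distrib)
    finally have "(\<epsilon> * s) ^ d * \<kappa> \<le> 0" by (simp add: mult.commute)
    moreover have "0 < (\<epsilon> * s) ^ d * \<kappa>" using es \<kappa> by simp
    ultimately show False by linarith
  qed
  then obtain y where y: "y \<in> K" "dist z (?p y) < \<epsilon> * s" by blast
  have es2: "\<epsilon> * s \<le> s / 2" using mult_right_mono[OF e(2), of s] s by simp
  have "dist (?p x) (?p y) \<le> dist (?p x) z + dist z (?p y)" by (rule dist_triangle)
  also have "dist (?p x) z = s" using u s by (simp add: z_def dist_norm)
  finally have pxy: "dist (?p x) (?p y) < 3/2 * s" using y(2) es2 by linarith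
  have "dist x y \<le> 1 / (1 - \<epsilon>) * dist (?p x) (?p y)"
    using flat_over_dist_le[OF sub fl x y(1)] e by auto
  also have "\<dots> \<le> 2 * dist (?p x) (?p y)"
    using e by (intro mult_right_mono) (auto simp: field_simps)
  finally have xy: "dist x y < 3 * s" using pxy by linarith
  then have nxy: "norm (y - x) < 3 * s" by (simp add: dist_norm norm_minus_commute)
  have a: "infdist (y - x) P \<le> \<epsilon> * (3 * s)"
  proof -
    have "infdist (y - x) P \<le> \<epsilon> * norm (y - x)" using y(1) K(2) xy s(3) by (intro \<delta>2(2)) auto
    also have "\<dots> \<le> \<epsilon> * (3 * s)" using nxy e by (intro mult_left_mono) auto
    finally show ?thesis .
  qed
  have b: "norm ((y - x) - (?p y - ?p x)) \<le> \<epsilon> * (3 * s)"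
  proof -
    have "norm ((y - x) - (?p y - ?p x)) \<le> \<epsilon> * norm (y - x)"
      by (rule flat_over_proj_near[OF sub fl x y(1)])
    also have "\<dots> \<le> \<epsilon> * (3 * s)" using nxy e by (intro mult_left_mono) auto
    finally show ?thesis .
  qed
  have "s *\<^sub>R u - (y - x) = (z - ?p y) - ((y - x) - (?p y - ?p x))" by (simp add: z_def)
  then have "dist (s *\<^sub>R u) (y - x) \<le> dist z (?p y) + norm ((y - x) - (?p y - ?p x))"
    by (metis dist_norm norm_triangle_ineq4)
  moreover have "infdist (s *\<^sub>R u) P \<le> infdist (y - x) P + dist (s *\<^sub>R u) (y - x)"
    by (rule infdist_triangle)
  ultimately have "infdist (s *\<^sub>R u) P \<le> 7 * \<epsilon> * s" using a b y(2) by (simp add: algebra_simps)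
  moreover have "infdist q P = norm q / s * infdist (s *\<^sub>R u) P"
  proof -
    have eq: "q = (norm q / s) *\<^sub>R (s *\<^sub>R u)" using s False by (simp add: u_def)
    have "orth_proj P q = (norm q / s) *\<^sub>R orth_proj P (s *\<^sub>R u)"
      using bounded_linear_orth_proj[OF subP] eq by (metis bounded_linear.linear linear_scale)
    then have "q - orth_proj P q = (norm q / s) *\<^sub>R (s *\<^sub>R u - orth_proj P (s *\<^sub>R u))"
      using eq by (simp add: scaleR_diff_right)
    then show ?thesis using s by (simp add: infdist_subspace[OF subP])
  qed
  moreover have "0 \<le> norm q / s" using s by simp
  ultimately have "infdist q P \<le> norm q / s * (7 * \<epsilon> * s)"
    by (metis mult_left_mono)
  then show ?thesis using s by (simp add: mult_ac)
qed

text \<open>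
  For a rational \<open>q\<close>, the measure with density \<open>\<bar>f - q\<bar>\<close> outside \<open>{y. \<bar>f y - q\<bar> < h}\<close> gives no mass to
  this set, so by \<open>AE_vanishing_density\<close> it has density zero at almost every point of it.  At such a
  point the mean oscillation of \<open>f\<close> is of order \<open>h\<close>.
\<close>
lemma AE_lebesgue_point:
  fixes \<mu> :: "'a::euclidean_space measure" and f :: "'a \<Rightarrow> real"
  assumes sets_\<mu> [measurable_cong]: "sets \<mu> = sets borel" and fin: "finite_measure \<mu>" and int: "integrable \<mu> f"
  shows "AE x in \<mu>. bounded_density d \<mu> x \<longrightarrow> zero_density d (density \<mu> (\<lambda>y. ennreal \<bar>f y - f x\<bar>)) x"
proof -
  interpret finite_measure \<mu> by (rule fin)
  have space: "space \<mu> = UNIV" using sets_eq_imp_space_eq[OF sets_\<mu>] by simp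
  have f [measurable]: "f \<in> borel_measurable \<mu>" using int by simp
  define Z where "Z q n = {y. \<bar>f y - of_rat q\<bar> < 1 / real (Suc n)}" for q n
  have fb: "f \<in> borel_measurable borel" using f by (simp cong: measurable_cong_sets[OF sets_\<mu> refl])
  have Z [measurable]: "Z q n \<in> sets borel" for q n
  proof -
    have "{y \<in> space borel. \<bar>f y - of_rat q\<bar> < 1 / real (Suc n)} \<in> sets borel"
      using fb by measurable
    then show ?thesis by (simp add: Z_def)
  qed
  define \<sigma> where "\<sigma> q n = density \<mu> (\<lambda>y. ennreal \<bar>f y - of_rat q\<bar> * indicator (- Z q n) y)" for q n
  have "AE x in \<mu>. x \<in> Z q n \<longrightarrow> bounded_density d \<mu> x \<longrightarrow> zero_density d (\<sigma> q n) x" for q n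
  proof (rule AE_vanishing_density)
    have "emeasure (\<sigma> q n) UNIV = (\<integral>\<^sup>+y. ennreal \<bar>f y - of_rat q\<bar> * indicator (- Z q n) y \<partial>\<mu>)"
      unfolding \<sigma>_def by (subst emeasure_density) (auto simp: space[symmetric])
    also have "\<dots> \<le> (\<integral>\<^sup>+y. ennreal (norm (f y - of_rat q)) \<partial>\<mu>)"
      by (intro nn_integral_mono) (auto simp: indicator_def)
    also have "\<dots> < \<infinity>"
      using Bochner_Integration.integrable_diff[OF int integrable_const, of "of_rat q"] by (simp add: integrable_iff_bounded)
    finally show "emeasure (\<sigma> q n) UNIV < \<infinity>" .
    have "emeasure (\<sigma> q n) (Z q n) =
        (\<integral>\<^sup>+y. ennreal \<bar>f y - of_rat q\<bar> * indicator (- Z q n) y * indicator (Z q n) y \<partial>\<mu>)"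
      unfolding \<sigma>_def by (subst emeasure_density) auto
    also have "\<dots> = (\<integral>\<^sup>+y. 0 \<partial>\<mu>)" by (intro nn_integral_cong) (auto simp: indicator_def)
    finally show "emeasure (\<sigma> q n) (Z q n) = 0" by simp
  qed (auto simp: sets_\<mu> \<sigma>_def)
  then have "AE x in \<mu>. \<forall>q n. x \<in> Z q n \<longrightarrow> bounded_density d \<mu> x \<longrightarrow> zero_density d (\<sigma> q n) x"
    by (simp add: AE_all_countable)
  then show ?thesis
  proof eventually_elim
    fix x assume x: "\<forall>q n. x \<in> Z q n \<longrightarrow> bounded_density d \<mu> x \<longrightarrow> zero_density d (\<sigma> q n) x"
    show "bounded_density d \<mu> x \<longrightarrow> zero_density d (density \<mu> (\<lambda>y. ennreal \<bar>f y - f x\<bar>)) x"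
    proof
      assume bd: "bounded_density d \<mu> x"
      then obtain C0 \<rho> where \<rho>: "0 < \<rho>"
        "\<And>r. 0 < r \<and> r < \<rho> \<Longrightarrow> emeasure \<mu> (ball x r) \<le> ennreal (C0 * r ^ d)"
        unfolding bounded_density_def by blast
      define C where "C = max C0 1"
      have C: "0 < C" "emeasure \<mu> (ball x r) \<le> ennreal (C * r ^ d)" if "0 < r \<and> r < \<rho>" for r
      proof -
        show "0 < C" by (simp add: C_def)
        have "C0 * r ^ d \<le> C * r ^ d" using that by (intro mult_right_mono) (auto simp: C_def)
        then show "emeasure \<mu> (ball x r) \<le> ennreal (C * r ^ d)"
          using \<rho>(2)[OF that] ennreal_leI order_trans by blast
      qed
      have C0: "0 < C" by (simp add: C_def)
      show "zero_density d (density \<mu> (\<lambda>y. ennreal \<bar>f y - f x\<bar>)) x"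
        unfolding zero_density_def
      proof (intro allI impI)
        fix c :: real assume c: "0 < c"
        obtain n where n: "4 * C / c < real (Suc n)" using ex_less_of_nat_Suc by blast
        define h where "h = 1 / real (Suc n)"
        have h: "0 < h" "2 * h * C \<le> c / 2" using n c by (auto simp: h_def field_simps)
        obtain q where q: "\<bar>f x - of_rat q\<bar> < h"
        proof -
          obtain q where "f x - h < real_of_rat q" "real_of_rat q < f x + h"
            using of_rat_dense[of "f x - h" "f x + h"] h by auto
          then show ?thesis by (intro that[of q]) (simp add: abs_less_iff)
        qed
        then have "x \<in> Z q n" by (simp add: Z_def h_def)
        then have "zero_density d (\<sigma> q n) x" using x bd by blast
        then obtain \<delta> where \<delta>: "0 < \<delta>"
          "\<And>r. 0 < r \<and> r < \<delta> \<Longrightarrow> emeasure (\<sigma> q n) (ball x r) \<le> ennreal (c / 2 * r ^ d)"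
          unfolding zero_density_def using c by (meson half_gt_zero)
        have "emeasure (density \<mu> (\<lambda>y. ennreal \<bar>f y - f x\<bar>)) (ball x r) \<le> ennreal (c * r ^ d)"
          if r: "0 < r \<and> r < min \<delta> \<rho>" for r
        proof -
          have [measurable]: "ball x r \<in> sets \<mu>" "- Z q n \<in> sets \<mu>" using Z by (auto simp: sets_\<mu>)
          have "emeasure (density \<mu> (\<lambda>y. ennreal \<bar>f y - f x\<bar>)) (ball x r) =
             (\<integral>\<^sup>+y. ennreal \<bar>f y - f x\<bar> * indicator (ball x r) y \<partial>\<mu>)"
            by (subst emeasure_density) auto
          also have "\<dots> \<le> (\<integral>\<^sup>+y. (ennreal \<bar>f y - of_rat q\<bar> * indicator (- Z q n) y) * indicator (ball x r) y
              + ennreal (2 * h) * indicator (ball x r) y \<partial>\<mu>)"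
          proof (rule nn_integral_mono)
            fix y
            have tri: "\<bar>f y - f x\<bar> \<le> \<bar>f y - of_rat q\<bar> + \<bar>f x - of_rat q\<bar>" by linarith
            have "ennreal \<bar>f y - f x\<bar> \<le> ennreal \<bar>f y - of_rat q\<bar> * indicator (- Z q n) y + ennreal (2 * h)"
            proof (cases "y \<in> Z q n")
              case True
              then have "\<bar>f y - of_rat q\<bar> < h" by (simp add: Z_def h_def)
              then have "\<bar>f y - f x\<bar> \<le> 2 * h" using tri q by linarith
              then show ?thesis using True by (simp add: ennreal_leI)
            next
              case False
              have "\<bar>f y - f x\<bar> \<le> \<bar>f y - of_rat q\<bar> + 2 * h" using tri q h by linarith
              then show ?thesis using False h by (simp add: ennreal_leI flip: ennreal_plus)
            qed
            then show "ennreal \<bar>f y - f x\<bar> * indicator (ball x r) y \<le>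
              (ennreal \<bar>f y - of_rat q\<bar> * indicator (- Z q n) y) * indicator (ball x r) y
              + ennreal (2 * h) * indicator (ball x r) y" by (simp add: indicator_def)
          qed
          also have "\<dots> = emeasure (\<sigma> q n) (ball x r) + ennreal (2 * h) * emeasure \<mu> (ball x r)"
            unfolding \<sigma>_def
            by (subst nn_integral_add) (auto simp: emeasure_density nn_integral_cmult_indicator)
          also have "\<dots> \<le> ennreal (c / 2 * r ^ d) + ennreal (2 * h) * ennreal (C * r ^ d)"
            using \<delta>(2)[of r] C(2)[of r] r by (intro add_mono mult_left_mono) auto
          also have "\<dots> = ennreal (c / 2 * r ^ d + 2 * h * (C * r ^ d))"
          proof -
            have nn: "0 \<le> c / 2 * r ^ d" "0 \<le> 2 * h" "0 \<le> C * r ^ d" using h C0 c r by auto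
            show ?thesis
              using ennreal_plus[OF nn(1) mult_nonneg_nonneg[OF nn(2,3)]] ennreal_mult[OF nn(2,3)] by metis
          qed
          also have "\<dots> \<le> ennreal (c * r ^ d)"
          proof (rule ennreal_leI)
            have "2 * h * C * r ^ d \<le> c / 2 * r ^ d" using h r by (intro mult_right_mono) auto
            then show "c / 2 * r ^ d + 2 * h * (C * r ^ d) \<le> c * r ^ d" by (simp add: mult_ac)
          qed
          finally show ?thesis .
        qed
        moreover have "0 < min \<delta> \<rho>" using \<delta> \<rho> by simp
        ultimately show "\<exists>\<delta>>0. \<forall>r. 0 < r \<and> r < \<delta> \<longrightarrow>
           emeasure (density \<mu> (\<lambda>y. ennreal \<bar>f y - f x\<bar>)) (ball x r) \<le> ennreal (c * r ^ d)" by blast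
      qed
    qed
  qed
qed

text \<open>
  A plane is invariant under the dilations about its points, which multiply the Hausdorff measure
  by \<open>r ^ d\<close>: it is its own blow-up.
\<close>
lemma integral_hausdorff_on_plane_scale:
  fixes \<phi> :: "'a::euclidean_space \<Rightarrow> real"
  assumes d: "0 < d" and Q: "Q \<in> grassmannian d" and a: "a \<in> Q" and r: "0 < r"
    and \<phi> [measurable]: "\<phi> \<in> borel_measurable borel"
  shows "(\<integral>z. \<phi> ((1 / r) *\<^sub>R (z - a)) \<partial>hausdorff_on d Q) = r ^ d * (\<integral>z. \<phi> z \<partial>hausdorff_on d Q)"
proof -
  have sub: "subspace Q" using Q by (rule grassmannian_subspace)
  have bQ [measurable]: "Q \<in> sets borel" using Q by (rule grassmannian_borel)
  have "distr (hausdorff_on d Q) borel (\<lambda>z. (1 / r) *\<^sub>R (z - a)) =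
      density (hausdorff_on d Q) (\<lambda>_. ennreal (r ^ d))"
  proof (rule measure_eqI)
    fix B assume "B \<in> sets (distr (hausdorff_on d Q) borel (\<lambda>z. (1 / r) *\<^sub>R (z - a)))"
    then have B [measurable]: "B \<in> sets borel" by simp
    have vB [measurable]: "(\<lambda>z. (1 / r) *\<^sub>R (z - a)) -` B \<in> sets borel"
      using measurable_sets[of "\<lambda>z. (1 / r) *\<^sub>R (z - a)" borel borel B] by simp
    have "Q \<inter> (\<lambda>z. (1 / r) *\<^sub>R (z - a)) -` B = (\<lambda>y. a + r *\<^sub>R y) ` (Q \<inter> B)"
    proof (intro equalityI subsetI)
      fix y assume y: "y \<in> Q \<inter> (\<lambda>z. (1 / r) *\<^sub>R (z - a)) -` B"
      have "y = a + r *\<^sub>R ((1 / r) *\<^sub>R (y - a))" using r by simp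
      moreover have "(1 / r) *\<^sub>R (y - a) \<in> Q \<inter> B"
        using y sub a by (auto intro: subspace_scale subspace_diff)
      ultimately show "y \<in> (\<lambda>y. a + r *\<^sub>R y) ` (Q \<inter> B)" by blast
    next
      fix y assume "y \<in> (\<lambda>y. a + r *\<^sub>R y) ` (Q \<inter> B)"
      then show "y \<in> Q \<inter> (\<lambda>z. (1 / r) *\<^sub>R (z - a)) -` B"
        using sub a r by (auto intro: subspace_add subspace_scale)
    qed
    then have "hausdorff_outer d (Q \<inter> (\<lambda>z. (1 / r) *\<^sub>R (z - a)) -` B) = ennreal (r ^ d) * hausdorff_outer d (Q \<inter> B)"
      using hausdorff_outer_scale_translate[OF r] by metis
    then show "emeasure (distr (hausdorff_on d Q) borel (\<lambda>z. (1 / r) *\<^sub>R (z - a))) B =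
        emeasure (density (hausdorff_on d Q) (\<lambda>_. ennreal (r ^ d))) B"
      by (simp add: emeasure_distr emeasure_density_const emeasure_hausdorff_on d)
  qed simp
  then have "(\<integral>z. \<phi> z \<partial>distr (hausdorff_on d Q) borel (\<lambda>z. (1 / r) *\<^sub>R (z - a))) =
      (\<integral>z. \<phi> z \<partial>density (hausdorff_on d Q) (\<lambda>_. ennreal (r ^ d)))" by simp
  then show ?thesis
    using r by (simp add: integral_distr integral_density)
qed

section \<open>Blow-ups of a measure on a flat piece\<close>

lemma integral_split_density:
  fixes f :: "'a \<Rightarrow> real"
  assumes K [measurable]: "K \<in> sets M" and f: "integrable M f"
  shows "(\<integral>x. f x \<partial>M) = (\<integral>x. f x \<partial>density M (indicator K)) + (\<integral>x. f x \<partial>density M (indicator (- K)))"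
proof -
  have [measurable]: "f \<in> borel_measurable M" using f by simp
  have ind: "(\<integral>x. f x \<partial>density M (indicator A)) = (\<integral>x. indicator A x * f x \<partial>M)"
    if [measurable]: "(indicator A :: 'a \<Rightarrow> real) \<in> borel_measurable M" for A
  proof -
    have eq: "(indicator A :: 'a \<Rightarrow> ennreal) = (\<lambda>x. ennreal (indicator A x))"
      by (auto simp: indicator_def)
    show ?thesis unfolding eq by (subst integral_density) auto
  qed
  have mK: "(indicator (- K) :: 'a \<Rightarrow> real) \<in> borel_measurable M"
  proof -
    have "(\<lambda>x. 1 - indicator K x :: real) \<in> borel_measurable M" by measurable
    then show ?thesis by (rule measurable_cong[THEN iffD1, rotated]) (auto simp: indicator_def)
  qed
  have i1: "integrable M (\<lambda>x. indicator K x * f x)"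
    using integrable_mult_indicator[OF K f] by simp
  have i2: "integrable M (\<lambda>x. indicator (- K) x * f x)"
  proof -
    have "integrable M (\<lambda>x. f x - indicator K x * f x)" using f i1 by simp
    then show ?thesis by (rule Bochner_Integration.integrable_cong[THEN iffD1, rotated -1]) (auto simp: indicator_def)
  qed
  have "(\<integral>x. f x \<partial>M) = (\<integral>x. indicator K x * f x + indicator (- K) x * f x \<partial>M)"
    by (intro Bochner_Integration.integral_cong) (auto simp: indicator_def)
  also have "\<dots> = (\<integral>x. indicator K x * f x \<partial>M) + (\<integral>x. indicator (- K) x * f x \<partial>M)"
    by (rule Bochner_Integration.integral_add[OF i1 i2])
  finally show ?thesis using mK by (simp add: ind)
qed

lemma density_hausdorff_on_indicator:
  assumes d: "0 < d" and [measurable]: "A \<in> sets borel" "B \<in> sets borel"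
  shows "density (hausdorff_on d A) (indicator B) = hausdorff_on d (A \<inter> B)"
proof (rule measure_eqI)
  fix C assume "C \<in> sets (density (hausdorff_on d A) (indicator B))"
  then have [measurable]: "C \<in> sets borel" by simp
  have "emeasure (density (hausdorff_on d A) (indicator B)) C = emeasure (hausdorff_on d A) (B \<inter> C)"
    by (subst emeasure_density) (auto simp: indicator_inter_arith[symmetric])
  then show "emeasure (density (hausdorff_on d A) (indicator B)) C = emeasure (hausdorff_on d (A \<inter> B)) C"
    by (simp add: emeasure_hausdorff_on d Int_assoc)
qed simp

text \<open>
  Chain of approximations for the rescaled integral of \<open>\<phi>\<close>, each with the hypothesis responsible for it:
  the measure \<open>m\<close> by its restriction to \<open>K\<close> (\<open>zd1\<close>), that restriction by \<open>\<theta> x\<close> times the Hausdorff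
  measure of \<open>K\<close> (\<open>zd2\<close>), this one by the Hausdorff measure of the projection of \<open>K\<close>
  (\<open>flat_integral_compare\<close>), and the latter by the Hausdorff measure of the plane \<open>Q\<close> (\<open>zd3\<close>), which is
  scale invariant.  Finally \<open>flat_integral_compare\<close> at scale \<open>1\<close> replaces \<open>Q\<close> by \<open>P\<close>.  Only the two uses
  of \<open>flat_integral_compare\<close> leave an error that does not vanish with \<open>r\<close>, and this error is small with
  \<open>\<epsilon>\<close> and \<open>w\<close>.
\<close>
lemma blowup_estimate:
  fixes m :: "'a::euclidean_space measure" and \<phi> \<theta> :: "'a \<Rightarrow> real"
  assumes d: "0 < d" and fin: "finite_measure m" and sets_m [measurable_cong]: "sets m = sets borel"
    and K: "compact K" and Q: "Q \<in> grassmannian d" and P: "P \<in> grassmannian d"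
    and fl: "flat_over \<epsilon> Q K" and e: "0 < \<epsilon>" "14 * \<epsilon> \<le> 1" and x: "x \<in> K"
    and \<theta> [measurable]: "\<theta> \<in> borel_measurable borel" and \<theta>0: "\<And>y. 0 \<le> \<theta> y"
    and dens: "density m (indicator K) = density (hausdorff_on d K) (\<lambda>y. ennreal (\<theta> y))"
    and zd1: "zero_density d (density m (indicator (- K))) x"
    and zd2: "zero_density d (density (hausdorff_on d K) (\<lambda>y. ennreal \<bar>\<theta> y - \<theta> x\<bar>)) x"
    and zd3: "zero_density d (hausdorff_on d (Q - orth_proj Q ` K)) (orth_proj Q x)"
    and gap: "\<And>q. q \<in> Q \<Longrightarrow> infdist q P \<le> 7 * \<epsilon> * norm q"
    and \<phi>: "continuous_on UNIV \<phi>" "\<And>u. 0 \<le> \<phi> u" "\<And>u. \<phi> u \<le> b" "\<And>u. R \<le> norm u \<Longrightarrow> \<phi> u = 0"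
    and R: "0 < R"
    and modulus: "\<And>u v. norm (u - v) \<le> 14 * \<epsilon> * R \<Longrightarrow> \<bar>\<phi> u - \<phi> v\<bar> \<le> w"
    and e0: "0 < e0"
  shows "\<forall>\<^sub>F r in at_right 0.
     \<bar>1 / r ^ d * (\<integral>y. \<phi> ((1 / r) *\<^sub>R (y - x)) \<partial>m) - \<theta> x * (\<integral>y. \<phi> y \<partial>hausdorff_on d P)\<bar>
      \<le> \<theta> x * (2 * (plane_const d * R ^ d * (4 ^ d * w + ((1 / (1 - 7 * \<epsilon>)) ^ d - 1) * b))) + e0"
proof -
  interpret finite_measure m by (rule fin)
  let ?p = "orth_proj Q"
  let ?HK = "hausdorff_on d K" and ?HQ = "hausdorff_on d Q"
  define E where "E = plane_const d * R ^ d * (4 ^ d * w + ((1 / (1 - 7 * \<epsilon>)) ^ d - 1) * b)"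
  have sub: "subspace Q" and subP: "subspace P" using Q P by (auto intro: grassmannian_subspace)
  have cpK: "compact (?p ` K)" by (rule compact_continuous_image[OF continuous_orth_proj[OF sub] K])
  have [measurable]: "K \<in> sets borel" "?p ` K \<in> sets borel"
    using cpK K by (auto intro: borel_closed compact_imp_closed)
  have [measurable]: "Q \<in> sets borel" "P \<in> sets borel" using Q P by (auto intro: grassmannian_borel)
  have [measurable]: "\<phi> \<in> borel_measurable borel" using \<phi>(1) by (intro borel_measurable_continuous_onI)
  have b0: "0 \<le> b" using \<phi>(2,3) order_trans by blast
  have e1: "\<epsilon> \<le> 1/2" "7 * \<epsilon> \<le> 1/2" "0 \<le> 7 * \<epsilon>" using e by auto
  have pKQ: "?p ` K \<subseteq> Q" using orth_proj_in[OF sub] by blast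
  have finHK: "hausdorff_outer d K < \<infinity>"
    by (rule hausdorff_outer_flat_finite[OF d Q fl e1(1) compact_imp_bounded[OF K]])
  interpret HK: finite_measure ?HK by (rule finite_measure_hausdorff_on[OF d _ finHK]) simp
  \<comment> \<open>Each of the three terms of density zero costs \<open>b * c * (R * r) ^ d\<close>, the one that comes from
    \<open>zd3\<close> with the factor \<open>\<theta> x\<close>; the summand \<open>1\<close> avoids division by zero.\<close>
  define c where "c = e0 / (b * R ^ d * (2 + \<theta> x) + 1)"
  have D: "0 < b * R ^ d * (2 + \<theta> x) + 1" using b0 R \<theta>0[of x] by (intro add_nonneg_pos) auto
  have c: "0 < c" "b * R ^ d * (2 + \<theta> x) * c \<le> e0"
    using D e0 by (auto simp: c_def field_simps)
  obtain \<delta>1 where \<delta>1: "0 < \<delta>1" "\<And>r. 0 < r \<and> r < \<delta>1 \<Longrightarrow>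
     emeasure (density m (indicator (- K))) (ball x r) \<le> ennreal (c * r ^ d)"
    using zd1 c(1) unfolding zero_density_def by blast
  obtain \<delta>2 where \<delta>2: "0 < \<delta>2" "\<And>r. 0 < r \<and> r < \<delta>2 \<Longrightarrow>
     emeasure (density ?HK (\<lambda>y. ennreal \<bar>\<theta> y - \<theta> x\<bar>)) (ball x r) \<le> ennreal (c * r ^ d)"
    using zd2 c(1) unfolding zero_density_def by blast
  obtain \<delta>3 where \<delta>3: "0 < \<delta>3" "\<And>r. 0 < r \<and> r < \<delta>3 \<Longrightarrow>
     emeasure (hausdorff_on d (Q - ?p ` K)) (ball (?p x) r) \<le> ennreal (c * r ^ d)"
    using zd3 c(1) unfolding zero_density_def by blast
  define \<delta> where "\<delta> = min \<delta>1 (min \<delta>2 \<delta>3) / R"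
  have \<delta>: "0 < \<delta>" using \<delta>1(1) \<delta>2(1) \<delta>3(1) R by (simp add: \<delta>_def)
  have finQball: "emeasure ?HQ (ball a s) < \<infinity>" if "0 < s" "a \<in> Q" for a s
    using hausdorff_outer_plane_ball[OF d Q that(2,1)] by (simp add: emeasure_hausdorff_on d le_less_trans)
  have fPQ: "flat_over (7 * \<epsilon>) P Q" by (rule flat_over_plane[OF subP sub gap])
  have ontoP: "orth_proj P ` Q = P" using e1 by (intro orth_proj_plane_onto[OF P Q fPQ]) auto
  have LQP: "\<bar>(\<integral>z. \<phi> z \<partial>?HQ) - (\<integral>z. \<phi> z \<partial>hausdorff_on d P)\<bar> \<le> E"
    using flat_integral_compare[OF d P fPQ e1(3,2) _ _ subspace_0[OF sub] \<phi> R, of w] modulus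
    by (simp add: ontoP E_def orth_proj_id[OF subP subspace_0[OF subP]] mult_ac)
  have main: "\<bar>1 / r ^ d * (\<integral>y. \<phi> ((1 / r) *\<^sub>R (y - x)) \<partial>m) - \<theta> x * (\<integral>y. \<phi> y \<partial>hausdorff_on d P)\<bar>
      \<le> \<theta> x * (2 * E) + e0" if r: "0 < r" "r < \<delta>" for r
  proof -
    define s where "s = R * r"
    have s: "0 < s" "s < \<delta>1" "s < \<delta>2" "s < \<delta>3"
      using r R by (auto simp: s_def \<delta>_def field_simps)
    have cs0: "0 \<le> c * s ^ d" using c s by simp
    define \<phi>r where "\<phi>r u = \<phi> ((1 / r) *\<^sub>R u)" for u
    have \<phi>r: "continuous_on UNIV \<phi>r" "\<And>u. 0 \<le> \<phi>r u" "\<And>u. \<phi>r u \<le> b" "\<And>u. s \<le> norm u \<Longrightarrow> \<phi>r u = 0"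
    proof -
      show "continuous_on UNIV \<phi>r" unfolding \<phi>r_def
        by (intro continuous_on_compose2[OF \<phi>(1)] continuous_intros) auto
      show "\<phi>r u = 0" if "s \<le> norm u" for u
        unfolding \<phi>r_def using that r by (intro \<phi>(4)) (simp add: s_def field_simps)
    qed (auto simp: \<phi>r_def \<phi>)
    have modr: "\<bar>\<phi>r u - \<phi>r v\<bar> \<le> w" if "norm (u - v) \<le> 2 * \<epsilon> * s" for u v
      unfolding \<phi>r_def
    proof (rule modulus)
      have "norm ((1 / r) *\<^sub>R u - (1 / r) *\<^sub>R v) = norm (u - v) / r"
        using r by (simp flip: scaleR_diff_right)
      also have "\<dots> \<le> 2 * \<epsilon> * R" using that r by (simp add: s_def field_simps)
      also have "\<dots> \<le> 14 * \<epsilon> * R" using e R by simp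
      finally show "norm ((1 / r) *\<^sub>R u - (1 / r) *\<^sub>R v) \<le> 14 * \<epsilon> * R" .
    qed
    have [measurable]: "\<phi>r \<in> borel_measurable borel" using \<phi>r(1) by (intro borel_measurable_continuous_onI)
    define \<psi> where "\<psi> y = \<phi>r (y - x)" for y
    define \<psi>' where "\<psi>' z = \<phi>r (z - ?p x)" for z
    have [measurable]: "\<psi> \<in> borel_measurable borel" "\<psi>' \<in> borel_measurable borel"
      by (simp_all add: \<psi>_def[abs_def] \<psi>'_def[abs_def])
    have \<psi>: "\<bar>\<psi> y\<bar> \<le> b" "0 \<le> \<psi> y" "y \<notin> ball x s \<Longrightarrow> \<psi> y = 0" for y
      using \<phi>r(2,3)[of "y - x"] \<phi>r(4)[of "y - x"] by (auto simp: \<psi>_def dist_norm norm_minus_commute)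
    have \<psi>': "\<bar>\<psi>' y\<bar> \<le> b" "y \<notin> ball (?p x) s \<Longrightarrow> \<psi>' y = 0" for y
      using \<phi>r(2,3)[of "y - ?p x"] \<phi>r(4)[of "y - ?p x"] by (auto simp: \<psi>'_def dist_norm norm_minus_commute)
    have meas: "measure M (ball a s) \<le> c * s ^ d" if "emeasure M (ball a s) \<le> ennreal (c * s ^ d)" for M and a :: 'a
      unfolding measure_def using that cs0 by (intro enn2real_leI) auto
    have lt: "emeasure M (ball a s) < \<infinity>" if "emeasure M (ball a s) \<le> ennreal (c * s ^ d)" for M and a :: 'a
      using that by (simp add: le_less_trans)
    have T2: "\<bar>\<integral>y. \<psi> y \<partial>density m (indicator (- K))\<bar> \<le> b * (c * s ^ d)"
    proof -
      have le: "emeasure (density m (indicator (- K))) (ball x s) \<le> ennreal (c * s ^ d)"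
        using \<delta>1(2)[of s] s by simp
      have "\<bar>\<integral>y. \<psi> y \<partial>density m (indicator (- K))\<bar> \<le> b * measure (density m (indicator (- K))) (ball x s)"
        using \<psi> lt[OF le] by (intro abs_integral_le_support) (auto simp: sets_m)
      also have "\<dots> \<le> b * (c * s ^ d)" by (intro mult_left_mono meas le b0)
      finally show ?thesis .
    qed
    have int\<psi>m: "integrable m \<psi>"
      using \<psi> by (intro integrable_const_bound[of _ b]) auto
    have split: "(\<integral>y. \<psi> y \<partial>m) = (\<integral>y. \<psi> y \<partial>density m (indicator K)) + (\<integral>y. \<psi> y \<partial>density m (indicator (- K)))"
      by (intro integral_split_density int\<psi>m) auto
    have int\<theta>: "integrable ?HK \<theta>"
    proof -
      have "(\<integral>\<^sup>+y. ennreal (\<theta> y) \<partial>?HK) = emeasure (density ?HK (\<lambda>y. ennreal (\<theta> y))) UNIV"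
        by (subst emeasure_density) auto
      also have "\<dots> = emeasure (density m (indicator K)) UNIV" by (simp add: dens)
      also have "\<dots> = emeasure m K"
        using sets_eq_imp_space_eq[OF sets_m] by (subst emeasure_density) auto
      also have "\<dots> < \<infinity>" by (simp add: less_top[symmetric])
      finally show ?thesis using \<theta>0 by (simp add: integrable_iff_bounded)
    qed
    have int\<psi>K: "integrable ?HK \<psi>"
      using \<psi> by (intro HK.integrable_const_bound[of _ b]) auto
    have int\<theta>\<psi>: "integrable ?HK (\<lambda>y. \<theta> y * \<psi> y)"
    proof (rule Bochner_Integration.integrable_bound[of _ "\<lambda>y. b * \<theta> y"])
      show "AE y in ?HK. norm (\<theta> y * \<psi> y) \<le> norm (b * \<theta> y)"
        using \<psi> \<theta>0 b0 by (auto simp: abs_mult mult.commute[of b] intro!: mult_left_mono)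
    qed (use int\<theta> in auto)
    have T1: "\<bar>(\<integral>y. \<psi> y \<partial>density m (indicator K)) - \<theta> x * (\<integral>y. \<psi> y \<partial>?HK)\<bar> \<le> b * (c * s ^ d)"
    proof -
      let ?L = "density ?HK (\<lambda>y. ennreal \<bar>\<theta> y - \<theta> x\<bar>)"
      have le: "emeasure ?L (ball x s) \<le> ennreal (c * s ^ d)" using \<delta>2(2)[of s] s by simp
      have "(\<integral>y. \<psi> y \<partial>density m (indicator K)) - \<theta> x * (\<integral>y. \<psi> y \<partial>?HK) =
          (\<integral>y. \<theta> y * \<psi> y \<partial>?HK) - (\<integral>y. \<theta> x * \<psi> y \<partial>?HK)"
        unfolding dens using \<theta>0 by (subst integral_density) auto
      also have "\<dots> = (\<integral>y. \<theta> y * \<psi> y - \<theta> x * \<psi> y \<partial>?HK)"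
        using int\<theta>\<psi> int\<psi>K by (intro Bochner_Integration.integral_diff[symmetric]) auto
      also have "\<bar>\<dots>\<bar> \<le> (\<integral>y. \<bar>\<theta> y * \<psi> y - \<theta> x * \<psi> y\<bar> \<partial>?HK)" by (rule integral_abs_bound)
      also have "\<dots> = (\<integral>y. \<bar>\<theta> y - \<theta> x\<bar> * \<psi> y \<partial>?HK)"
        using \<psi>(2) by (intro Bochner_Integration.integral_cong) (auto simp: abs_mult left_diff_distrib[symmetric])
      also have "\<dots> = (\<integral>y. \<psi> y \<partial>?L)" by (subst integral_density) auto
      also have "\<dots> \<le> \<bar>\<integral>y. \<psi> y \<partial>?L\<bar>" by simp
      also have "\<dots> \<le> b * measure ?L (ball x s)"
        using \<psi> lt[OF le] by (intro abs_integral_le_support) auto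
      also have "\<dots> \<le> b * (c * s ^ d)" by (intro mult_left_mono meas le b0)
      finally show ?thesis .
    qed
    have T3: "\<bar>(\<integral>y. \<psi> y \<partial>?HK) - (\<integral>z. \<psi>' z \<partial>hausdorff_on d (?p ` K))\<bar> \<le> E * r ^ d"
    proof -
      have w0: "0 \<le> w" using modulus[of 0 0] e R by simp
      have "\<bar>(\<integral>y. \<psi> y \<partial>?HK) - (\<integral>z. \<psi>' z \<partial>hausdorff_on d (?p ` K))\<bar> \<le>
          plane_const d * s ^ d * (4 ^ d * w + ((1 / (1 - \<epsilon>)) ^ d - 1) * b)"
        unfolding \<psi>_def \<psi>'_def
        using e e1 by (intro flat_integral_compare[OF d Q fl _ e1(1) _ _ x \<phi>r s(1) modr]) auto
      also have "\<dots> \<le> plane_const d * s ^ d * (4 ^ d * w + ((1 / (1 - 7 * \<epsilon>)) ^ d - 1) * b)"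
        using e e1 s b0 plane_const_nonneg[of d]
        by (intro mult_left_mono add_left_mono mult_right_mono diff_right_mono power_mono frac_le mult_nonneg_nonneg) auto
      also have "\<dots> = E * r ^ d" by (simp add: E_def s_def power_mult_distrib mult_ac)
      finally show ?thesis .
    qed
    have T4: "\<bar>(\<integral>z. \<psi>' z \<partial>?HQ) - (\<integral>z. \<psi>' z \<partial>hausdorff_on d (?p ` K))\<bar> \<le> b * (c * s ^ d)"
    proof -
      have int: "integrable ?HQ \<psi>'"
        using \<psi>' finQball[OF s(1) orth_proj_in[OF sub]] by (intro integrable_bounded_support[of "ball (?p x) s"]) auto
      have "(\<integral>z. \<psi>' z \<partial>?HQ) = (\<integral>z. \<psi>' z \<partial>density ?HQ (indicator (?p ` K))) + (\<integral>z. \<psi>' z \<partial>density ?HQ (indicator (- ?p ` K)))"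
        by (intro integral_split_density int) auto
      also have "density ?HQ (indicator (?p ` K)) = hausdorff_on d (?p ` K)"
        using pKQ by (subst density_hausdorff_on_indicator[OF d]) (auto simp: Int_absorb1)
      also have "density ?HQ (indicator (- ?p ` K)) = hausdorff_on d (Q - ?p ` K)"
        by (subst density_hausdorff_on_indicator[OF d]) (auto simp: Diff_eq)
      finally have eq: "(\<integral>z. \<psi>' z \<partial>?HQ) - (\<integral>z. \<psi>' z \<partial>hausdorff_on d (?p ` K)) = (\<integral>z. \<psi>' z \<partial>hausdorff_on d (Q - ?p ` K))"
        by simp
      have le: "emeasure (hausdorff_on d (Q - ?p ` K)) (ball (?p x) s) \<le> ennreal (c * s ^ d)"
        using \<delta>3(2)[of s] s by simp
      have "\<bar>\<integral>z. \<psi>' z \<partial>hausdorff_on d (Q - ?p ` K)\<bar> \<le> b * measure (hausdorff_on d (Q - ?p ` K)) (ball (?p x) s)"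
        using \<psi>' lt[OF le] by (intro abs_integral_le_support) auto
      also have "\<dots> \<le> b * (c * s ^ d)" by (intro mult_left_mono meas le b0)
      finally show ?thesis unfolding eq .
    qed
    have T5: "(\<integral>z. \<psi>' z \<partial>?HQ) = r ^ d * (\<integral>z. \<phi> z \<partial>?HQ)"
      unfolding \<psi>'_def \<phi>r_def
      by (rule integral_hausdorff_on_plane_scale[OF d Q orth_proj_in[OF sub] r(1)]) simp
    define LQ LP where "LQ = (\<integral>z. \<phi> z \<partial>?HQ)" and "LP = (\<integral>z. \<phi> z \<partial>hausdorff_on d P)"
    define J where "J = (\<integral>y. \<psi> y \<partial>?HK)"
    have rd: "0 < r ^ d" using r by simp
    have "\<bar>J - r ^ d * LQ\<bar> \<le> E * r ^ d + b * (c * s ^ d)"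
      using T3 T4 unfolding T5 LQ_def[symmetric] J_def[symmetric] by linarith
    moreover have "\<bar>r ^ d * LQ - r ^ d * LP\<bar> \<le> E * r ^ d"
      using LQP rd by (simp add: LQ_def[symmetric] LP_def[symmetric] abs_mult flip: right_diff_distrib)
    ultimately have "\<bar>J - r ^ d * LP\<bar> \<le> 2 * E * r ^ d + b * (c * s ^ d)" by linarith
    then have "\<theta> x * \<bar>J - r ^ d * LP\<bar> \<le> \<theta> x * (2 * E * r ^ d + b * (c * s ^ d))"
      by (intro mult_left_mono \<theta>0)
    then have "\<bar>\<theta> x * J - \<theta> x * (r ^ d * LP)\<bar> \<le> \<theta> x * (2 * E * r ^ d + b * (c * s ^ d))"
      by (simp add: abs_mult \<theta>0 flip: right_diff_distrib)
    then have "\<bar>(\<integral>y. \<psi> y \<partial>m) - \<theta> x * (r ^ d * LP)\<bar> \<le> \<theta> x * (2 * E * r ^ d + b * (c * s ^ d)) + 2 * (b * (c * s ^ d))"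
      using T1 T2 unfolding split J_def[symmetric] by linarith
    also have "\<dots> = r ^ d * (\<theta> x * (2 * E) + b * R ^ d * (2 + \<theta> x) * c)"
      by (simp add: s_def power_mult_distrib algebra_simps)
    also have "\<dots> \<le> r ^ d * (\<theta> x * (2 * E) + e0)" using c(2) rd by (intro mult_left_mono) auto
    finally have "\<bar>(\<integral>y. \<psi> y \<partial>m) - \<theta> x * (r ^ d * LP)\<bar> / r ^ d \<le> \<theta> x * (2 * E) + e0"
      using rd by (simp add: divide_le_eq mult.commute)
    also have "\<bar>(\<integral>y. \<psi> y \<partial>m) - \<theta> x * (r ^ d * LP)\<bar> / r ^ d = \<bar>((\<integral>y. \<psi> y \<partial>m) - \<theta> x * (r ^ d * LP)) / r ^ d\<bar>"
      using rd by simp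
    also have "((\<integral>y. \<psi> y \<partial>m) - \<theta> x * (r ^ d * LP)) / r ^ d = 1 / r ^ d * (\<integral>y. \<psi> y \<partial>m) - \<theta> x * LP"
      using rd r by (simp add: diff_divide_distrib)
    finally show ?thesis by (simp add: \<psi>_def \<phi>r_def LP_def)
  qed
  show ?thesis
    unfolding eventually_at_right_field E_def[symmetric] using main \<delta> by (intro exI[of _ \<delta>]) auto
qed

section \<open>Measures carried by flat pieces\<close>

lemma nn_integral_hausdorff_on:
  fixes f :: "'a::metric_space \<Rightarrow> ennreal"
  assumes d: "0 < d" and A: "A \<in> sets borel" and f: "f \<in> borel_measurable borel"
  shows "(\<integral>\<^sup>+x. f x \<partial>hausdorff_on d A) = (\<integral>\<^sup>+x. f x * indicator A x \<partial>hausdorff_measure d)"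
proof -
  have [measurable]: "A \<in> sets (hausdorff_measure d)"
    using A d by (auto intro: borel_in_sets_hausdorff_measure)
  have f': "f \<in> borel_measurable (hausdorff_measure d)"
    using f d by (rule borel_measurable_hausdorff_measure[rotated])
  have "(\<integral>\<^sup>+x. f x \<partial>hausdorff_on d A) = (\<integral>\<^sup>+x. f x \<partial>density (hausdorff_measure d) (indicator A))"
    unfolding hausdorff_on_def using f by (intro nn_integral_distr id_measurable_hausdorff d) simp
  also have "\<dots> = (\<integral>\<^sup>+x. f x * indicator A x \<partial>hausdorff_measure d)"
    using f' by (subst nn_integral_density) (auto simp: mult.commute)
  finally show ?thesis .
qed

lemma Cc_euclidean_props:
  fixes \<phi> :: "'a::euclidean_space \<Rightarrow> real"
  assumes \<phi>: "\<phi> \<in> Cc euclidean"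
  obtains b R where "continuous_on UNIV \<phi>" "0 < R" "\<And>u. \<bar>\<phi> u\<bar> \<le> b" "\<And>u. R \<le> norm u \<Longrightarrow> \<phi> u = 0"
    "uniformly_continuous_on UNIV \<phi>"
proof -
  have cont: "continuous_on UNIV \<phi>" and comp: "compact (closure {x. \<phi> x \<noteq> 0})"
    using \<phi> by (auto simp: Cc_def)
  obtain R where R: "0 < R" "closure {x. \<phi> x \<noteq> 0} \<subseteq> ball 0 R"
    using bounded_subset_ballD[OF compact_imp_bounded[OF comp]] by blast
  have supp: "\<phi> u = 0" if "R \<le> norm u" for u
    using that R(2) closure_subset[of "{x. \<phi> x \<noteq> 0}"] by force
  have "bounded (\<phi> ` cball 0 (R + 1))"
    by (intro compact_imp_bounded compact_continuous_image continuous_on_subset[OF cont]) auto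
  then obtain b where "\<forall>v\<in>\<phi> ` cball 0 (R + 1). norm v \<le> b"
    unfolding bounded_iff by blast
  then have b: "\<bar>\<phi> u\<bar> \<le> b" if "u \<in> cball 0 (R + 1)" for u
    using that by auto
  have b0: "0 \<le> b" using b[of 0] R(1) by auto
  have bound: "\<bar>\<phi> u\<bar> \<le> b" for u
    using b[of u] supp[of u] b0 by (cases "norm u \<le> R + 1") auto
  have uc: "uniformly_continuous_on (cball 0 (R + 1)) \<phi>"
    by (intro compact_uniformly_continuous continuous_on_subset[OF cont]) auto
  have "uniformly_continuous_on UNIV \<phi>"
    unfolding uniformly_continuous_on_def
  proof (intro allI impI)
    fix e :: real assume e: "0 < e"
    then obtain \<delta> where \<delta>: "0 < \<delta>"
      "\<And>u v. u \<in> cball 0 (R + 1) \<Longrightarrow> v \<in> cball 0 (R + 1) \<Longrightarrow> dist v u < \<delta> \<Longrightarrow> dist (\<phi> v) (\<phi> u) < e"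
      using uc unfolding uniformly_continuous_on_def by metis
    have "dist (\<phi> v) (\<phi> u) < e" if uv: "dist v u < min \<delta> 1" for u v
    proof (cases "norm u \<le> R + 1 \<and> norm v \<le> R + 1")
      case True
      then show ?thesis using \<delta>(2)[of u v] uv by simp
    next
      case False
      have "\<bar>norm u - norm v\<bar> < 1" using uv norm_triangle_ineq3[of v u] by (simp add: dist_norm abs_minus_commute)
      then have "R \<le> norm u" "R \<le> norm v" using False by linarith+
      then show ?thesis using supp e by simp
    qed
    then show "\<exists>d>0. \<forall>x\<in>UNIV. \<forall>x'\<in>UNIV. dist x' x < d \<longrightarrow> dist (\<phi> x') (\<phi> x) < e"
      using \<delta>(1) by (intro exI[of _ "min \<delta> 1"]) auto
  qed
  then show ?thesis using that cont R(1) bound supp by blast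
qed

text \<open>
  A finite measure that for each \<open>n\<close> is carried, up to a null set, by countably many compact pieces
  that are \<open>e n\<close>-flat.  The bound \<open>14 * e n \<le> 1\<close> means that \<open>7 * e n\<close>, which will bound the gap between
  a reference plane and a tangent plane, is at most \<open>1/2\<close>, as the comparison lemmas require.
\<close>
locale flat_pieces =
  fixes d :: nat and m :: "'a::euclidean_space measure" and S X :: "'a set"
    and K :: "nat \<Rightarrow> nat \<Rightarrow> 'a set" and Q :: "nat \<Rightarrow> nat \<Rightarrow> 'a set" and e :: "nat \<Rightarrow> real"
  assumes d: "0 < d"
    and finite_m: "finite_measure m" and sets_m [measurable_cong]: "sets m = sets borel"
    and X [measurable]: "X \<in> sets borel" and m_X: "emeasure m (- X) = 0"
    and bounded_density_X: "\<And>x. x \<in> X \<Longrightarrow> bounded_density d m x"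
    and compact_K: "\<And>n i. compact (K n i)" and K_S: "\<And>n i. K n i \<subseteq> S"
    and Q: "\<And>n i. Q n i \<in> grassmannian d" and flat_K: "\<And>n i. flat_over (e n) (Q n i) (K n i)"
    and e: "\<And>n. 0 < e n" "\<And>n. 14 * e n \<le> 1" "e \<longlonglongrightarrow> 0"
    and X_K: "\<And>n. X \<subseteq> (\<Union>i. K n i)"
begin

lemma K_borel [measurable]: "K n i \<in> sets borel"
  using compact_K by (intro borel_closed compact_imp_closed)

lemma e_half: "e n \<le> 1/2"
  using e(2)[of n] by simp

lemma space_m: "space m = UNIV"
  using sets_eq_imp_space_eq[OF sets_m] by simp

lemma hausdorff_null_imp_null:
  assumes [measurable]: "B \<in> sets borel" and B: "hausdorff_outer d B = 0"
  shows "emeasure m B = 0"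
proof -
  obtain N where N: "N \<in> null_sets m" "B \<inter> X \<subseteq> N"
    using null_set_of_hausdorff_null[OF d sets_m bounded_density_X B] by blast
  have "- X \<in> null_sets m" using m_X X by (auto simp: null_sets_def sets_m)
  then have "N \<union> - X \<in> null_sets m" using N(1) by (rule null_sets.Un[rotated])
  then have "emeasure m (N \<union> - X) = 0" "N \<union> - X \<in> sets m" by auto
  then have "emeasure m B \<le> 0" using N(2) emeasure_mono[of B "N \<union> - X" m] by auto
  then show ?thesis by simp
qed

definition Y :: "'a set" where "Y = (\<Union>i. K 0 i)"

lemma Y_borel [measurable]: "Y \<in> sets borel"
  unfolding Y_def by measurable

lemma hausdorff_K_finite: "hausdorff_outer d (K n i) < \<infinity>"
  by (rule hausdorff_outer_flat_finite[OF d Q flat_K e_half compact_imp_bounded[OF compact_K]])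

lemma sigma_finite_Y: "sigma_finite_measure (hausdorff_on d Y)"
proof
  have "emeasure (hausdorff_on d Y) a \<noteq> \<infinity>" if a: "a \<in> insert (- Y) (range (K 0))" for a
  proof (cases "a = - Y")
    case True
    then show ?thesis using hausdorff_outer_empty[OF d, where 'a = 'a] by (simp add: emeasure_hausdorff_on d)
  next
    case False
    then obtain i where i: "a = K 0 i" using a by blast
    then have "emeasure (hausdorff_on d Y) a = hausdorff_outer d (Y \<inter> K 0 i)"
      by (simp add: emeasure_hausdorff_on d)
    also have "\<dots> \<le> hausdorff_outer d (K 0 i)" by (rule hausdorff_outer_mono) auto
    finally show ?thesis using hausdorff_K_finite[of 0 i] by (auto simp: less_top[symmetric] top_unique)
  qed
  then show "\<exists>A. countable A \<and> A \<subseteq> sets (hausdorff_on d Y) \<and> \<Union> A = space (hausdorff_on d Y) \<and>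
      (\<forall>a\<in>A. emeasure (hausdorff_on d Y) a \<noteq> \<infinity>)"
    by (intro exI[of _ "insert (- Y) (range (K 0))"]) (auto simp: Y_def)
qed

text \<open>
  On the union of the coarsest pieces the Hausdorff measure is sigma-finite, and \<open>m\<close> is absolutely
  continuous with respect to it because of the upper density bound.
\<close>
lemma ex_hausdorff_density:
  "\<exists>\<theta>. \<theta> \<in> borel_measurable borel \<and> (\<forall>x. 0 \<le> \<theta> x) \<and> (AE x in m. 0 < \<theta> x) \<and>
     (\<forall>B\<in>sets borel. emeasure m B = (\<integral>\<^sup>+x. ennreal (\<theta> x) * indicator B x \<partial>hausdorff_measure d))"
proof -
  interpret HY: sigma_finite_measure "hausdorff_on d Y" by (rule sigma_finite_Y)
  have XY: "- Y \<subseteq> - X" using X_K[of 0] by (auto simp: Y_def)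
  then have mY: "- Y \<in> null_sets m"
    using emeasure_mono[OF XY, of m] m_X X by (auto simp: null_sets_def sets_m)
  have ac: "absolutely_continuous (hausdorff_on d Y) m"
    unfolding absolutely_continuous_def
  proof
    fix B assume B: "B \<in> null_sets (hausdorff_on d Y)"
    then have [measurable]: "B \<in> sets borel" by (auto simp: null_sets_def)
    have "hausdorff_outer d (Y \<inter> B) = 0" using B by (auto simp: null_sets_def emeasure_hausdorff_on d)
    then have "Y \<inter> B \<in> null_sets m"
      using hausdorff_null_imp_null[of "Y \<inter> B"] by (auto simp: null_sets_def sets_m)
    then have "(Y \<inter> B) \<union> - Y \<in> null_sets m" using mY by (rule null_sets.Un)
    then show "B \<in> null_sets m" by (rule null_sets_subset) (auto simp: sets_m)
  qed
  obtain D where D: "D \<in> borel_measurable (hausdorff_on d Y)"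
      "AE x in hausdorff_on d Y. RN_deriv (hausdorff_on d Y) m x = ennreal (D x)"
      "AE x in m. 0 < D x" "\<And>x. 0 \<le> D x"
    using HY.real_RN_deriv[OF finite_m ac] by (auto simp: sets_m)
  have [measurable]: "D \<in> borel_measurable borel"
    using D(1) by (simp cong: measurable_cong_sets)
  have m: "m = density (hausdorff_on d Y) (\<lambda>x. ennreal (D x))"
  proof -
    have "m = density (hausdorff_on d Y) (RN_deriv (hausdorff_on d Y) m)"
      using HY.density_RN_deriv[OF ac] by (simp add: sets_m)
    also have "\<dots> = density (hausdorff_on d Y) (\<lambda>x. ennreal (D x))"
      using D(2) by (intro density_cong) auto
    finally show ?thesis .
  qed
  define \<theta> where "\<theta> x = D x * indicator Y x" for x
  have em: "emeasure m B = (\<integral>\<^sup>+x. ennreal (\<theta> x) * indicator B x \<partial>hausdorff_measure d)"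
    if [measurable]: "B \<in> sets borel" for B
  proof -
    have "emeasure m B = emeasure (density (hausdorff_on d Y) (\<lambda>x. ennreal (D x))) B"
      using m by simp
    also have "\<dots> = (\<integral>\<^sup>+x. ennreal (D x) * indicator B x \<partial>hausdorff_on d Y)"
      by (subst emeasure_density) auto
    also have "\<dots> = (\<integral>\<^sup>+x. ennreal (\<theta> x) * indicator B x \<partial>hausdorff_measure d)"
      by (subst nn_integral_hausdorff_on[OF d]) (auto simp: \<theta>_def indicator_def intro!: nn_integral_cong)
    finally show ?thesis .
  qed
  have "AE x in m. x \<in> Y" using mY by (rule AE_I') auto
  then have "AE x in m. 0 < \<theta> x" using D(3) by eventually_elim (simp add: \<theta>_def)
  moreover have "\<theta> \<in> borel_measurable borel" unfolding \<theta>_def[abs_def] by measurable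
  moreover have "0 \<le> \<theta> x" for x using D(4) by (simp add: \<theta>_def)
  ultimately show ?thesis using em by blast
qed

definition \<theta> :: "'a \<Rightarrow> real" where
  "\<theta> = (SOME \<theta>. \<theta> \<in> borel_measurable borel \<and> (\<forall>x. 0 \<le> \<theta> x) \<and> (AE x in m. 0 < \<theta> x) \<and>
     (\<forall>B\<in>sets borel. emeasure m B = (\<integral>\<^sup>+x. ennreal (\<theta> x) * indicator B x \<partial>hausdorff_measure d)))"

lemma \<theta>_borel [measurable]: "\<theta> \<in> borel_measurable borel"
  and \<theta>_nonneg: "0 \<le> \<theta> x"
  and \<theta>_pos: "AE x in m. 0 < \<theta> x"
  and emeasure_m: "B \<in> sets borel \<Longrightarrow>
     emeasure m B = (\<integral>\<^sup>+x. ennreal (\<theta> x) * indicator B x \<partial>hausdorff_measure d)"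
  using someI_ex[OF ex_hausdorff_density, folded \<theta>_def] by blast+

lemma density_on_piece:
  "density m (indicator (K n i)) = density (hausdorff_on d (K n i)) (\<lambda>x. ennreal (\<theta> x))"
proof (rule measure_eqI)
  fix B assume "B \<in> sets (density m (indicator (K n i)))"
  then have [measurable]: "B \<in> sets borel" by (simp add: sets_m)
  have "emeasure (density m (indicator (K n i))) B = emeasure m (K n i \<inter> B)"
    by (subst emeasure_density) (auto simp: indicator_inter_arith[symmetric])
  also have "\<dots> = (\<integral>\<^sup>+x. ennreal (\<theta> x) * indicator B x * indicator (K n i) x \<partial>hausdorff_measure d)"
    by (subst emeasure_m) (auto simp: indicator_def intro!: nn_integral_cong)
  also have "\<dots> = (\<integral>\<^sup>+x. ennreal (\<theta> x) * indicator B x \<partial>hausdorff_on d (K n i))"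
    by (subst nn_integral_hausdorff_on[OF d]) auto
  also have "\<dots> = emeasure (density (hausdorff_on d (K n i)) (\<lambda>x. ennreal (\<theta> x))) B"
    by (subst emeasure_density) auto
  finally show "emeasure (density m (indicator (K n i))) B =
     emeasure (density (hausdorff_on d (K n i)) (\<lambda>x. ennreal (\<theta> x))) B" .
qed (simp add: sets_m)

lemma AE_m_on_piece:
  assumes "AE x in hausdorff_on d (K n i). A x"
  shows "AE x in m. x \<in> K n i \<longrightarrow> A x"
proof -
  have "AE x in density (hausdorff_on d (K n i)) (\<lambda>x. ennreal (\<theta> x)). A x"
    using assms by (subst AE_density) auto
  then have "AE x in m. 0 < (indicator (K n i) x :: ennreal) \<longrightarrow> A x"
    unfolding density_on_piece[symmetric] by (subst (asm) AE_density) auto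
  then show ?thesis by eventually_elim auto
qed

text \<open>
  The conditions under which \<open>blowup_estimate\<close> and \<open>tangent_plane_close\<close> apply at \<open>x\<close> to the piece
  \<open>K n i\<close>.
\<close>
definition good :: "nat \<Rightarrow> nat \<Rightarrow> 'a \<Rightarrow> bool" where
  "good n i x \<longleftrightarrow>
     zero_density d (density m (indicator (- K n i))) x \<and>
     zero_density d (density (hausdorff_on d (K n i)) (\<lambda>y. ennreal \<bar>\<theta> y - \<theta> x\<bar>)) x \<and>
     zero_density d (hausdorff_on d (Q n i - orth_proj (Q n i) ` K n i)) (orth_proj (Q n i) x) \<and>
     hausdorff_outer d (Q n i \<inter> ball 0 1) \<noteq> 0"

lemma AE_good: "AE x in m. x \<in> K n i \<longrightarrow> good n i x"
proof -
  let ?K = "K n i" and ?Q = "Q n i"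
  have sub: "subspace ?Q" using Q by (rule grassmannian_subspace)
  have X_AE: "AE x in m. x \<in> X"
    by (rule AE_I'[of "- X"]) (use m_X X in \<open>auto simp: null_sets_def sets_m\<close>)
  have 1: "AE x in m. x \<in> ?K \<longrightarrow> zero_density d (density m (indicator (- ?K))) x"
  proof -
    have "AE x in m. x \<in> ?K \<longrightarrow> bounded_density d m x \<longrightarrow> zero_density d (density m (indicator (- ?K))) x"
    proof (rule AE_vanishing_density[OF sets_m])
      have "emeasure (density m (indicator (- ?K))) UNIV = emeasure m (- ?K)"
        by (subst emeasure_density) (auto simp: space_m sets_m)
      also have "\<dots> < \<infinity>" using finite_measure.emeasure_finite[OF finite_m] by (simp add: less_top)
      finally show "emeasure (density m (indicator (- ?K))) UNIV < \<infinity>" .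
      have "emeasure (density m (indicator (- ?K))) ?K = (\<integral>\<^sup>+x. indicator (- ?K) x * indicator ?K x \<partial>m)"
        by (subst emeasure_density) auto
      also have "\<dots> = (\<integral>\<^sup>+x. 0 \<partial>m)" by (intro nn_integral_cong) (auto simp: indicator_def)
      finally show "emeasure (density m (indicator (- ?K))) ?K = 0" by simp
    qed (auto simp: sets_m)
    then show ?thesis using X_AE by eventually_elim (use bounded_density_X in auto)
  qed
  have finHK: "finite_measure (hausdorff_on d ?K)"
    by (intro finite_measure_hausdorff_on d hausdorff_K_finite) simp
  have 2: "AE x in m. x \<in> ?K \<longrightarrow>
      zero_density d (density (hausdorff_on d ?K) (\<lambda>y. ennreal \<bar>\<theta> y - \<theta> x\<bar>)) x"
  proof -
    have int: "integrable (hausdorff_on d ?K) \<theta>"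
    proof -
      have "(\<integral>\<^sup>+y. ennreal (\<theta> y) \<partial>hausdorff_on d ?K) = emeasure (density m (indicator ?K)) UNIV"
        unfolding density_on_piece by (subst emeasure_density) auto
      also have "\<dots> = emeasure m ?K"
        by (subst emeasure_density) (auto simp: space_m sets_m)
      also have "\<dots> < \<infinity>" using finite_measure.emeasure_finite[OF finite_m] by (simp add: less_top)
      finally show ?thesis using \<theta>_nonneg by (simp add: integrable_iff_bounded)
    qed
    have bd: "bounded_density d (hausdorff_on d ?K) x" if "x \<in> ?K" for x
      unfolding bounded_density_def
      using hausdorff_outer_flat_ball[OF d Q flat_K e_half that]
      by (intro exI[of _ "2 ^ d * plane_const d"] exI[of _ 1]) (auto simp: emeasure_hausdorff_on d)
    have "AE x in hausdorff_on d ?K. bounded_density d (hausdorff_on d ?K) x \<longrightarrow>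
        zero_density d (density (hausdorff_on d ?K) (\<lambda>y. ennreal \<bar>\<theta> y - \<theta> x\<bar>)) x"
      by (rule AE_lebesgue_point[OF _ finHK int]) simp
    from AE_m_on_piece[OF this] show ?thesis by eventually_elim (use bd in auto)
  qed
  have 3: "AE x in m. x \<in> ?K \<longrightarrow>
     zero_density d (hausdorff_on d (?Q - orth_proj ?Q ` ?K)) (orth_proj ?Q x)"
    using AE_m_on_piece[OF AE_proj_density_point[OF d Q compact_K flat_K e_half]] by eventually_elim auto
  have 4: "AE x in m. x \<in> ?K \<longrightarrow> hausdorff_outer d (?Q \<inter> ball 0 1) \<noteq> 0"
  proof (cases "hausdorff_outer d (?Q \<inter> ball 0 1) = 0")
    case True
    have "hausdorff_outer d ?K = 0"
    proof (cases "?K = {}")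
      case False
      then obtain a where a: "a \<in> ?K" by blast
      obtain R where R: "0 < R" "orth_proj ?Q ` ?K \<subseteq> ball 0 R"
        using bounded_subset_ballD[OF compact_imp_bounded[OF compact_continuous_image[OF continuous_orth_proj[OF sub] compact_K]]]
        by blast
      have "hausdorff_outer d ?K \<le> ennreal ((1 / (1 - e n)) ^ d) * hausdorff_outer d (orth_proj ?Q ` ?K)"
        using e_half[of n] by (intro hausdorff_outer_flat_le[OF sub flat_K]) auto
      also have "hausdorff_outer d (orth_proj ?Q ` ?K) \<le> hausdorff_outer d (?Q \<inter> ball 0 R)"
        using R(2) orth_proj_in[OF sub] by (intro hausdorff_outer_mono) auto
      also have "hausdorff_outer d (?Q \<inter> ball 0 R) = 0"
        by (simp add: hausdorff_outer_plane_ball_eq[OF sub subspace_0[OF sub] R(1)] True)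
      finally show ?thesis by (simp add: mult_left_mono)
    qed (simp add: hausdorff_outer_empty d)
    then have "?K \<in> null_sets m" using hausdorff_null_imp_null[of ?K] by (auto simp: null_sets_def sets_m)
    then show ?thesis by (rule AE_I') auto
  qed simp
  show ?thesis using 1 2 3 4 unfolding good_def by eventually_elim auto
qed

lemma good_plane_close:
  assumes "x \<in> K n i" "good n i x" "P \<in> grassmannian d" "tangent_to S x P" "q \<in> Q n i"
  shows "infdist q P \<le> 7 * e n * norm q"
  using assms e(1) e_half
  by (intro tangent_plane_close[OF d Q _ compact_K K_S flat_K]) (auto simp: good_def)

text \<open>
  The error terms of \<open>blowup_estimate\<close> tend to \<open>0\<close> as the pieces get flatter, while the limit that it
  approximates depends on \<open>P\<close> only.
\<close>
lemma blowup_nonneg: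
  assumes P: "P \<in> grassmannian d" "tangent_to S x P"
    and good: "\<And>n. \<exists>i. x \<in> K n i \<and> good n i x"
    and \<phi>: "continuous_on UNIV \<phi>" "\<And>u. 0 \<le> \<phi> u" "\<And>u. \<phi> u \<le> b" "\<And>u. R \<le> norm u \<Longrightarrow> \<phi> u = 0"
    and uc: "uniformly_continuous_on UNIV \<phi>" and R: "0 < R"
  shows "((\<lambda>r. 1 / r ^ d * (\<integral>y. \<phi> ((1 / r) *\<^sub>R (y - x)) \<partial>m)) \<longlongrightarrow>
     \<theta> x * (\<integral>y. \<phi> y \<partial>hausdorff_on d P)) (at_right 0)"
proof (rule tendstoI)
  fix e0 :: real assume e0: "0 < e0"
  define C where "C = \<theta> x * (2 * (plane_const d * R ^ d))"
  have C0: "0 \<le> C" using \<theta>_nonneg plane_const_nonneg R by (simp add: C_def)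
  define G where "G = C * 4 ^ d + 1"
  define w where "w = e0 / (4 * G)"
  have D: "0 < G" unfolding G_def using C0 by (intro add_nonneg_pos) auto
  have w: "0 < w" "C * (4 ^ d * w) < e0 / 2"
  proof -
    show "0 < w" using D e0 by (simp add: w_def)
    have "C * (4 ^ d * w) \<le> G * w" using \<open>0 < w\<close> by (simp add: G_def algebra_simps)
    also have "\<dots> = e0 / 4" using D by (simp add: w_def)
    finally show "C * (4 ^ d * w) < e0 / 2" using e0 by simp
  qed
  obtain \<delta> where \<delta>: "0 < \<delta>" "\<And>u v. dist u v < \<delta> \<Longrightarrow> dist (\<phi> u) (\<phi> v) < w"
    using uc w(1) unfolding uniformly_continuous_on_def by (metis UNIV_I)
  have "(\<lambda>n. C * (4 ^ d * w + ((1 / (1 - 7 * e n)) ^ d - 1) * b)) \<longlonglongrightarrow>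
      C * (4 ^ d * w + ((1 / (1 - 7 * 0)) ^ d - 1) * b)"
    by (intro tendsto_intros e(3)) auto
  then have "\<forall>\<^sub>F n in sequentially. C * (4 ^ d * w + ((1 / (1 - 7 * e n)) ^ d - 1) * b) < e0 / 2"
    using w(2) by (intro order_tendstoD(2)) auto
  moreover have "(\<lambda>n. 14 * e n * R) \<longlonglongrightarrow> 14 * 0 * R" by (intro tendsto_intros e(3))
  then have "\<forall>\<^sub>F n in sequentially. 14 * e n * R < \<delta>"
    using \<delta>(1) by (intro order_tendstoD(2)) auto
  ultimately have "\<forall>\<^sub>F n in sequentially. C * (4 ^ d * w + ((1 / (1 - 7 * e n)) ^ d - 1) * b) < e0 / 2
      \<and> 14 * e n * R < \<delta>"
    by (rule eventually_conj)
  then obtain n where n: "C * (4 ^ d * w + ((1 / (1 - 7 * e n)) ^ d - 1) * b) < e0 / 2" "14 * e n * R < \<delta>"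
    by (auto simp: eventually_sequentially)
  obtain i where i: "x \<in> K n i" "good n i x" using good by blast
  have "\<forall>\<^sub>F r in at_right 0.
     \<bar>1 / r ^ d * (\<integral>y. \<phi> ((1 / r) *\<^sub>R (y - x)) \<partial>m) - \<theta> x * (\<integral>y. \<phi> y \<partial>hausdorff_on d P)\<bar>
      \<le> \<theta> x * (2 * (plane_const d * R ^ d * (4 ^ d * w + ((1 / (1 - 7 * e n)) ^ d - 1) * b))) + e0 / 2"
  proof (rule blowup_estimate[OF d finite_m sets_m compact_K Q P(1) flat_K e(1) e(2) i(1) \<theta>_borel
        \<theta>_nonneg density_on_piece _ _ _ _ \<phi> R])
    show "infdist q P \<le> 7 * e n * norm q" if "q \<in> Q n i" for q
      by (rule good_plane_close[OF i P that])
    show "\<bar>\<phi> u - \<phi> v\<bar> \<le> w" if "norm (u - v) \<le> 14 * e n * R" for u v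
      using \<delta>(2)[of u v] that n(2) by (simp add: dist_norm)
  qed (use i e0 in \<open>auto simp: good_def\<close>)
  then show "\<forall>\<^sub>F r in at_right 0.
     dist (1 / r ^ d * (\<integral>y. \<phi> ((1 / r) *\<^sub>R (y - x)) \<partial>m)) (\<theta> x * (\<integral>y. \<phi> y \<partial>hausdorff_on d P)) < e0"
  proof eventually_elim
    case (elim r)
    have "\<theta> x * (2 * (plane_const d * R ^ d * (4 ^ d * w + ((1 / (1 - 7 * e n)) ^ d - 1) * b))) =
        C * (4 ^ d * w + ((1 / (1 - 7 * e n)) ^ d - 1) * b)" by (simp add: C_def)
    from elim[unfolded this] show ?case using n(1) unfolding dist_real_def by linarith
  qed
qed

lemma blowup_limit:
  assumes P: "P \<in> grassmannian d" "tangent_to S x P"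
    and good: "\<And>n. \<exists>i. x \<in> K n i \<and> good n i x" and \<phi>: "\<phi> \<in> Cc euclidean"
  shows "((\<lambda>r. 1 / r ^ d * (\<integral>y. \<phi> ((1 / r) *\<^sub>R (y - x)) \<partial>m)) \<longlongrightarrow>
     \<theta> x * (\<integral>y. \<phi> y \<partial>hausdorff_on d P)) (at_right 0)"
proof -
  interpret finite_measure m by (rule finite_m)
  obtain b R where \<phi>': "continuous_on UNIV \<phi>" "0 < R" "\<And>u. \<bar>\<phi> u\<bar> \<le> b" "\<And>u. R \<le> norm u \<Longrightarrow> \<phi> u = 0"
    "uniformly_continuous_on UNIV \<phi>"
    by (rule Cc_euclidean_props[OF \<phi>], rule that, assumption+)
  \<comment> \<open>The cases \<open>s = 1\<close> and \<open>s = -1\<close> are the positive and the negative part of \<open>\<phi>\<close>.\<close>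
  define \<psi> where "\<psi> s u = max (s * \<phi> u) 0" for s u
  have part: "((\<lambda>r. 1 / r ^ d * (\<integral>y. \<psi> s ((1 / r) *\<^sub>R (y - x)) \<partial>m)) \<longlongrightarrow>
     \<theta> x * (\<integral>y. \<psi> s y \<partial>hausdorff_on d P)) (at_right 0)" if s: "\<bar>s\<bar> = 1" for s :: real
  proof (rule blowup_nonneg[OF P good, of "\<psi> s" b R])
    show "continuous_on UNIV (\<psi> s)"
      unfolding \<psi>_def[abs_def] by (intro continuous_intros \<phi>'(1))
    show "0 \<le> \<psi> s u" for u by (simp add: \<psi>_def)
    show "\<psi> s u \<le> b" for u
    proof -
      have "\<bar>s * \<phi> u\<bar> \<le> b" using \<phi>'(3)[of u] s by (simp add: abs_mult)
      then show ?thesis by (auto simp: \<psi>_def max_def)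
    qed
    show "\<psi> s u = 0" if "R \<le> norm u" for u using \<phi>'(4)[OF that] by (simp add: \<psi>_def)
    show "uniformly_continuous_on UNIV (\<psi> s)"
      unfolding uniformly_continuous_on_def
    proof (intro allI impI)
      fix e1 :: real assume "0 < e1"
      then obtain \<delta> where \<delta>: "0 < \<delta>" "\<And>u v. dist u v < \<delta> \<Longrightarrow> dist (\<phi> u) (\<phi> v) < e1"
        using \<phi>'(5) unfolding uniformly_continuous_on_def by (metis UNIV_I)
      have "dist (\<psi> s u) (\<psi> s v) \<le> dist (\<phi> u) (\<phi> v)" for u v
      proof -
        have "\<bar>s * \<phi> u - s * \<phi> v\<bar> = \<bar>\<phi> u - \<phi> v\<bar>"
          using s by (simp add: abs_mult flip: right_diff_distrib)
        then show ?thesis by (auto simp: \<psi>_def dist_real_def max_def)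
      qed
      then show "\<exists>d>0. \<forall>x\<in>UNIV. \<forall>x'\<in>UNIV. dist x' x < d \<longrightarrow> dist (\<psi> s x') (\<psi> s x) < e1"
        using \<delta> by (meson le_less_trans)
    qed
  qed (rule \<phi>'(2))
  have [measurable]: "\<phi> \<in> borel_measurable borel" using \<phi>'(1) by (rule borel_measurable_continuous_onI)
  have [measurable]: "\<psi> s \<in> borel_measurable borel" for s unfolding \<psi>_def[abs_def] by measurable
  have \<psi>b: "\<bar>\<psi> s u\<bar> \<le> b" if "\<bar>s\<bar> = 1" for s u
  proof -
    have "\<bar>s * \<phi> u\<bar> \<le> b" using \<phi>'(3)[of u] that by (simp add: abs_mult)
    then show ?thesis by (auto simp: \<psi>_def max_def)
  qed
  have eq: "\<phi> u = \<psi> 1 u - \<psi> (- 1) u" for u by (auto simp: \<psi>_def max_def)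
  have im: "integrable m (\<lambda>y. \<psi> s ((1 / r) *\<^sub>R (y - x)))" if "\<bar>s\<bar> = 1" for s r
    using \<psi>b[OF that] by (intro integrable_const_bound[of _ b]) auto
  have iP: "integrable (hausdorff_on d P) (\<psi> s)" if "\<bar>s\<bar> = 1" for s
  proof (rule integrable_bounded_support[of "ball 0 R" _ _ b])
    have [measurable]: "P \<in> sets borel" using P(1) by (rule grassmannian_borel)
    show "emeasure (hausdorff_on d P) (ball 0 R) < \<infinity>"
      using hausdorff_outer_plane_ball[OF d P(1) subspace_0[OF grassmannian_subspace[OF P(1)]] \<phi>'(2)]
      by (simp add: emeasure_hausdorff_on d le_less_trans)
    show "\<psi> s u = 0" if "u \<notin> ball 0 R" for u using \<phi>'(4)[of u] that by (simp add: \<psi>_def)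
  qed (use \<psi>b that in auto)
  have "((\<lambda>r. 1 / r ^ d * (\<integral>y. \<psi> 1 ((1 / r) *\<^sub>R (y - x)) \<partial>m) - 1 / r ^ d * (\<integral>y. \<psi> (- 1) ((1 / r) *\<^sub>R (y - x)) \<partial>m))
     \<longlongrightarrow> \<theta> x * (\<integral>y. \<psi> 1 y \<partial>hausdorff_on d P) - \<theta> x * (\<integral>y. \<psi> (- 1) y \<partial>hausdorff_on d P)) (at_right 0)"
    by (intro tendsto_diff part) auto
  moreover have "(\<integral>y. \<phi> ((1 / r) *\<^sub>R (y - x)) \<partial>m) =
      (\<integral>y. \<psi> 1 ((1 / r) *\<^sub>R (y - x)) \<partial>m) - (\<integral>y. \<psi> (- 1) ((1 / r) *\<^sub>R (y - x)) \<partial>m)" for r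
    unfolding eq[of "(1 / r) *\<^sub>R (_ - x)"] by (rule Bochner_Integration.integral_diff) (use im in auto)
  moreover have "(\<integral>y. \<phi> y \<partial>hausdorff_on d P) = (\<integral>y. \<psi> 1 y \<partial>hausdorff_on d P) - (\<integral>y. \<psi> (- 1) y \<partial>hausdorff_on d P)"
    unfolding eq by (rule Bochner_Integration.integral_diff) (use iP in auto)
  ultimately show ?thesis by (simp add: right_diff_distrib)
qed

text \<open>
  The exceptional null sets of the countably many pieces are removed once and for all, so that all
  statements about tangent planes hold at every point of \<open>M\<close>.
\<close>
lemma rectifiable_structure:
  obtains M where "M \<in> sets borel" "M \<subseteq> X" "M \<subseteq> (\<Union>i. K 0 i)" "\<And>x. x \<in> M \<Longrightarrow> 0 < \<theta> x"
    "emeasure m (- M) = 0"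
    "m = distr (weighted_hausdorff d M \<theta>) borel (\<lambda>x. x)"
    "\<And>x n i P q. x \<in> M \<Longrightarrow> x \<in> K n i \<Longrightarrow> P \<in> grassmannian d \<Longrightarrow> tangent_to S x P \<Longrightarrow> q \<in> Q n i \<Longrightarrow>
       infdist q P \<le> 7 * e n * norm q"
    "\<And>x P. x \<in> M \<Longrightarrow> P \<in> grassmannian d \<Longrightarrow> tangent_to S x P \<Longrightarrow> approx_tangent_space d M \<theta> x P"
proof -
  have "AE x in m. \<forall>n i. x \<in> K n i \<longrightarrow> good n i x" using AE_good by (simp add: AE_all_countable)
  then obtain N where N: "N \<in> null_sets m" "\<And>x n i. x \<notin> N \<Longrightarrow> x \<in> K n i \<Longrightarrow> good n i x"
    by (rule AE_E3) (auto simp: space_m)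
  have [measurable]: "N \<in> sets borel" using N(1) by (auto simp: null_sets_def sets_m)
  define M where "M = {x. 0 < \<theta> x} \<inter> X - N"
  have [measurable]: "{x. 0 < \<theta> x} \<in> sets borel"
  proof -
    have "{x \<in> space borel. 0 < \<theta> x} \<in> sets borel" by measurable
    then show ?thesis by simp
  qed
  have M [measurable]: "M \<in> sets borel" by (simp add: M_def)
  have "AE x in m. x \<in> M"
  proof -
    have "AE x in m. x \<in> X"
      by (rule AE_I'[of "- X"]) (use m_X X in \<open>auto simp: null_sets_def sets_m\<close>)
    moreover have "AE x in m. x \<notin> N" using N(1) by (rule AE_not_in)
    ultimately show ?thesis using \<theta>_pos by eventually_elim (auto simp: M_def)
  qed
  then have mM: "emeasure m (- M) = 0"
    by (subst (asm) AE_iff_measurable[of "- M"]) (auto simp: sets_m space_m)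
  have [measurable]: "M \<in> sets (hausdorff_measure d)" "\<theta> \<in> borel_measurable (hausdorff_measure d)"
    by (auto intro: borel_in_sets_hausdorff_measure borel_measurable_hausdorff_measure d)
  have idw: "(\<lambda>x. x) \<in> borel_measurable (weighted_hausdorff d M \<theta>)"
    unfolding weighted_hausdorff_def by (rule id_measurable_hausdorff[OF d])
  have dist: "m = distr (weighted_hausdorff d M \<theta>) borel (\<lambda>x. x)"
  proof (rule measure_eqI)
    fix B assume "B \<in> sets m"
    then have [measurable]: "B \<in> sets borel" by (simp add: sets_m)
    then have [measurable]: "B \<in> sets (hausdorff_measure d)" by (rule borel_in_sets_hausdorff_measure[OF d])
    have "- M \<in> null_sets m" using mM by (auto simp: null_sets_def sets_m)
    then have "emeasure m B = emeasure m (B - - M)"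
      by (intro emeasure_Diff_null_set[symmetric]) (auto simp: sets_m)
    also have "B - - M = B \<inter> M" by auto
    also have "emeasure m (B \<inter> M) = (\<integral>\<^sup>+x. ennreal (\<theta> x) * indicator (B \<inter> M) x \<partial>hausdorff_measure d)"
      by (rule emeasure_m) simp
    also have "\<dots> = (\<integral>\<^sup>+x. ennreal (\<theta> x) * indicator M x * indicator B x \<partial>hausdorff_measure d)"
      by (intro nn_integral_cong) (auto simp: indicator_def)
    also have "\<dots> = emeasure (weighted_hausdorff d M \<theta>) B"
      unfolding weighted_hausdorff_def by (subst emeasure_density) auto
    also have "\<dots> = emeasure (distr (weighted_hausdorff d M \<theta>) borel (\<lambda>x. x)) B"
      by (subst emeasure_distr[OF idw]) (auto simp: weighted_hausdorff_def)
    finally show "emeasure m B = emeasure (distr (weighted_hausdorff d M \<theta>) borel (\<lambda>x. x)) B" .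
  qed (simp add: sets_m)
  have goodM: "good n i x" if "x \<in> M" "x \<in> K n i" for x n i
    using N(2) that by (auto simp: M_def)
  have ex_good: "\<exists>i. x \<in> K n i \<and> good n i x" if "x \<in> M" for x n
  proof -
    have "x \<in> (\<Union>i. K n i)" using that X_K[of n] by (auto simp: M_def)
    then show ?thesis using goodM that by blast
  qed
  show ?thesis
  proof (rule that[OF M _ _ _ mM dist])
    show "M \<subseteq> X" by (auto simp: M_def)
    then show "M \<subseteq> (\<Union>i. K 0 i)" using X_K by blast
    show "0 < \<theta> x" if "x \<in> M" for x using that by (simp add: M_def)
    show "infdist q P \<le> 7 * e n * norm q"
      if "x \<in> M" "x \<in> K n i" "P \<in> grassmannian d" "tangent_to S x P" "q \<in> Q n i" for x n i P q
      using good_plane_close[OF that(2) goodM[OF that(1,2)] that(3-5)] .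
    show "approx_tangent_space d M \<theta> x P"
      if x: "x \<in> M" and P: "P \<in> grassmannian d" "tangent_to S x P" for x P
      unfolding approx_tangent_space_def
    proof (intro conjI ballI P(1))
      fix \<phi> :: "'a \<Rightarrow> real" assume \<phi>: "\<phi> \<in> Cc euclidean"
      have [measurable]: "\<phi> \<in> borel_measurable borel"
        using \<phi> by (auto simp: Cc_def intro: borel_measurable_continuous_onI)
      have 1: "(\<integral>y. \<phi> ((1 / r) *\<^sub>R (y - x)) \<partial>weighted_hausdorff d M \<theta>) = (\<integral>y. \<phi> ((1 / r) *\<^sub>R (y - x)) \<partial>m)" for r
        by (subst dist, subst integral_distr[OF idw]) auto
      have 2: "(LINT y:P|hausdorff_measure d. \<phi> y) = (\<integral>y. \<phi> y \<partial>hausdorff_on d P)"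
        by (rule integral_hausdorff_on[symmetric, OF d grassmannian_borel[OF P(1)]]) simp
      show "((\<lambda>r. 1 / r ^ d * (\<integral>y. \<phi> ((1 / r) *\<^sub>R (y - x)) \<partial>weighted_hausdorff d M \<theta>))
          \<longlongrightarrow> \<theta> x * (LINT y:P|hausdorff_measure d. \<phi> y)) (at_right 0)"
        unfolding 1 2 by (rule blowup_limit[OF P ex_good[OF x] \<phi>])
    qed
  qed
qed

end

section \<open>Compactness of the Grassmannian\<close>

lemma norm_orth_proj_diff_le:
  assumes "subspace P" "subspace Q"
  shows "norm (orth_proj P v - orth_proj Q v) \<le> grass_dist P Q * norm v"
  using onorm[OF bounded_linear_sub[OF bounded_linear_orth_proj[OF assms(1)] bounded_linear_orth_proj[OF assms(2)]], of v]
  by (simp add: grass_dist_def assms)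

lemma infdist_plane_le:
  assumes "subspace P" "subspace Q"
  shows "infdist v Q \<le> infdist v P + grass_dist P Q * norm v"
proof -
  have "norm (v - orth_proj Q v) \<le> norm (v - orth_proj P v) + norm (orth_proj P v - orth_proj Q v)"
    using norm_triangle_ineq[of "v - orth_proj P v" "orth_proj P v - orth_proj Q v"] by simp
  then show ?thesis using norm_orth_proj_diff_le[OF assms, of v] by (simp add: infdist_subspace assms)
qed

lemma grass_dist_commute: "grass_dist P Q = grass_dist Q P"
  using onorm_neg[of "\<lambda>x. orth_proj P x - orth_proj Q x"] by (simp add: grass_dist_def)

lemma dim_le_of_grass_dist:
  assumes P: "subspace P" and Q: "subspace Q" and lt: "grass_dist P Q < 1"
  shows "dim P \<le> dim Q"
proof -
  have lin: "linear (orth_proj Q)" using bounded_linear_orth_proj[OF Q] by (simp add: bounded_linear.linear)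
  have "inj_on (orth_proj Q) P"
  proof (rule inj_onI)
    fix x y assume xy: "x \<in> P" "y \<in> P" "orth_proj Q x = orth_proj Q y"
    have P': "orth_proj P (x - y) = x - y" using xy P by (intro orth_proj_id subspace_diff)
    have "norm (x - y) \<le> grass_dist P Q * norm (x - y)"
      using norm_orth_proj_diff_le[OF P Q, of "x - y"] xy(3) by (simp add: P' orth_proj_diff[OF Q])
    then have "(1 - grass_dist P Q) * norm (x - y) \<le> 0" by (simp add: algebra_simps)
    then show "x = y" using lt by (simp add: mult_le_0_iff)
  qed
  then have "dim (orth_proj Q ` P) = dim P"
    using lin P by (intro dim_image_eq) (auto simp: span_eq_iff[THEN iffD2])
  moreover have "dim (orth_proj Q ` P) \<le> dim Q"
    using orth_proj_in[OF Q] by (intro dim_subset) auto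
  ultimately show ?thesis by simp
qed

text \<open>
  Sends the Grassmannian isometrically into a finite-dimensional normed space, where closed bounded
  sets are compact.
\<close>
definition proj_blinfun :: "'a::euclidean_space set \<Rightarrow> 'a \<Rightarrow>\<^sub>L 'a" where
  "proj_blinfun P = Blinfun (orth_proj P)"

lemma proj_blinfun_apply: "subspace P \<Longrightarrow> blinfun_apply (proj_blinfun P) = orth_proj P"
  by (simp add: proj_blinfun_def bounded_linear_Blinfun_apply bounded_linear_orth_proj)

lemma dist_proj_blinfun:
  assumes "subspace P" "subspace Q"
  shows "dist (proj_blinfun P) (proj_blinfun Q) = grass_dist P Q"
  using assms
  by (simp add: dist_norm norm_blinfun.rep_eq minus_blinfun.rep_eq proj_blinfun_apply grass_dist_def)

text \<open>
  The image is closed: a limit of orthogonal projections is idempotent and self-adjoint, hence is the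
  orthogonal projection onto its set of fixed points, and the dimension of that set is \<open>d\<close> because
  projections at distance less than \<open>1\<close> have equal rank.
\<close>
lemma compact_grassmannian: "compact (proj_blinfun ` (grassmannian d :: 'a::euclidean_space set set))"
proof -
  let ?G = "proj_blinfun ` (grassmannian d :: 'a set set)"
  have "bounded ?G"
    unfolding bounded_iff
  proof (intro exI[of _ 1] ballI)
    fix B assume "B \<in> ?G"
    then obtain P where P: "subspace P" "B = proj_blinfun P" by (auto simp: grassmannian_def)
    have "onorm (orth_proj P) \<le> 1" by (intro onorm_le) (simp add: norm_orth_proj_le P)
    then show "norm B \<le> 1" by (simp add: P norm_blinfun.rep_eq proj_blinfun_apply)
  qed
  moreover have "closed ?G"
    unfolding closed_sequential_limits
  proof (intro allI impI, elim conjE)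
    fix B A assume B: "\<forall>n. B n \<in> ?G" and lim: "B \<longlonglongrightarrow> A"
    have "\<forall>n. \<exists>P\<in>grassmannian d. B n = proj_blinfun P" using B by blast
    then obtain R where R: "\<And>n. R n \<in> grassmannian d" "\<And>n. B n = proj_blinfun (R n)" by metis
    have sub: "subspace (R n)" for n using R(1) by (rule grassmannian_subspace)
    have Bn: "blinfun_apply (B n) = orth_proj (R n)" for n by (simp add: R(2) proj_blinfun_apply sub)
    have limv: "(\<lambda>n. orth_proj (R n) v) \<longlonglongrightarrow> blinfun_apply A v" for v
      using blinfun.tendsto[OF lim tendsto_const[of v]] by (simp add: Bn)
    have idem: "blinfun_apply A (blinfun_apply A v) = blinfun_apply A v" for v
    proof -
      have "(\<lambda>n. blinfun_apply (B n) (orth_proj (R n) v)) \<longlonglongrightarrow> blinfun_apply A (blinfun_apply A v)"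
        by (rule blinfun.tendsto[OF lim limv])
      moreover have "blinfun_apply (B n) (orth_proj (R n) v) = orth_proj (R n) v" for n
        by (simp add: Bn orth_proj_id sub orth_proj_in)
      ultimately have "(\<lambda>n. orth_proj (R n) v) \<longlonglongrightarrow> blinfun_apply A (blinfun_apply A v)" by simp
      then show ?thesis using limv[of v] by (rule LIMSEQ_unique)
    qed
    have adj: "blinfun_apply A u \<bullet> v = u \<bullet> blinfun_apply A v" for u v
    proof -
      have "orth_proj (R n) u \<bullet> v = u \<bullet> orth_proj (R n) v" for n
      proof -
        have "(v - orth_proj (R n) v) \<bullet> orth_proj (R n) u = 0" "(u - orth_proj (R n) u) \<bullet> orth_proj (R n) v = 0"
          using orth_proj_orthogonal[OF sub orth_proj_in[OF sub]] by (auto simp: orthogonal_def)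
        then show ?thesis by (simp add: inner_diff_left inner_diff_right inner_commute)
      qed
      then have "(\<lambda>n. orth_proj (R n) u \<bullet> v) \<longlonglongrightarrow> u \<bullet> blinfun_apply A v"
        using tendsto_inner[OF tendsto_const[of u] limv[of v]] by simp
      moreover have "(\<lambda>n. orth_proj (R n) u \<bullet> v) \<longlonglongrightarrow> blinfun_apply A u \<bullet> v"
        by (intro tendsto_inner limv tendsto_const)
      ultimately show ?thesis by (rule LIMSEQ_unique[rotated])
    qed
    define P where "P = {v. blinfun_apply A v = v}"
    have subP: "subspace P"
      unfolding subspace_def P_def by (auto simp: blinfun.add_right blinfun.scaleR_right)
    have proj: "orth_proj P v = blinfun_apply A v" for v
    proof (rule orth_proj_unique[OF subP])
      show "blinfun_apply A v \<in> P" by (simp add: P_def idem)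
      fix z assume "z \<in> P"
      then have z: "blinfun_apply A z = z" by (simp add: P_def)
      have "(v - blinfun_apply A v) \<bullet> z = v \<bullet> z - v \<bullet> blinfun_apply A z"
        by (simp add: inner_diff_left adj)
      then show "orthogonal (v - blinfun_apply A v) z" by (simp add: orthogonal_def z)
    qed
    then have AP: "A = proj_blinfun P"
      by (intro blinfun_eqI) (simp add: proj_blinfun_apply subP)
    obtain n where n: "dist (B n) A < 1"
      using lim by (meson LIMSEQ_iff_nz metric_LIMSEQ_D order_refl zero_less_one)
    then have "grass_dist (R n) P < 1" by (simp add: R(2) AP dist_proj_blinfun sub subP)
    then have "dim (R n) \<le> dim P" "dim P \<le> dim (R n)"
      using sub[of n] subP grass_dist_commute[of P "R n"] by (auto intro: dim_le_of_grass_dist)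
    then have "P \<in> grassmannian d" using R(1)[of n] subP by (auto simp: grassmannian_def)
    then show "A \<in> ?G" by (simp add: AP)
  qed
  ultimately show ?thesis by (simp add: compact_eq_bounded_closed)
qed

lemma grassmannian_finite_net:
  assumes "0 < \<epsilon>"
  obtains F where "finite F" "F \<subseteq> (grassmannian d :: 'a::euclidean_space set set)"
    "\<And>P. P \<in> grassmannian d \<Longrightarrow> \<exists>Q\<in>F. grass_dist P Q < \<epsilon>"
proof -
  let ?G = "grassmannian d :: 'a set set"
  have cov: "proj_blinfun ` ?G \<subseteq> (\<Union>Q\<in>?G. ball (proj_blinfun Q) \<epsilon>)" using assms by auto
  obtain F where F: "F \<subseteq> ?G" "finite F" "proj_blinfun ` ?G \<subseteq> (\<Union>Q\<in>F. ball (proj_blinfun Q) \<epsilon>)"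
    by (rule compactE_image[OF compact_grassmannian _ cov]) auto
  show ?thesis
  proof (rule that[OF F(2,1)])
    fix P assume P: "P \<in> ?G"
    then obtain Q where Q: "Q \<in> F" "dist (proj_blinfun Q) (proj_blinfun P) < \<epsilon>" using F(3) by auto
    then have "grass_dist P Q < \<epsilon>"
      using P F(1) dist_proj_blinfun[of Q P] grass_dist_commute[of P Q] by (auto simp: grassmannian_def)
    then show "\<exists>Q\<in>F. grass_dist P Q < \<epsilon>" using Q(1) by blast
  qed
qed

lemma grassmannian_cluster_plane:
  fixes R :: "nat \<Rightarrow> 'a::euclidean_space set"
  assumes R: "\<And>n. R n \<in> grassmannian d"
  obtains P where "P \<in> grassmannian d" "\<And>\<epsilon> N. 0 < \<epsilon> \<Longrightarrow> \<exists>n\<ge>N. grass_dist (R n) P < \<epsilon>"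
proof -
  have "\<forall>n. proj_blinfun (R n) \<in> proj_blinfun ` (grassmannian d :: 'a set set)" using R by blast
  then obtain A and s :: "nat \<Rightarrow> nat" where A: "A \<in> proj_blinfun ` (grassmannian d :: 'a set set)" "strict_mono s"
    "((\<lambda>n. proj_blinfun (R n)) \<circ> s) \<longlonglongrightarrow> A"
    using compact_grassmannian[of d, where 'a = 'a] unfolding compact_def by metis
  then obtain P where P: "P \<in> grassmannian d" "A = proj_blinfun P" by blast
  show ?thesis
  proof (rule that[OF P(1)])
    fix \<epsilon> :: real and N :: nat assume "0 < \<epsilon>"
    then obtain n0 where n0: "\<And>n. n0 \<le> n \<Longrightarrow> dist (proj_blinfun (R (s n))) A < \<epsilon>"
      using metric_LIMSEQ_D[OF A(3)] by (auto simp: o_def)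
    have "grass_dist (R (s (max n0 N))) P < \<epsilon>"
      using n0[of "max n0 N"] dist_proj_blinfun[OF grassmannian_subspace[OF R] grassmannian_subspace[OF P(1)]]
      by (simp add: P(2))
    moreover have "N \<le> s (max n0 N)" using seq_suble[OF A(2), of "max n0 N"] by linarith
    ultimately show "\<exists>n\<ge>N. grass_dist (R n) P < \<epsilon>" by blast
  qed
qed

section \<open>From height excess to tangent planes\<close>

lemma tangent_to_closure:
  assumes P: "subspace P" and tan: "tangent_to X x P"
  shows "tangent_to (closure X) x P"
  unfolding tangent_to_def
proof (intro allI impI)
  fix \<epsilon> :: real assume "0 < \<epsilon>"
  then obtain \<delta> where \<delta>: "0 < \<delta>" "\<And>y. y \<in> X \<Longrightarrow> dist x y < \<delta> \<Longrightarrow> infdist (y - x) P \<le> \<epsilon> * norm (y - x)"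
    using tan unfolding tangent_to_def by blast
  have "infdist (y - x) P \<le> \<epsilon> * norm (y - x)" if y: "y \<in> closure X" "dist x y < \<delta>" for y
  proof -
    obtain z where z: "\<And>n. z n \<in> X" "z \<longlonglongrightarrow> y" using y(1) unfolding closure_sequential by blast
    have "(\<lambda>n. dist x (z n)) \<longlonglongrightarrow> dist x y" by (intro tendsto_intros z(2))
    then have ev: "\<forall>\<^sub>F n in sequentially. dist x (z n) < \<delta>" using y(2) by (rule order_tendstoD)
    show ?thesis
    proof (rule tendsto_le[OF sequentially_bot])
      show "(\<lambda>n. \<epsilon> * norm (z n - x)) \<longlonglongrightarrow> \<epsilon> * norm (y - x)" by (intro tendsto_intros z(2))
      show "(\<lambda>n. infdist (z n - x) P) \<longlonglongrightarrow> infdist (y - x) P"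
        by (intro tendsto_infdist tendsto_intros z(2))
      show "\<forall>\<^sub>F n in sequentially. infdist (z n - x) P \<le> \<epsilon> * norm (z n - x)"
        using ev by eventually_elim (use \<delta>(2) z(1) in auto)
    qed
  qed
  then show "\<exists>\<delta>>0. \<forall>y\<in>closure X. dist x y < \<delta> \<longrightarrow> infdist (y - x) P \<le> \<epsilon> * norm (y - x)"
    using \<delta>(1) by blast
qed

text \<open>
  If \<open>f \<ge> \<eta> / \<rho>\<close> held on \<open>{2 * \<rho><..4 * \<rho>}\<close> for arbitrarily small \<open>\<rho>\<close>, then infinitely many such
  intervals could be chosen disjoint, each contributing \<open>2 * \<eta>\<close> to the integral.  The lower bounds are
  collected in measurable step functions \<open>g \<le> f\<close>, because on such functions the integral is additive.
\<close>
lemma ex_small_value_at_fine_scales: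
  fixes f :: "real \<Rightarrow> ennreal"
  assumes fin: "(\<integral>\<^sup>+r\<in>{0<..1}. f r \<partial>lborel) < \<infinity>" and \<eta>: "0 < \<eta>"
  shows "\<exists>\<delta>>0. \<forall>\<rho>. 0 < \<rho> \<and> \<rho> < \<delta> \<longrightarrow> (\<exists>s. 2 * \<rho> < s \<and> s \<le> 4 * \<rho> \<and> f s < ennreal (\<eta> / \<rho>))"
proof (rule ccontr)
  assume no: "\<not> ?thesis"
  have bad: "\<exists>\<rho>>0. \<rho> < \<delta> \<and> (\<forall>s. 2 * \<rho> < s \<and> s \<le> 4 * \<rho> \<longrightarrow> ennreal (\<eta> / \<rho>) \<le> f s)" if "0 < \<delta>" for \<delta>
    using no that by (meson not_le)
  have step: "\<exists>g\<in>borel_measurable borel. (\<forall>r. g r \<le> f r * indicator {0<..t} r) \<and>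
      (\<integral>\<^sup>+r. g r \<partial>lborel) = ennreal (real N * (2 * \<eta>))" if "0 < t" for t N
    using that
  proof (induction N arbitrary: t)
    case 0
    then show ?case by (intro bexI[of _ "\<lambda>_. 0"]) auto
  next
    case (Suc N)
    obtain \<rho> where \<rho>: "0 < \<rho>" "\<rho> < t / 4" "\<forall>s. 2 * \<rho> < s \<and> s \<le> 4 * \<rho> \<longrightarrow> ennreal (\<eta> / \<rho>) \<le> f s"
      using bad[of "t / 4"] Suc.prems by auto
    obtain g where [measurable]: "g \<in> borel_measurable borel" and g: "\<forall>r. g r \<le> f r * indicator {0<..2 * \<rho>} r"
      "(\<integral>\<^sup>+r. g r \<partial>lborel) = ennreal (real N * (2 * \<eta>))"
      using Suc.IH[of "2 * \<rho>"] \<rho>(1) by auto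
    let ?h = "\<lambda>r. ennreal (\<eta> / \<rho>) * indicator {2 * \<rho><..4 * \<rho>} r"
    have "(\<integral>\<^sup>+r. g r + ?h r \<partial>lborel) = ennreal (real N * (2 * \<eta>)) + ennreal (\<eta> / \<rho>) * ennreal (2 * \<rho>)"
      using \<rho>(1) by (subst nn_integral_add) (auto simp: g(2) nn_integral_cmult_indicator)
    also have "\<dots> = ennreal (real (Suc N) * (2 * \<eta>))"
      using \<rho>(1) \<eta> by (simp add: ennreal_mult[symmetric] ennreal_plus[symmetric] algebra_simps del: ennreal_plus)
    finally have int: "(\<integral>\<^sup>+r. g r + ?h r \<partial>lborel) = ennreal (real (Suc N) * (2 * \<eta>))" .
    have le: "g r + ?h r \<le> f r * indicator {0<..t} r" for r
    proof -
      consider "r \<le> 0" | "0 < r" "r \<le> 2 * \<rho>" | "2 * \<rho> < r" "r \<le> 4 * \<rho>" | "4 * \<rho> < r" by linarith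
      then show ?thesis
      proof cases
        case 1
        then show ?thesis using spec[OF g(1), of r] \<rho>(1) by (simp add: indicator_def)
      next
        case 2
        then show ?thesis using spec[OF g(1), of r] \<rho>(1,2) by (simp add: indicator_def)
      next
        case 3
        then show ?thesis using spec[OF g(1), of r] spec[OF \<rho>(3), of r] \<rho>(1,2) by (simp add: indicator_def)
      next
        case 4
        then show ?thesis using spec[OF g(1), of r] \<rho>(1) by (simp add: indicator_def)
      qed
    qed
    show ?case
    proof (intro bexI[of _ "\<lambda>r. g r + ?h r"] conjI allI le int)
    qed measurable
  qed
  define I where "I = (\<integral>\<^sup>+r\<in>{0<..1}. f r \<partial>lborel)"
  have "ennreal (real N * (2 * \<eta>)) \<le> I" for N
  proof -
    obtain g where g: "\<forall>r. g r \<le> f r * indicator {0<..1} r" "(\<integral>\<^sup>+r. g r \<partial>lborel) = ennreal (real N * (2 * \<eta>))"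
      using step[of 1 N] by auto
    have "(\<integral>\<^sup>+r. g r \<partial>lborel) \<le> I" unfolding I_def using g(1) by (intro nn_integral_mono) auto
    then show ?thesis by (simp add: g(2))
  qed
  moreover obtain N where "enn2real I / (2 * \<eta>) < real N" using reals_Archimedean2 by blast
  then have "enn2real I < real N * (2 * \<eta>)" using \<eta> by (simp add: field_simps)
  then have "I < ennreal (real N * (2 * \<eta>))"
  proof -
    assume "enn2real I < real N * (2 * \<eta>)"
    then have "ennreal (enn2real I) < ennreal (real N * (2 * \<eta>))"
      using le_less_trans[OF enn2real_nonneg] by (intro ennreal_lessI) auto
    moreover have "ennreal (enn2real I) = I" using fin by (simp add: I_def)
    ultimately show ?thesis by simp
  qed
  ultimately show False by (meson not_le)
qed

text \<open>
  A point \<open>y\<close> of \<open>X\<close> at distance \<open>\<rho>\<close> from \<open>x\<close> and at height more than \<open>\<epsilon> * \<rho>\<close> over \<open>x + P\<close> comes with a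
  ball of radius \<open>\<epsilon> * \<rho> / 2\<close> of points at height at least \<open>\<epsilon> * \<rho> / 2\<close>.  By the lower density bound this
  ball has mass of order \<open>\<rho> ^ d\<close>, so the integrand of the excess is at least \<open>\<eta> / \<rho>\<close> on
  \<open>{2 * \<rho><..4 * \<rho>}\<close>, which finiteness of the excess forbids for small \<open>\<rho>\<close>.
\<close>
lemma tangent_to_of_height_excess:
  fixes \<Omega> :: "'a::euclidean_space set"
  assumes \<Omega>: "open \<Omega>" and x: "x \<in> \<Omega>" and P: "P \<in> grassmannian d" and X: "X \<subseteq> \<Omega>" and c: "0 < c"
    and lower: "\<And>y r. y \<in> X \<Longrightarrow> 0 < r \<Longrightarrow> ereal r < dist_compl y \<Omega> \<Longrightarrow> ball y r \<subseteq> \<Omega> \<Longrightarrow>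
       ennreal (c * r ^ d) \<le> emeasure (mass \<Omega> V) (ball y r)"
    and excess: "height_excess d \<Omega> x P V < \<infinity>"
  shows "tangent_to X x P"
  unfolding tangent_to_def
proof (intro allI impI)
  fix \<epsilon>' :: real assume "0 < \<epsilon>'"
  define \<epsilon> where "\<epsilon> = min \<epsilon>' 1"
  have \<epsilon>: "0 < \<epsilon>" "\<epsilon> \<le> 1" "\<epsilon> \<le> \<epsilon>'" using \<open>0 < \<epsilon>'\<close> by (auto simp: \<epsilon>_def)
  have subP: "subspace P" using P by (rule grassmannian_subspace)
  obtain R where R: "0 < R" "ball x R \<subseteq> \<Omega>" using \<Omega> x openE by blast
  define G where "G s = (\<integral>\<^sup>+y\<in>ball x s \<inter> \<Omega>. ennreal ((infdist (y - x) P / s)\<^sup>2) \<partial>mass \<Omega> V)" for s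
  define f where "f s = ennreal (1 / s ^ d) * G s * ennreal (1 / s)" for s
  \<comment> \<open>For \<open>s \<le> 4 * \<rho>\<close> the relative height of the ball around \<open>y\<close> is at least \<open>\<epsilon> / 8\<close>, its mass divided by
    \<open>s ^ d\<close> at least \<open>c * (\<epsilon> / 8) ^ d\<close>, and \<open>1 / s\<close> at least \<open>1 / (4 * \<rho>)\<close>.\<close>
  define \<eta> where "\<eta> = c * (\<epsilon> / 8) ^ 2 * (\<epsilon> / 8) ^ d / 4"
  have \<eta>: "0 < \<eta>" using c \<epsilon> by (simp add: \<eta>_def)
  have "(\<integral>\<^sup>+r\<in>{0<..1}. f r \<partial>lborel) < \<infinity>"
    using excess by (simp add: height_excess_def f_def G_def)
  then obtain \<delta> where \<delta>: "0 < \<delta>"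
    "\<And>\<rho>. 0 < \<rho> \<and> \<rho> < \<delta> \<Longrightarrow> \<exists>s. 2 * \<rho> < s \<and> s \<le> 4 * \<rho> \<and> f s < ennreal (\<eta> / \<rho>)"
    using ex_small_value_at_fine_scales[OF _ \<eta>] by blast
  have main: "infdist (y - x) P \<le> \<epsilon> * norm (y - x)" if y: "y \<in> X" "dist x y < min \<delta> (R / 2)" for y
  proof (rule ccontr)
    assume far: "\<not> ?thesis"
    define \<rho> where "\<rho> = norm (y - x)"
    have far': "\<epsilon> * \<rho> < infdist (y - x) P" using far by (simp add: \<rho>_def)
    have dxy: "dist x y = \<rho>" by (simp add: \<rho>_def dist_norm norm_minus_commute)
    have "\<rho> \<noteq> 0" using far subspace_0[OF subP] by (auto simp: \<rho>_def)
    then have \<rho>: "0 < \<rho>" "\<rho> < \<delta>" "2 * \<rho> < R" using y(2) dxy by (auto simp: \<rho>_def)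
    obtain s where s: "2 * \<rho> < s" "s \<le> 4 * \<rho>" "f s < ennreal (\<eta> / \<rho>)" using \<delta>(2)[of \<rho>] \<rho> by blast
    have s0: "0 < s" using s \<rho> by linarith
    define t where "t = \<epsilon> * \<rho> / 2"
    have t: "0 < t" "t \<le> \<rho> / 2"
      using \<epsilon> \<rho> mult_right_mono[OF \<epsilon>(2), of \<rho>] by (auto simp: t_def)
    have bsub: "ball y t \<subseteq> ball x s \<inter> \<Omega>"
    proof
      fix z assume "z \<in> ball y t"
      then have "dist x z < 2 * \<rho>" using dist_triangle[of x z y] dxy t \<rho>(1) by (simp add: dist_commute)
      then have "z \<in> ball x s" "z \<in> ball x R" using s \<rho> by auto
      then show "z \<in> ball x s \<inter> \<Omega>" using R(2) by blast
    qed
    have "ereal (R - \<rho>) \<le> dist_compl y \<Omega>"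
      unfolding dist_compl_def
    proof (rule INF_greatest)
      fix w assume "w \<in> - \<Omega>"
      then have "w \<notin> ball x R" using R(2) by blast
      then have "R \<le> dist x w" by simp
      then show "ereal (R - \<rho>) \<le> ereal (dist y w)" using dist_triangle[of x w y] dxy by simp
    qed
    moreover have "ereal t < ereal (R - \<rho>)" using t \<rho> by simp
    ultimately have "ereal t < dist_compl y \<Omega>" by (rule less_le_trans[rotated])
    then have low: "ennreal (c * t ^ d) \<le> emeasure (mass \<Omega> V) (ball y t)"
      using bsub t(1) by (intro lower y(1)) auto
    have bs: "ball y t \<in> sets (mass \<Omega> V)"
      using bsub \<Omega> by (simp add: mass_def sets_restrict_space_iff)
    have "ennreal ((\<epsilon> / 8) ^ 2) * emeasure (mass \<Omega> V) (ball y t) =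
        (\<integral>\<^sup>+z. ennreal ((\<epsilon> / 8) ^ 2) * indicator (ball y t) z \<partial>mass \<Omega> V)"
      using bs by (simp add: nn_integral_cmult_indicator)
    also have "\<dots> \<le> G s" unfolding G_def
    proof (rule nn_integral_mono)
      fix z
      show "ennreal ((\<epsilon> / 8) ^ 2) * indicator (ball y t) z \<le>
          ennreal ((infdist (z - x) P / s)\<^sup>2) * indicator (ball x s \<inter> \<Omega>) z"
      proof (cases "z \<in> ball y t")
        case True
        then have zin: "z \<in> ball x s \<inter> \<Omega>" using bsub by blast
        have "infdist (y - x) P \<le> infdist (z - x) P + dist (y - x) (z - x)" by (rule infdist_triangle)
        moreover have "dist (y - x) (z - x) = dist y z" by (simp add: dist_norm)
        ultimately have "t \<le> infdist (z - x) P" using far' True by (simp add: t_def)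
        moreover have "\<epsilon> / 8 * s \<le> t" using mult_left_mono[OF s(2), of "\<epsilon> / 8"] \<epsilon> by (simp add: t_def)
        ultimately have "\<epsilon> / 8 \<le> infdist (z - x) P / s" using s0 by (simp add: pos_le_divide_eq)
        then have "(\<epsilon> / 8) ^ 2 \<le> (infdist (z - x) P / s)\<^sup>2" using \<epsilon> by (intro power_mono) auto
        then show ?thesis using True zin by (simp add: ennreal_leI)
      qed simp
    qed
    finally have G: "ennreal ((\<epsilon> / 8) ^ 2) * emeasure (mass \<Omega> V) (ball y t) \<le> G s" .
    have "ennreal ((\<epsilon> / 8) ^ 2 * (c * t ^ d)) \<le> G s"
    proof -
      have "ennreal ((\<epsilon> / 8) ^ 2 * (c * t ^ d)) = ennreal ((\<epsilon> / 8) ^ 2) * ennreal (c * t ^ d)"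
        using c t by (intro ennreal_mult) auto
      also have "\<dots> \<le> ennreal ((\<epsilon> / 8) ^ 2) * emeasure (mass \<Omega> V) (ball y t)"
        by (intro mult_left_mono low) simp
      finally show ?thesis using G by (rule order_trans)
    qed
    then have "ennreal (1 / s ^ d) * ennreal ((\<epsilon> / 8) ^ 2 * (c * t ^ d)) * ennreal (1 / s) \<le> f s"
      unfolding f_def by (intro mult_right_mono mult_left_mono) auto
    also have "ennreal (1 / s ^ d) * ennreal ((\<epsilon> / 8) ^ 2 * (c * t ^ d)) * ennreal (1 / s) =
        ennreal (1 / s ^ d * ((\<epsilon> / 8) ^ 2 * (c * t ^ d)) * (1 / s))"
      using s0 c t by (simp only: ennreal_mult[symmetric] zero_le_divide_1_iff zero_le_power less_imp_le mult_nonneg_nonneg zero_le_power2)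
    finally have low_f: "ennreal (1 / s ^ d * ((\<epsilon> / 8) ^ 2 * (c * t ^ d)) * (1 / s)) \<le> f s" .
    have "ennreal (\<eta> / \<rho>) \<le> ennreal (1 / s ^ d * ((\<epsilon> / 8) ^ 2 * (c * t ^ d)) * (1 / s))"
    proof (rule ennreal_leI)
      have a: "(1 / (4 * \<rho>)) ^ d \<le> 1 / s ^ d"
        using s s0 \<rho> unfolding power_one_over[symmetric] by (intro power_mono frac_le) auto
      have b: "1 / (4 * \<rho>) \<le> 1 / s" using s s0 \<rho> by (simp add: frac_le)
      have "\<eta> / \<rho> = (1 / (4 * \<rho>)) ^ d * ((\<epsilon> / 8) ^ 2 * (c * t ^ d)) * (1 / (4 * \<rho>))"
      proof -
        have "(1 / (4 * \<rho>)) ^ d * t ^ d = (\<epsilon> / 8) ^ d"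
          using \<rho> by (simp add: t_def flip: power_mult_distrib)
        moreover have "(1 / (4 * \<rho>)) ^ d * ((\<epsilon> / 8) ^ 2 * (c * t ^ d)) =
            (\<epsilon> / 8) ^ 2 * c * ((1 / (4 * \<rho>)) ^ d * t ^ d)" by (simp only: mult_ac)
        ultimately have "(1 / (4 * \<rho>)) ^ d * ((\<epsilon> / 8) ^ 2 * (c * t ^ d)) =
            (\<epsilon> / 8) ^ 2 * c * (\<epsilon> / 8) ^ d" by simp
        then have "(1 / (4 * \<rho>)) ^ d * ((\<epsilon> / 8) ^ 2 * (c * t ^ d)) * (1 / (4 * \<rho>)) =
            (\<epsilon> / 8) ^ 2 * c * (\<epsilon> / 8) ^ d * (1 / (4 * \<rho>))" by (simp only:)
        also have "\<dots> = \<eta> / \<rho>" unfolding \<eta>_def by simp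
        finally show ?thesis by (rule sym)
      qed
      also have "\<dots> \<le> 1 / s ^ d * ((\<epsilon> / 8) ^ 2 * (c * t ^ d)) * (1 / s)"
        using a b c t s0 \<rho> \<epsilon> by (intro mult_mono mult_nonneg_nonneg) auto
      finally show "\<eta> / \<rho> \<le> 1 / s ^ d * ((\<epsilon> / 8) ^ 2 * (c * t ^ d)) * (1 / s)" .
    qed
    then have "ennreal (\<eta> / \<rho>) \<le> f s" using low_f by (rule order_trans)
    then show False using s(3) by simp
  qed
  have "infdist (y - x) P \<le> \<epsilon>' * norm (y - x)" if "y \<in> X" "dist x y < min \<delta> (R / 2)" for y
    using main[OF that] mult_right_mono[OF \<epsilon>(3) norm_ge_zero[of "y - x"]] by linarith
  moreover have "0 < min \<delta> (R / 2)" using \<delta>(1) R(1) by simp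
  ultimately show "\<exists>\<delta>>0. \<forall>y\<in>X. dist x y < \<delta> \<longrightarrow> infdist (y - x) P \<le> \<epsilon>' * norm (y - x)" by blast
qed

section \<open>Lipschitz parametrisation of flat sets\<close>

text \<open>
  McShane's formula: the infimum of the cones \<open>f a + L * dist a x\<close>.
\<close>
lemma lipschitz_extension_real:
  fixes f :: "'b::metric_space \<Rightarrow> real"
  assumes L: "0 \<le> L" and lip: "\<And>x y. x \<in> A \<Longrightarrow> y \<in> A \<Longrightarrow> \<bar>f x - f y\<bar> \<le> L * dist x y"
  shows "\<exists>g. (\<forall>x y. \<bar>g x - g y\<bar> \<le> L * dist x y) \<and> (\<forall>x\<in>A. g x = f x)"
proof (cases "A = {}")
  case True
  then show ?thesis using L by (intro exI[of _ "\<lambda>_. 0"]) auto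
next
  case False
  define g where "g x = (INF a\<in>A. f a + L * dist a x)" for x
  have lower: "f b - L * dist b x \<le> f a + L * dist a x" if "a \<in> A" "b \<in> A" for a b x
  proof -
    have "f b - f a \<le> L * dist a b" using lip[OF that] by linarith
    also have "\<dots> \<le> L * (dist a x + dist b x)"
      using L dist_triangle2[of a b x] by (intro mult_left_mono) (auto simp: dist_commute)
    finally show ?thesis by (simp add: algebra_simps)
  qed
  have bdd: "bdd_below ((\<lambda>a. f a + L * dist a x) ` A)" for x
    using False lower unfolding bdd_below_def by blast
  have le: "g x \<le> g y + L * dist x y" for x y
  proof -
    have "g x - L * dist x y \<le> g y"
      unfolding g_def[of y]
    proof (rule cINF_greatest[OF False])
      fix a assume a: "a \<in> A"
      have "g x \<le> f a + L * dist a x" unfolding g_def by (rule cINF_lower[OF bdd a])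
      also have "\<dots> \<le> f a + L * (dist a y + dist x y)"
        using L dist_triangle2[of a x y] by (intro add_left_mono mult_left_mono) auto
      finally show "g x - L * dist x y \<le> f a + L * dist a y" by (simp add: algebra_simps)
    qed
    then show ?thesis by simp
  qed
  have "\<bar>g x - g y\<bar> \<le> L * dist x y" for x y
    using le[of x y] le[of y x] by (simp add: dist_commute abs_le_iff)
  moreover have "g x = f x" if "x \<in> A" for x
  proof (rule antisym)
    show "g x \<le> f x" unfolding g_def using cINF_lower[OF bdd that, of x] by simp
    show "f x \<le> g x" unfolding g_def
      using lower[OF _ that, of _ x] by (intro cINF_greatest[OF False]) auto
  qed
  ultimately show ?thesis by blast
qed

lemma lipschitz_extension:
  fixes f :: "'b::metric_space \<Rightarrow> 'a::euclidean_space"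
  assumes L: "0 \<le> L" and lip: "\<And>x y. x \<in> A \<Longrightarrow> y \<in> A \<Longrightarrow> dist (f x) (f y) \<le> L * dist x y"
  shows "\<exists>g C. C-lipschitz_on UNIV g \<and> (\<forall>x\<in>A. g x = f x)"
proof -
  have "\<exists>g. (\<forall>x y. \<bar>g x - g y\<bar> \<le> L * dist x y) \<and> (\<forall>x\<in>A. g x = f x \<bullet> b)" if "b \<in> Basis" for b
  proof (rule lipschitz_extension_real[OF L])
    fix x y assume xy: "x \<in> A" "y \<in> A"
    have "\<bar>f x \<bullet> b - f y \<bullet> b\<bar> = \<bar>(f x - f y) \<bullet> b\<bar>" by (simp add: inner_diff_left)
    also have "\<dots> \<le> norm (f x - f y)" using that by (rule Basis_le_norm)
    also have "\<dots> \<le> L * dist x y" using lip[OF xy] by (simp add: dist_norm)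
    finally show "\<bar>f x \<bullet> b - f y \<bullet> b\<bar> \<le> L * dist x y" .
  qed
  then obtain h where h: "\<And>b x y. b \<in> Basis \<Longrightarrow> \<bar>h b x - h b y\<bar> \<le> L * dist x y"
     "\<And>b x. b \<in> Basis \<Longrightarrow> x \<in> A \<Longrightarrow> h b x = f x \<bullet> b" by metis
  define g where "g x = (\<Sum>b\<in>Basis. h b x *\<^sub>R b)" for x
  have "(real DIM('a) * L)-lipschitz_on UNIV g"
  proof (rule lipschitz_onI)
    fix x y
    have "dist (g x) (g y) = norm (\<Sum>b\<in>Basis. (h b x - h b y) *\<^sub>R b)"
      by (simp add: dist_norm g_def sum_subtractf scaleR_diff_left)
    also have "\<dots> \<le> (\<Sum>b\<in>(Basis :: 'a set). \<bar>h b x - h b y\<bar>)"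
      by (rule order_trans[OF norm_sum]) (auto intro!: sum_mono)
    also have "\<dots> \<le> (\<Sum>b\<in>(Basis :: 'a set). L * dist x y)" using h(1) by (intro sum_mono)
    finally show "dist (g x) (g y) \<le> real DIM('a) * L * dist x y" by simp
  qed (use L in auto)
  moreover have "g x = f x" if "x \<in> A" for x
  proof -
    have "g x = (\<Sum>b\<in>Basis. (f x \<bullet> b) *\<^sub>R b)" unfolding g_def using h(2) that by (intro sum.cong) auto
    then show ?thesis by (simp add: euclidean_representation)
  qed
  ultimately show ?thesis by blast
qed

text \<open>
  The inverse of the projection, read through an isometry between \<open>real ^ 'd\<close> and \<open>Q\<close> and extended to
  the whole space.
\<close>
lemma flat_subset_lipschitz_range:
  fixes A Q :: "'a::euclidean_space set"
  assumes Q: "Q \<in> grassmannian CARD('d::finite)" and fl: "flat_over \<epsilon> Q A" and e: "\<epsilon> < 1"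
  shows "\<exists>(f :: real ^ 'd \<Rightarrow> 'a) L. L-lipschitz_on UNIV f \<and> A \<subseteq> range f"
proof -
  have sub: "subspace Q" and dimQ: "dim Q = CARD('d)" using Q by (auto simp: grassmannian_def)
  obtain j :: "real ^ 'd \<Rightarrow> 'a" where j: "linear j" "j ` UNIV = Q" "\<And>x. norm (j x) = norm x"
  proof (rule isometry_subspaces[of "UNIV :: (real ^ 'd) set" Q])
    show "dim (UNIV :: (real ^ 'd) set) = dim Q" by (simp add: dimQ dim_UNIV)
  qed (use sub in auto)
  let ?g = "inv_into A (orth_proj Q)"
  define B where "B = j -` (orth_proj Q ` A)"
  have "dist (?g (j u)) (?g (j v)) \<le> 1 / (1 - \<epsilon>) * dist u v" if uv: "u \<in> B" "v \<in> B" for u v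
  proof -
    have in_A: "j u \<in> orth_proj Q ` A" "j v \<in> orth_proj Q ` A" using uv by (auto simp: B_def)
    have "dist (?g (j u)) (?g (j v)) \<le> 1 / (1 - \<epsilon>) * dist (orth_proj Q (?g (j u))) (orth_proj Q (?g (j v)))"
      by (rule flat_over_dist_le[OF sub fl inv_into_into[OF in_A(1)] inv_into_into[OF in_A(2)] e])
    also have "\<dots> = 1 / (1 - \<epsilon>) * dist (j u) (j v)" by (simp add: f_inv_into_f[OF in_A(1)] f_inv_into_f[OF in_A(2)])
    also have "dist (j u) (j v) = dist u v"
      using j(3)[of "u - v"] by (simp add: dist_norm linear_diff[OF j(1)])
    finally show ?thesis .
  qed
  then obtain f C where f: "C-lipschitz_on UNIV f" "\<And>u. u \<in> B \<Longrightarrow> f u = ?g (j u)"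
    using lipschitz_extension[of "1 / (1 - \<epsilon>)" B "\<lambda>u. ?g (j u)"] e by auto
  have "A \<subseteq> range f"
  proof
    fix a assume a: "a \<in> A"
    have "orth_proj Q a \<in> range j" using orth_proj_in[OF sub] j(2) by blast
    then obtain u where u: "orth_proj Q a = j u" by auto
    then have "u \<in> B" unfolding B_def using a by (metis imageI vimageI2)
    then have "f u = ?g (j u)" by (rule f(2))
    also have "\<dots> = a" unfolding u[symmetric] by (rule inv_into_f_f[OF flat_over_inj_on[OF sub fl e] a])
    finally show "a \<in> range f" by (metis rangeI)
  qed
  then show ?thesis using f(1) by blast
qed

section \<open>Decomposition into flat pieces\<close>

text \<open>
  For a plane \<open>Q\<close> from a finite \<open>\<epsilon> / 2\<close>-net of the Grassmannian and a radius \<open>h k\<close>, the set \<open>A Q k\<close> of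
  points whose cone condition with respect to \<open>Q\<close> holds up to distance \<open>h k\<close> is closed: each \<open>y\<close> in \<open>S\<close>
  imposes a closed condition on \<open>x\<close>.  Intersected with a ball of diameter less than \<open>h k\<close> it is flat
  over \<open>Q\<close>.  A point with tangent plane \<open>P\<close> belongs to \<open>A Q k\<close> if \<open>Q\<close> is close to \<open>P\<close> and \<open>h k\<close> is small.
\<close>
lemma ex_flat_pieces:
  fixes S :: "'a::euclidean_space set"
  assumes d: "d \<le> DIM('a)" and S: "closed S" and \<epsilon>: "0 < \<epsilon>"
  obtains K Q :: "nat \<Rightarrow> 'a set" where
    "\<And>i. compact (K i)" "\<And>i. K i \<subseteq> S" "\<And>i. Q i \<in> grassmannian d" "\<And>i. flat_over \<epsilon> (Q i) (K i)"
    "\<And>i x. x \<in> K i \<Longrightarrow> \<exists>\<delta>>0. \<forall>y\<in>S. dist x y < \<delta> \<longrightarrow> infdist (y - x) (Q i) \<le> \<epsilon> * norm (y - x)"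
    "\<And>x P. x \<in> S \<Longrightarrow> P \<in> grassmannian d \<Longrightarrow> tangent_to S x P \<Longrightarrow> \<exists>i. x \<in> K i"
proof -
  obtain F where F: "finite F" "F \<subseteq> (grassmannian d :: 'a set set)"
    "\<And>P. P \<in> grassmannian d \<Longrightarrow> \<exists>Q\<in>F. grass_dist P Q < \<epsilon> / 2"
    by (rule grassmannian_finite_net[of "\<epsilon> / 2" d]) (use \<epsilon> in auto)
  obtain P0 :: "'a set" where "subspace P0" "dim P0 = d"
    using choose_subspace_of_subspace[of d "UNIV :: 'a set"] d by auto
  then have "F \<noteq> {}" using F(3)[of P0] by (auto simp: grassmannian_def)
  obtain D :: "'a set" where D: "countable D" "\<And>U. open U \<Longrightarrow> U \<noteq> {} \<Longrightarrow> \<exists>z\<in>D. z \<in> U"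
    using countable_dense_exists by blast
  then have "D \<noteq> {}" by (metis UNIV_not_empty empty_iff open_UNIV)
  define h where "h k = 1 / real (Suc k)" for k
  have h0: "0 < h k" for k by (simp add: h_def)
  define A where "A Q k = {x \<in> S. \<forall>y\<in>S. dist x y < h k \<longrightarrow> infdist (y - x) Q \<le> \<epsilon> * norm (y - x)}" for Q k
  define pc where "pc = (\<lambda>(Q, k, z). (A Q k \<inter> cball z (h k / 3), Q))"
  define \<P> where "\<P> = pc ` (F \<times> (UNIV :: nat set) \<times> D)"
  have closed_A: "closed (A Q k)" for Q k
  proof -
    have "A Q k = S \<inter> (\<Inter>y\<in>S. {x. h k \<le> dist x y} \<union> {x. infdist (y - x) Q \<le> \<epsilon> * norm (y - x)})"
      by (auto simp: A_def not_less[symmetric])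
    moreover have "closed ({x. h k \<le> dist x y} \<union> {x. infdist (y - x) Q \<le> \<epsilon> * norm (y - x)})" for y
      by (intro closed_Un closed_Collect_le continuous_intros continuous_on_infdist)
    ultimately show ?thesis using S by (auto intro!: closed_Int closed_INT)
  qed
  have cnt: "countable \<P>" unfolding \<P>_def
    using countable_finite[OF F(1)] D(1) by (intro countable_image countable_SIGMA) auto
  have ne: "\<P> \<noteq> {}" using \<open>F \<noteq> {}\<close> \<open>D \<noteq> {}\<close> by (auto simp: \<P>_def)
  define K where "K i = fst (from_nat_into \<P> i)" for i
  define Q where "Q i = snd (from_nat_into \<P> i)" for i
  have piece: "\<exists>k z. K i = A (Q i) k \<inter> cball z (h k / 3) \<and> Q i \<in> F" for i
  proof -
    have "from_nat_into \<P> i \<in> pc ` (F \<times> UNIV \<times> D)" using from_nat_into[OF ne] by (simp add: \<P>_def)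
    then obtain R k z where "from_nat_into \<P> i = (A R k \<inter> cball z (h k / 3), R)" "R \<in> F"
      by (auto simp: pc_def)
    then have "K i = A (Q i) k \<inter> cball z (h k / 3)" "Q i \<in> F" by (simp_all add: K_def Q_def)
    then show ?thesis by blast
  qed
  show ?thesis
  proof (rule that)
    fix i
    obtain k z where kz: "K i = A (Q i) k \<inter> cball z (h k / 3)" "Q i \<in> F" using piece by blast
    show "compact (K i)" unfolding kz(1) by (intro closed_Int_compact closed_A compact_cball)
    show "K i \<subseteq> S" using kz(1) by (auto simp: A_def)
    show "Q i \<in> grassmannian d" using kz(2) F(2) by blast
    show "flat_over \<epsilon> (Q i) (K i)"
      unfolding flat_over_def
    proof (intro ballI)
      fix x y assume xy: "x \<in> K i" "y \<in> K i"
      have "dist x y \<le> dist z x + dist z y" by (metis dist_triangle2 dist_commute)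
      also have "\<dots> \<le> h k / 3 + h k / 3" using xy kz(1) by (intro add_mono) auto
      finally have "dist x y < h k" using h0[of k] by simp
      then show "infdist (y - x) (Q i) \<le> \<epsilon> * norm (y - x)"
        using xy kz(1) by (auto simp: A_def)
    qed
  next
    fix i x assume "x \<in> K i"
    moreover obtain k z where kz: "K i = A (Q i) k \<inter> cball z (h k / 3)" using piece by blast
    ultimately show "\<exists>\<delta>>0. \<forall>y\<in>S. dist x y < \<delta> \<longrightarrow> infdist (y - x) (Q i) \<le> \<epsilon> * norm (y - x)"
      using h0[of k] by (intro exI[of _ "h k"]) (auto simp: A_def)
  next
    fix x and P :: "'a set" assume x: "x \<in> S" and P: "P \<in> grassmannian d" and tan: "tangent_to S x P"
    obtain R where R: "R \<in> F" "grass_dist P R < \<epsilon> / 2" using F(3)[OF P] by blast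
    have sub: "subspace P" "subspace R" using P R(1) F(2) by (auto intro: grassmannian_subspace)
    obtain \<delta> where \<delta>: "0 < \<delta>" "\<And>y. y \<in> S \<Longrightarrow> dist x y < \<delta> \<Longrightarrow> infdist (y - x) P \<le> \<epsilon> / 2 * norm (y - x)"
      using tan \<epsilon> unfolding tangent_to_def by (metis half_gt_zero)
    obtain k where k: "1 / \<delta> < real (Suc k)" using ex_less_of_nat_Suc by blast
    have hk: "h k < \<delta>" using k \<delta>(1) by (simp add: h_def field_simps)
    have "x \<in> A R k"
      unfolding A_def
    proof (intro CollectI conjI x ballI impI)
      fix y assume y: "y \<in> S" "dist x y < h k"
      have "infdist (y - x) R \<le> infdist (y - x) P + grass_dist P R * norm (y - x)"
        by (rule infdist_plane_le[OF sub])
      also have "\<dots> \<le> \<epsilon> / 2 * norm (y - x) + \<epsilon> / 2 * norm (y - x)"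
        using y hk R(2) by (intro add_mono \<delta>(2) mult_right_mono) auto
      finally show "infdist (y - x) R \<le> \<epsilon> * norm (y - x)" by (simp add: field_simps)
    qed
    moreover obtain z where z: "z \<in> D" "z \<in> ball x (h k / 3)"
      using D(2)[of "ball x (h k / 3)"] h0[of k] by auto
    moreover from z have "x \<in> cball z (h k / 3)" by (simp add: dist_commute)
    ultimately have "x \<in> A R k \<inter> cball z (h k / 3)" by blast
    moreover have "(A R k \<inter> cball z (h k / 3), R) \<in> \<P>"
      unfolding \<P>_def pc_def using R(1) z(1) by force
    then obtain i where "from_nat_into \<P> i = (A R k \<inter> cball z (h k / 3), R)"
      using from_nat_into_surj[OF cnt] by blast
    ultimately show "\<exists>i. x \<in> K i" by (metis K_def fst_conv)
  qed
qed

section \<open>Varifolds as measures\<close>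

lemma varifold_space_measure:
  assumes "varifold d \<Omega> V"
  shows "sets V = sets (borel_of (varifold_space d \<Omega>))" "space V = \<Omega> \<times> grassmannian d"
proof -
  show sets: "sets V = sets (borel_of (varifold_space d \<Omega>))"
    using assms by (simp add: varifold_def)
  then show "space V = \<Omega> \<times> grassmannian d"
    by (metis sets_eq_imp_space_eq space_borel_of topspace_varifold_space)
qed

lemma continuous_map_measurable_varifold:
  fixes f :: "'a::euclidean_space \<times> 'a set \<Rightarrow> 'b::topological_space"
  assumes V: "varifold d \<Omega> V" and f: "continuous_map (varifold_space d \<Omega>) euclidean f"
  shows "f \<in> borel_measurable V"
proof (rule borel_measurableI)
  fix U :: "'b set" assume "open U"
  then have "openin (varifold_space d \<Omega>) {z \<in> topspace (varifold_space d \<Omega>). f z \<in> U}"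
    using f by (intro openin_continuous_map_preimage) auto
  moreover have "f -` U \<inter> space V = {z \<in> topspace (varifold_space d \<Omega>). f z \<in> U}"
    by (auto simp: varifold_space_measure[OF V] topspace_varifold_space)
  ultimately show "f -` U \<inter> space V \<in> sets V"
    by (simp add: varifold_space_measure[OF V] openin_sets_borel_of)
qed

lemma fst_measurable_varifold:
  assumes "varifold d \<Omega> V"
  shows "fst \<in> borel_measurable V"
proof (rule continuous_map_measurable_varifold[OF assms])
  show "continuous_map (varifold_space d \<Omega>) euclidean fst"
    unfolding varifold_space_def
    by (intro continuous_map_into_fulltopology[OF continuous_map_fst])
qed

lemma limitin_varifold_space:
  assumes x: "x \<in> \<Omega>" and P: "P \<in> grassmannian d" and R: "\<And>n. R n \<in> grassmannian d"
    and lim: "(\<lambda>n. grass_dist (R n) P) \<longlonglongrightarrow> 0"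
  shows "limitin (varifold_space d \<Omega>) (\<lambda>n. (x, R n)) (x, P) sequentially"
proof -
  have "limitin (grass_topology d) R P sequentially"
    unfolding grass_topology_def Metric_space.limitin_metric[OF Metric_space_grassmannian]
  proof (intro conjI P allI impI)
    fix \<epsilon> :: real assume "0 < \<epsilon>"
    then have "\<forall>\<^sub>F n in sequentially. grass_dist (R n) P < \<epsilon>" by (rule order_tendstoD(2)[OF lim])
    then show "\<forall>\<^sub>F n in sequentially. R n \<in> grassmannian d \<and> grass_dist (R n) P < \<epsilon>"
      by eventually_elim (use R in auto)
  qed
  then show ?thesis
    using x by (simp add: varifold_space_def limitin_pairwise o_def)
qed

section \<open>Rectifiability\<close>

theorem theorem3:
  fixes \<Omega> :: "(real ^ 'n) set"
    and V :: "((real ^ 'n) \<times> (real ^ 'n) set) measure"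
  assumes dim: "CARD('d::finite) < CARD('n)"
    and \<Omega>: "open \<Omega>"
    and V: "varifold CARD('d) \<Omega> V"
    and finite_mass: "emeasure (mass \<Omega> V) \<Omega> < \<infinity>"
    and density_bounds:
      "\<exists>C1 C2. 0 < C1 \<and> C1 < C2 \<and>
        (AE x in mass \<Omega> V. \<forall>r. 0 < r \<and> ereal r < dist_compl x \<Omega> \<and> ball x r \<subseteq> \<Omega> \<longrightarrow>
           ennreal (C1 * unit_ball_vol (real CARD('d)) * r ^ CARD('d)) \<le> emeasure (mass \<Omega> V) (ball x r) \<and>
           emeasure (mass \<Omega> V) (ball x r) \<le> ennreal (C2 * unit_ball_vol (real CARD('d)) * r ^ CARD('d)))"
    and excess:
      "{(x, P). (x, P) \<in> \<Omega> \<times> grassmannian CARD('d) \<and> height_excess CARD('d) \<Omega> x P V = \<infinity>}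
         \<in> null_sets V"
  shows "rectifiable_varifold TYPE('d) \<Omega> V"
proof -
  let ?d = "CARD('d)"
  let ?W = "varifold_space ?d \<Omega>"
  have d: "0 < ?d" by simp
  have sets_V: "sets V = sets (borel_of ?W)" and space_V: "space V = \<Omega> \<times> grassmannian ?d"
    using varifold_space_measure[OF V] by auto
  have fst_V: "fst \<in> borel_measurable V" by (rule fst_measurable_varifold[OF V])
  have \<Omega>_borel [measurable]: "\<Omega> \<in> sets borel" using \<Omega> by (rule borel_open)
  define m where "m = distr V borel fst"
  have sets_m [measurable_cong]: "sets m = sets borel" by (simp add: m_def)
  have em: "emeasure m B = emeasure (mass \<Omega> V) (B \<inter> \<Omega>)" if [measurable]: "B \<in> sets borel" for B
  proof -
    have "emeasure m B = emeasure V (fst -` B \<inter> space V)"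
      using fst_V by (simp add: m_def emeasure_distr)
    also have "fst -` B \<inter> space V = (B \<inter> \<Omega>) \<times> grassmannian ?d" by (auto simp: space_V)
    also have "emeasure V ((B \<inter> \<Omega>) \<times> grassmannian ?d) = emeasure (mass \<Omega> V) (B \<inter> \<Omega>)"
      by (intro emeasure_mass[OF \<Omega> V, symmetric]) auto
    finally show ?thesis .
  qed
  have fin: "finite_measure m"
    by (rule finite_measureI) (use finite_mass in \<open>auto simp: em sets_eq_imp_space_eq[OF sets_m]\<close>)
  obtain C1 C2 where C: "0 < C1" "C1 < C2" and AE_bounds:
    "AE x in mass \<Omega> V. \<forall>r. 0 < r \<and> ereal r < dist_compl x \<Omega> \<and> ball x r \<subseteq> \<Omega> \<longrightarrow>
       ennreal (C1 * unit_ball_vol (real ?d) * r ^ ?d) \<le> emeasure (mass \<Omega> V) (ball x r) \<and>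
       emeasure (mass \<Omega> V) (ball x r) \<le> ennreal (C2 * unit_ball_vol (real ?d) * r ^ ?d)"
    using density_bounds by blast
  obtain N where N: "N \<in> null_sets (mass \<Omega> V)" and N_bounds:
    "\<And>x. x \<in> space (mass \<Omega> V) - N \<Longrightarrow> \<forall>r. 0 < r \<and> ereal r < dist_compl x \<Omega> \<and> ball x r \<subseteq> \<Omega> \<longrightarrow>
       ennreal (C1 * unit_ball_vol (real ?d) * r ^ ?d) \<le> emeasure (mass \<Omega> V) (ball x r) \<and>
       emeasure (mass \<Omega> V) (ball x r) \<le> ennreal (C2 * unit_ball_vol (real ?d) * r ^ ?d)"
    by (rule AE_E3[OF AE_bounds], rule that)
  have "space (mass \<Omega> V) = \<Omega>" by (simp add: mass_def space_restrict_space)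
  note N_bounds = N_bounds[unfolded this]
  have N_borel [measurable]: "N \<in> sets borel" and N_sub: "N \<subseteq> \<Omega>"
    using N by (auto simp: null_sets_def mass_def sets_restrict_space)
  define X where "X = \<Omega> - N"
  have X_borel [measurable]: "X \<in> sets borel" by (simp add: X_def)
  have XO: "X \<subseteq> \<Omega>" by (auto simp: X_def)
  have bd: "bounded_density ?d m x" if x: "x \<in> X" for x
  proof -
    obtain R where R: "0 < R" "ball x R \<subseteq> \<Omega>" using \<Omega> x XO openE by blast
    have "ereal R \<le> dist_compl x \<Omega>" unfolding dist_compl_def
    proof (rule INF_greatest)
      fix w assume "w \<in> - \<Omega>"
      then have "w \<notin> ball x R" using R(2) by blast
      then show "ereal R \<le> ereal (dist x w)" by simp
    qed
    then have "emeasure m (ball x r) \<le> ennreal ((C2 * unit_ball_vol (real ?d)) * r ^ ?d)"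
      if r: "0 < r \<and> r < R" for r
    proof -
      assume "ereal R \<le> dist_compl x \<Omega>"
      then have "ereal r < dist_compl x \<Omega>" using r by (metis less_ereal.simps(1) order_less_le_trans)
      moreover have sub: "ball x r \<subseteq> \<Omega>" using r R(2) subset_ball[of r R x] by auto
      ultimately have "emeasure (mass \<Omega> V) (ball x r) \<le> ennreal (C2 * unit_ball_vol (real ?d) * r ^ ?d)"
        using N_bounds[of x] x r unfolding X_def by blast
      then show ?thesis using sub by (simp add: em Int_absorb2)
    qed
    then show ?thesis unfolding bounded_density_def using R(1) by blast
  qed
  let ?bad = "{(x, P). (x, P) \<in> \<Omega> \<times> grassmannian ?d \<and> height_excess ?d \<Omega> x P V = \<infinity>}"
  define S where "S = closure X"
  have XS: "X \<subseteq> S" by (simp add: S_def closure_subset)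
  have tangent: "tangent_to S x P" if "x \<in> X" "P \<in> grassmannian ?d" "(x, P) \<notin> ?bad" for x P
    unfolding S_def
  proof (rule tangent_to_closure[OF grassmannian_subspace[OF that(2)]])
    show "tangent_to X x P"
    proof (rule tangent_to_of_height_excess[OF \<Omega> _ that(2) XO])
      show "0 < C1 * unit_ball_vol (real ?d)" using C(1) by simp
      show "height_excess ?d \<Omega> x P V < \<infinity>" using that XO by (auto simp: less_top)
      show "ennreal (C1 * unit_ball_vol (real ?d) * r ^ ?d) \<le> emeasure (mass \<Omega> V) (ball y r)"
        if "y \<in> X" "0 < r" "ereal r < dist_compl y \<Omega>" "ball y r \<subseteq> \<Omega>" for y r
        using N_bounds[of y] that unfolding X_def by blast
    qed (use that XO in auto)
  qed
  define e where "e n = 1 / (14 * real (Suc n))" for n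
  have e_bounds: "0 < e n" "14 * e n \<le> 1" for n by (auto simp: e_def field_simps)
  have e_lim: "e \<longlonglongrightarrow> 0"
    using tendsto_mult_right[OF LIMSEQ_inverse_real_of_nat, of "1 / 14"]
    by (simp add: e_def[abs_def] field_simps)
  have "\<exists>K Q :: nat \<Rightarrow> (real ^ 'n) set.
      (\<forall>i. compact (K i) \<and> K i \<subseteq> S \<and> Q i \<in> grassmannian ?d \<and> flat_over (e n) (Q i) (K i)) \<and>
      (\<forall>i x. x \<in> K i \<longrightarrow> (\<exists>\<delta>>0. \<forall>y\<in>S. dist x y < \<delta> \<longrightarrow> infdist (y - x) (Q i) \<le> e n * norm (y - x))) \<and>
      (\<forall>x P. x \<in> S \<longrightarrow> P \<in> grassmannian ?d \<longrightarrow> tangent_to S x P \<longrightarrow> (\<exists>i. x \<in> K i))" for n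
  proof -
    have "?d \<le> DIM(real ^ 'n)" "closed S" using dim by (auto simp: S_def)
    from ex_flat_pieces[OF this e_bounds(1)[of n]] show ?thesis by metis
  qed
  then obtain K Q :: "nat \<Rightarrow> nat \<Rightarrow> (real ^ 'n) set" where
    K: "\<And>n i. compact (K n i)" "\<And>n i. K n i \<subseteq> S" "\<And>n i. Q n i \<in> grassmannian ?d"
      "\<And>n i. flat_over (e n) (Q n i) (K n i)" and
    K_cone: "\<And>n i x. x \<in> K n i \<Longrightarrow>
       \<exists>\<delta>>0. \<forall>y\<in>S. dist x y < \<delta> \<longrightarrow> infdist (y - x) (Q n i) \<le> e n * norm (y - x)" and
    K_cover: "\<And>n x P. x \<in> S \<Longrightarrow> P \<in> grassmannian ?d \<Longrightarrow> tangent_to S x P \<Longrightarrow> \<exists>i. x \<in> K n i"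
    by metis
  have K_borel [measurable]: "K n i \<in> sets borel" for n i
    using K(1) by (intro borel_closed compact_imp_closed)
  define X' where "X' = X \<inter> (\<Inter>n. \<Union>i. K n i)"
  have X'_borel [measurable]: "X' \<in> sets borel" unfolding X'_def by measurable
  \<comment> \<open>A fibre of \<open>V\<close> over a point of \<open>X - X'\<close> consists of planes that are not tangent, hence of infinite
    excess.\<close>
  have m_X': "emeasure m (- X') = 0"
  proof -
    have "emeasure m (X - X') = emeasure V ((X - X') \<times> grassmannian ?d)"
      using XO by (simp add: em Int_absorb2 emeasure_mass[OF \<Omega> V] Diff_subset[THEN subset_trans])
    also have "\<dots> \<le> emeasure V ?bad"
    proof (rule emeasure_mono)
      show "(X - X') \<times> grassmannian ?d \<subseteq> ?bad"
      proof (rule subsetI, rule ccontr)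
        fix z assume z: "z \<in> (X - X') \<times> grassmannian ?d" and nb: "z \<notin> ?bad"
        obtain x P where xP: "z = (x, P)" "x \<in> X" "x \<notin> X'" "P \<in> grassmannian ?d" using z by auto
        have "tangent_to S x P" using xP nb by (intro tangent) auto
        then have "\<exists>i. x \<in> K n i" for n using xP XS by (intro K_cover) auto
        then show False using xP(2,3) by (auto simp: X'_def)
      qed
    qed (use excess in auto)
    also have "\<dots> = 0" using excess by auto
    finally have 1: "emeasure m (X - X') = 0" by simp
    have "emeasure m (- X) = emeasure (mass \<Omega> V) (- X \<inter> \<Omega>)" by (simp add: em)
    also have "- X \<inter> \<Omega> = N" using N_sub by (auto simp: X_def)
    finally have "emeasure m (- X) = 0" using N by auto
    then have "(X - X') \<union> - X \<in> null_sets m"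
      using 1 by (intro null_sets.Un) (auto simp: null_sets_def sets_m)
    moreover have "(X - X') \<union> - X = - X'" by (auto simp: X'_def)
    ultimately show ?thesis by auto
  qed
  interpret flat_pieces ?d m S X' K Q e
  proof (rule flat_pieces.intro)
    show "bounded_density ?d m x" if "x \<in> X'" for x using that by (intro bd) (simp add: X'_def)
    show "X' \<subseteq> (\<Union>i. K n i)" for n by (auto simp: X'_def)
  qed (rule d fin sets_m X'_borel m_X' K e_bounds e_lim)+
  obtain M where M_borel [measurable]: "M \<in> sets borel" and M: "M \<subseteq> X'" "M \<subseteq> (\<Union>i. K 0 i)"
    "\<And>x. x \<in> M \<Longrightarrow> 0 < \<theta> x" "emeasure m (- M) = 0"
    and m_dist: "m = distr (weighted_hausdorff ?d M \<theta>) borel (\<lambda>x. x)"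
    and close: "\<And>x n i P q. x \<in> M \<Longrightarrow> x \<in> K n i \<Longrightarrow> P \<in> grassmannian ?d \<Longrightarrow> tangent_to S x P \<Longrightarrow> q \<in> Q n i \<Longrightarrow>
       infdist q P \<le> 7 * e n * norm q"
    and blowup: "\<And>x P. x \<in> M \<Longrightarrow> P \<in> grassmannian ?d \<Longrightarrow> tangent_to S x P \<Longrightarrow> approx_tangent_space ?d M \<theta> x P"
    by (rule rectifiable_structure, rule that)
  have MX: "M \<subseteq> X" using M(1) by (auto simp: X'_def)
  have MO: "M \<subseteq> \<Omega>" using MX XO by blast
  have in_K: "\<exists>i. x \<in> K n i" if "x \<in> M" for x n using that M(1) by (auto simp: X'_def)
  have near: "grass_dist (Q n i) P \<le> 21 * e n"
    if "x \<in> M" "x \<in> K n i" "P \<in> grassmannian ?d" "tangent_to S x P" for x n i P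
    using grass_dist_le_gap[OF that(3) K(3) close[OF that]] e_bounds[of n]
    by (simp add: grass_dist_commute[of "Q n i" P])
  have ex_tangent: "\<exists>P. P \<in> grassmannian ?d \<and> tangent_to S x P" if x: "x \<in> M" for x
  proof -
    obtain i where i: "\<And>n. x \<in> K n (i n)" using in_K[OF x] by metis
    obtain P where P: "P \<in> grassmannian ?d" "\<And>\<epsilon> N. 0 < \<epsilon> \<Longrightarrow> \<exists>n\<ge>N. grass_dist (Q n (i n)) P < \<epsilon>"
      by (rule grassmannian_cluster_plane[of "\<lambda>n. Q n (i n)" ?d]) (use K(3) in auto)
    have "tangent_to S x P"
      unfolding tangent_to_def
    proof (intro allI impI)
      fix \<epsilon> :: real assume \<epsilon>: "0 < \<epsilon>"
      then obtain n0 where n0: "\<And>n. n0 \<le> n \<Longrightarrow> e n < \<epsilon> / 2"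
        using order_tendstoD(2)[OF e_lim, of "\<epsilon> / 2"] by (auto simp: eventually_sequentially)
      obtain n where n: "n0 \<le> n" "grass_dist (Q n (i n)) P < \<epsilon> / 2"
        using P(2)[of "\<epsilon> / 2" n0] \<epsilon> by auto
      obtain \<delta> where \<delta>: "0 < \<delta>"
        "\<And>y. y \<in> S \<Longrightarrow> dist x y < \<delta> \<Longrightarrow> infdist (y - x) (Q n (i n)) \<le> e n * norm (y - x)"
        using K_cone[OF i[of n]] by blast
      have "infdist (y - x) P \<le> \<epsilon> * norm (y - x)" if y: "y \<in> S" "dist x y < \<delta>" for y
      proof -
        have "infdist (y - x) P \<le> infdist (y - x) (Q n (i n)) + grass_dist (Q n (i n)) P * norm (y - x)"
          by (intro infdist_plane_le grassmannian_subspace[OF K(3)] grassmannian_subspace[OF P(1)])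
        also have "\<dots> \<le> e n * norm (y - x) + \<epsilon> / 2 * norm (y - x)"
          using n(2) by (intro add_mono \<delta>(2) y mult_right_mono) auto
        also have "\<dots> \<le> \<epsilon> / 2 * norm (y - x) + \<epsilon> / 2 * norm (y - x)"
          using n0[OF n(1)] by (intro add_right_mono mult_right_mono) auto
        finally show ?thesis by (simp add: field_simps)
      qed
      then show "\<exists>\<delta>>0. \<forall>y\<in>S. dist x y < \<delta> \<longrightarrow> infdist (y - x) P \<le> \<epsilon> * norm (y - x)"
        using \<delta>(1) by blast
    qed
    then show ?thesis using P(1) by blast
  qed
  \<comment> \<open>Existence on all of \<open>M\<close>, and not just for almost every \<open>x\<close> in the sense of \<open>V\<close>, comes from the
    compactness argument above: a limit of reference planes of flatter and flatter pieces is tangent.\<close>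
  define T where "T x = (SOME P. P \<in> grassmannian ?d \<and> tangent_to S x P)" for x
  have T: "T x \<in> grassmannian ?d" "tangent_to S x (T x)" if "x \<in> M" for x
    using someI_ex[OF ex_tangent[OF that]] by (auto simp: T_def)
  have T_unique: "P = T x" if x: "x \<in> M" and P: "P \<in> grassmannian ?d" "tangent_to S x P" for x P
  proof -
    obtain i where i: "\<And>n. x \<in> K n (i n)" using in_K[OF x] by metis
    have le: "grass_dist P (T x) \<le> 42 * e n" for n
    proof -
      have "grass_dist P (T x) \<le> grass_dist P (Q n (i n)) + grass_dist (Q n (i n)) (T x)"
        by (rule Metric_space.triangle[OF Metric_space_grassmannian P(1) K(3) T(1)[OF x]])
      then show ?thesis
        using near[OF x i[of n] P] near[OF x i[of n] T[OF x]] grass_dist_commute[of P "Q n (i n)"]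
        by linarith
    qed
    have "(\<lambda>n. 42 * e n) \<longlonglongrightarrow> 42 * 0" by (intro tendsto_intros e_lim)
    then have "grass_dist P (T x) \<le> 42 * 0" by (rule LIMSEQ_le_const) (use le in auto)
    moreover have "0 \<le> grass_dist P (T x)" by (rule Metric_space.nonneg[OF Metric_space_grassmannian])
    ultimately show ?thesis
      using Metric_space.zero[OF Metric_space_grassmannian P(1) T(1)[OF x]] by simp
  qed
  have AE_T: "AE z in V. fst z \<in> M \<and> snd z = T (fst z)"
  proof -
    have "AE x in m. x \<in> M"
      by (rule AE_I'[of "- M"]) (use M(4) in \<open>auto simp: null_sets_def sets_m\<close>)
    then have "AE z in V. fst z \<in> M" unfolding m_def by (subst (asm) AE_distr_iff) (use fst_V in auto)
    moreover have "AE z in V. z \<notin> ?bad" using excess by (rule AE_not_in)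
    ultimately show ?thesis using AE_space
    proof eventually_elim
      case (elim z)
      then have "snd z \<in> grassmannian ?d" by (auto simp: space_V)
      then have "tangent_to S (fst z) (snd z)" using elim MX by (intro tangent) auto
      then show ?case using T_unique elim(1) \<open>snd z \<in> grassmannian ?d\<close> by blast
    qed
  qed
  have idw: "(\<lambda>x. x) \<in> borel_measurable (weighted_hausdorff ?d M \<theta>)"
    unfolding weighted_hausdorff_def by (rule id_measurable_hausdorff[OF d])
  have MH [measurable]: "M \<in> sets (hausdorff_measure ?d)"
    by (rule borel_in_sets_hausdorff_measure[OF d M_borel])
  have \<theta>H [measurable]: "\<theta> \<in> borel_measurable (hausdorff_measure ?d)"
    by (rule borel_measurable_hausdorff_measure[OF d \<theta>_borel])
  interpret m: finite_measure m by (rule fin)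
  have representation: "set_integrable (hausdorff_measure ?d) M (\<lambda>x. \<phi> (x, T x) * \<theta> x) \<and>
      (\<integral>z. \<phi> z \<partial>V) = (LINT x:M|hausdorff_measure ?d. \<phi> (x, T x) * \<theta> x)" if \<phi>: "\<phi> \<in> Cc ?W" for \<phi>
  proof -
    have cont: "continuous_map ?W euclideanreal \<phi>"
      and comp: "compactin ?W (?W closure_of {z \<in> topspace ?W. \<phi> z \<noteq> 0})" using \<phi> by (auto simp: Cc_def)
    have \<phi>_V [measurable]: "\<phi> \<in> borel_measurable V"
      by (rule continuous_map_measurable_varifold[OF V cont])
    obtain b where b: "0 \<le> b" "\<And>z. z \<in> topspace ?W \<Longrightarrow> \<bar>\<phi> z\<bar> \<le> b"
    proof -
      have "bounded (\<phi> ` (?W closure_of {z \<in> topspace ?W. \<phi> z \<noteq> 0}))"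
        using image_compactin[OF comp cont] by (simp add: compact_imp_bounded)
      then obtain b where b: "\<And>z. z \<in> ?W closure_of {z \<in> topspace ?W. \<phi> z \<noteq> 0} \<Longrightarrow> \<bar>\<phi> z\<bar> \<le> b"
        unfolding bounded_iff by auto
      have "\<bar>\<phi> z\<bar> \<le> max b 0" if "z \<in> topspace ?W" for z
      proof (cases "\<phi> z = 0")
        case False
        then have "z \<in> ?W closure_of {z \<in> topspace ?W. \<phi> z \<noteq> 0}"
          using closure_of_subset[of "{z \<in> topspace ?W. \<phi> z \<noteq> 0}" ?W] that by auto
        then show ?thesis using b by (simp add: le_max_iff_disj)
      qed simp
      then show thesis by (intro that[of "max b 0"]) auto
    qed
    define \<psi> where "\<psi> x = indicator M x * \<phi> (x, T x)" for x
    \<comment> \<open>Measurability of \<open>\<psi>\<close>: the reference plane of the first \<open>n\<close>-th generation piece containing \<open>x\<close> takes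
      countably many values and converges to \<open>T x\<close>.\<close>
    define idx where "idx n x = (LEAST i. x \<in> K n i)" for n x
    have slice [measurable]: "(\<lambda>x. indicator \<Omega> x * \<phi> (x, R)) \<in> borel_measurable borel"
      if R: "R \<in> grassmannian ?d" for R
    proof -
      have "continuous_map (top_of_set \<Omega>) ?W (\<lambda>x. (x, R))"
        unfolding varifold_space_def using R
        by (intro continuous_map_pairedI)
           (auto simp: grass_topology_def Metric_space.topspace_mtopology[OF Metric_space_grassmannian])
      then have "continuous_map (top_of_set \<Omega>) euclideanreal (\<phi> \<circ> (\<lambda>x. (x, R)))"
        using cont by (rule continuous_map_compose)
      then have "continuous_on \<Omega> (\<lambda>x. \<phi> (x, R))" by (simp add: o_def)
      from borel_measurable_continuous_on_indicator[OF \<Omega>_borel this] show ?thesis by simp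
    qed
    have idx_meas [measurable]: "idx n \<in> measurable borel (count_space UNIV)" for n
      unfolding idx_def[abs_def] by measurable
    have \<psi>n [measurable]: "(\<lambda>x. indicator M x * (indicator \<Omega> x * \<phi> (x, Q n (idx n x)))) \<in> borel_measurable borel" for n
    proof -
      have "(\<lambda>x. (\<lambda>i x. indicator \<Omega> x * \<phi> (x, Q n i)) (idx n x) x) \<in> borel_measurable borel"
        by (rule measurable_compose_countable[OF slice[OF K(3)] idx_meas])
      then show ?thesis by (rule borel_measurable_times[OF borel_measurable_indicator[OF M_borel]])
    qed
    have lim: "(\<lambda>n. indicator M x * (indicator \<Omega> x * \<phi> (x, Q n (idx n x)))) \<longlonglongrightarrow> \<psi> x" for x
    proof (cases "x \<in> M")
      case True
      have idx: "x \<in> K n (idx n x)" for n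
        unfolding idx_def using in_K[OF True] by (rule LeastI_ex)
      have "(\<lambda>n. grass_dist (Q n (idx n x)) (T x)) \<longlonglongrightarrow> 0"
      proof (rule tendsto_sandwich[where f = "\<lambda>_. 0" and h = "\<lambda>n. 21 * e n"])
        show "(\<lambda>n. 21 * e n) \<longlonglongrightarrow> 0" using tendsto_mult_left[OF e_lim, of 21] by simp
        show "\<forall>\<^sub>F n in sequentially. grass_dist (Q n (idx n x)) (T x) \<le> 21 * e n"
          using near[OF True idx T[OF True]] by simp
        show "\<forall>\<^sub>F n in sequentially. 0 \<le> grass_dist (Q n (idx n x)) (T x)"
          using Metric_space.nonneg[OF Metric_space_grassmannian] by (intro always_eventually allI)
      qed simp
      then have "limitin ?W (\<lambda>n. (x, Q n (idx n x))) (x, T x) sequentially"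
        using True MO T(1) K(3) by (intro limitin_varifold_space) auto
      then have "limitin euclideanreal (\<phi> \<circ> (\<lambda>n. (x, Q n (idx n x)))) (\<phi> (x, T x)) sequentially"
        using cont by (rule continuous_map_limit[rotated])
      then show ?thesis using True MO by (auto simp: \<psi>_def o_def)
    qed (simp add: \<psi>_def)
    have \<psi>_borel [measurable]: "\<psi> \<in> borel_measurable borel"
      by (rule borel_measurable_LIMSEQ_real[OF lim \<psi>n])
    have \<psi>H [measurable]: "\<psi> \<in> borel_measurable (hausdorff_measure ?d)"
      by (rule borel_measurable_hausdorff_measure[OF d \<psi>_borel])
    have \<psi>_bound: "\<bar>\<psi> x\<bar> \<le> b" for x
      using b T(1) MO by (auto simp: \<psi>_def indicator_def topspace_varifold_space)
    have int_m: "integrable m \<psi>" using \<psi>_bound by (intro m.integrable_const_bound[of _ b]) auto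
    have int_w: "integrable (weighted_hausdorff ?d M \<theta>) \<psi>"
      using int_m by (subst (asm) m_dist, subst (asm) integrable_distr_eq[OF idw]) auto
    have w_eq: "weighted_hausdorff ?d M \<theta> = density (hausdorff_measure ?d) (\<lambda>x. ennreal (\<theta> x * indicator M x))"
      unfolding weighted_hausdorff_def by (intro arg_cong2[where f = density]) (auto simp: indicator_def)
    have int_H: "integrable (hausdorff_measure ?d) (\<lambda>x. (\<theta> x * indicator M x) *\<^sub>R \<psi> x)"
      using int_w \<theta>_nonneg unfolding w_eq by (subst (asm) integrable_density) auto
    have eq: "(\<theta> x * indicator M x) *\<^sub>R \<psi> x = indicator M x *\<^sub>R (\<phi> (x, T x) * \<theta> x)" for x
      by (simp add: \<psi>_def indicator_def)
    have int: "set_integrable (hausdorff_measure ?d) M (\<lambda>x. \<phi> (x, T x) * \<theta> x)"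
      using int_H unfolding set_integrable_def eq .
    have "(\<integral>z. \<phi> z \<partial>V) = (\<integral>z. \<psi> (fst z) \<partial>V)"
    proof (rule integral_cong_AE)
      show "(\<lambda>z. \<psi> (fst z)) \<in> borel_measurable V" using fst_V \<psi>_borel by (rule measurable_compose)
      show "AE z in V. \<phi> z = \<psi> (fst z)"
        using AE_T by eventually_elim (auto simp: \<psi>_def)
    qed measurable
    also have "\<dots> = (\<integral>x. \<psi> x \<partial>m)" unfolding m_def by (rule integral_distr[symmetric, OF fst_V \<psi>_borel])
    also have "\<dots> = (\<integral>x. \<psi> x \<partial>weighted_hausdorff ?d M \<theta>)"
      by (subst m_dist, subst integral_distr[OF idw]) auto
    also have "\<dots> = (\<integral>x. (\<theta> x * indicator M x) *\<^sub>R \<psi> x \<partial>hausdorff_measure ?d)"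
      unfolding w_eq using \<theta>_nonneg by (subst integral_density) auto
    also have "\<dots> = (LINT x:M|hausdorff_measure ?d. \<phi> (x, T x) * \<theta> x)"
      unfolding set_lebesgue_integral_def by (simp only: eq)
    finally show ?thesis using int by blast
  qed
  have rect: "countably_rectifiable TYPE('d) M"
  proof -
    have "\<exists>(f :: real ^ 'd \<Rightarrow> real ^ 'n) L. L-lipschitz_on UNIV f \<and> K 0 i \<subseteq> range f" for i
      using e_bounds(2)[of 0] by (intro flat_subset_lipschitz_range[OF K(3) K(4)]) auto
    then obtain f :: "nat \<Rightarrow> real ^ 'd \<Rightarrow> real ^ 'n" where
      f: "\<And>i. \<exists>L. L-lipschitz_on UNIV (f i)" "\<And>i. K 0 i \<subseteq> range (f i)" by metis
    then show ?thesis
      unfolding countably_rectifiable_def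
    proof (intro exI[of _ "{}"] exI[of _ f] conjI allI)
      show "hausdorff_outer ?d ({} :: (real ^ 'n) set) = 0" by (rule hausdorff_outer_empty[OF d])
      show "\<exists>L. L-lipschitz_on UNIV (f i)" for i by (rule f(1))
      show "M \<subseteq> {} \<union> (\<Union>i. range (f i))"
      proof
        fix x assume "x \<in> M"
        then have "x \<in> (\<Union>i. K 0 i)" using M(2) by (rule subsetD[rotated])
        then obtain i where "x \<in> K 0 i" by (rule UN_E)
        then have "x \<in> range (f i)" using f(2) by (rule subsetD[rotated])
        then show "x \<in> {} \<union> (\<Union>i. range (f i))" by (intro UnI2 UN_I[OF UNIV_I])
      qed
    qed
  qed
  show ?thesis
    unfolding rectifiable_varifold_def
  proof (intro conjI V exI[of _ M] exI[of _ \<theta>] exI[of _ T])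
    show "AE x in hausdorff_measure ?d. x \<in> M \<longrightarrow> 0 < \<theta> x" using M(3) by auto
    show "AE x in hausdorff_measure ?d. x \<in> M \<longrightarrow> approx_tangent_space ?d M \<theta> x (T x)"
      using blowup T by auto
  qed (use MO MH rect \<theta>_nonneg representation in auto)
qed

end
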